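(* Let $G=(A\uplus B,E)$ be a planar bipartite graph and let $<$ be a $(2,2)$-admissible order on $A\uplus B$. Then $K_{3,3}$ is not a subgraph of $G^{b,<}$. Equivalently, every planar bipartite graph is $(2,2)$-stress free.
   Context: All graphs are finite and simple. A bipartite graph $G=(A\uplus B,E)$ has a fixed bipartition; identify $A=\{1<\dots<n\}$, $B=\{1'<\dots<m'\}$ and write $ij'$ for the pair $\{i,j'\}$. Let $S=\mathbb{R}[x_1,\dots,x_n,y_1,\dots,y_m]$, $I_G$ the ideal generated by all $x_ix_j$ ($i<j$), all $y_iy_j$ ($i<j$) and all $x_iy_j$ with $ij'\notin E$, and $\mathbb{R}[G]=S/I_G$, $\mathbb{Z}^2$-graded by $\deg x_i=(1,0)$, $\deg y_j=(0,1)$. Fix generic reals (e.g. algebraically independent over $\mathbb{Q}$) $\theta_{ij}$ ($1\le i,j\le n$), $\theta_{s't'}$ ($1\le s,t\le m$) and put $\theta_i=\sum_j\theta_{ij}x_j$, $\theta_{s'}=\sum_t\theta_{s't'}y_t$. For a total order $<$ on $A\uplus B$ extending the natural orders on $A$ and $B$, with induced lexicographic order $<_{\mathrm{lex}}$ on pairs $ij'$, the balanced shifting $G^{b,<}$ is the bipartite graph on $A\uplus B$ whose edges are the $ij'$ with $\theta_i\theta_{j'}\notin\operatorname{span}\{\theta_p\theta_{q'}:pq'<_{\mathrm{lex}}ij'\}\subseteq\mathbb{R}[G]_{(1,1)}$. The order is $(k,l)$-admissible if $\{1,\dots,k\}\cup\{1',\dots,l'\}$ is an initial segment of it. $G$ is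 $(k,l)$-stress free if $(k+1)(l+1)'$ is not an edge of $G^{b,<}$ for a $(k,l)$-admissible order $<$ (this does not depend on the choice of such order). *)

theory Defs
  imports
    "HOL-Analysis.Analysis"
    "HOL-Algebra.QuotRing"
    "HOL-Library.Poly_Mapping"
begin

section \<open>Graphs and planarity\<close>

text \<open>A finite simple graph is a pair of a vertex set and a set of two-element sets of vertices.\<close>

type_synonym 'v graph = "'v set \<times> 'v set set"

definition subgraph_copy :: "'u graph \<Rightarrow> 'v graph \<Rightarrow> bool" where
  "subgraph_copy H G \<longleftrightarrow>
     (\<exists>f. inj_on f (fst H) \<and> f ` fst H \<subseteq> fst G \<and> (\<forall>e\<in>snd H. f ` e \<in> snd G))"

text \<open>
  Embeddings are into the complex plane; edges are arbitrary Jordan arcs.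
\<close>

definition planar :: "'v graph \<Rightarrow> bool" where
  "planar G \<longleftrightarrow>
     (\<exists>(pos :: 'v \<Rightarrow> complex) (curve :: 'v set \<Rightarrow> real \<Rightarrow> complex).
        inj_on pos (fst G) \<and>
        (\<forall>e\<in>snd G. arc (curve e) \<and>
           {pathstart (curve e), pathfinish (curve e)} = pos ` e \<and>
           path_image (curve e) \<inter> pos ` fst G = pos ` e) \<and>
        (\<forall>e\<in>snd G. \<forall>e'\<in>snd G. e \<noteq> e' \<longrightarrow>
           path_image (curve e) \<inter> path_image (curve e') \<subseteq> pos ` (e \<inter> e')))"

text \<open>
  The sides \<open>A = {1 < \<dots> < n}\<close> and \<open>B = {1' < \<dots> < m'}\<close> are tagged by \<^const>\<open>Inl\<close> and
  \<^const>\<open>Inr\<close>; an edge \<open>ij'\<close> is given by the pair \<open>(i, j)\<close>.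
\<close>

definition bip_verts :: "nat \<Rightarrow> nat \<Rightarrow> (nat + nat) set" where
  "bip_verts n m = Inl ` {1..n} \<union> Inr ` {1..m}"

definition pair_set :: "nat \<times> nat \<Rightarrow> (nat + nat) set" where
  "pair_set ij = {Inl (fst ij), Inr (snd ij)}"

definition bip_graph :: "nat \<Rightarrow> nat \<Rightarrow> (nat \<times> nat) set \<Rightarrow> (nat + nat) graph" where
  "bip_graph n m E = (bip_verts n m, pair_set ` E)"

definition complete_bipartite :: "nat \<Rightarrow> nat \<Rightarrow> (nat + nat) graph" where
  "complete_bipartite r s = bip_graph r s ({1..r} \<times> {1..s})"


section \<open>Multivariate polynomials\<close>

type_synonym ('v, 'a) mpoly = "('v \<Rightarrow>\<^sub>0 nat) \<Rightarrow>\<^sub>0 'a"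

definition mvars :: "('v, 'a::zero) mpoly \<Rightarrow> 'v set" where
  "mvars p = (\<Union>t\<in>Poly_Mapping.keys p. Poly_Mapping.keys t)"

definition mconst :: "'a::zero \<Rightarrow> ('v, 'a) mpoly" where
  "mconst c = Poly_Mapping.single 0 c"

definition mvar :: "'v \<Rightarrow> ('v, 'a::zero_neq_one) mpoly" where
  "mvar v = Poly_Mapping.single (Poly_Mapping.single v 1) 1"

definition meval_rat :: "('v, rat) mpoly \<Rightarrow> ('v \<Rightarrow> real) \<Rightarrow> real" where
  "meval_rat p a =
     (\<Sum>t\<in>Poly_Mapping.keys p. of_rat (Poly_Mapping.lookup p t) *
        (\<Prod>v\<in>Poly_Mapping.keys t. a v ^ Poly_Mapping.lookup t v))"

definition alg_independent_rat :: "'v set \<Rightarrow> ('v \<Rightarrow> real) \<Rightarrow> bool" where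
  "alg_independent_rat V a \<longleftrightarrow>
     (\<forall>p. mvars p \<subseteq> V \<and> meval_rat p a = 0 \<longrightarrow> p = 0)"

text \<open>
  \<open>a i j\<close> stands for \<open>\<theta>\<^sub>i\<^sub>j\<close> and \<open>b s t\<close> for \<open>\<theta>\<^sub>s\<^sub>'\<^sub>t\<^sub>'\<close>; all \<open>n\<^sup>2 + m\<^sup>2\<close> numbers are jointly
  algebraically independent.
\<close>

definition generic :: "nat \<Rightarrow> nat \<Rightarrow> (nat \<Rightarrow> nat \<Rightarrow> real) \<Rightarrow> (nat \<Rightarrow> nat \<Rightarrow> real) \<Rightarrow> bool" where
  "generic n m a b \<longleftrightarrow>
     alg_independent_rat (Inl ` ({1..n} \<times> {1..n}) \<union> Inr ` ({1..m} \<times> {1..m}))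
       (case_sum (\<lambda>(i, j). a i j) (\<lambda>(s, t). b s t))"


section \<open>The ring \<open>\<real>[G]\<close>\<close>

definition poly_ring :: "nat \<Rightarrow> nat \<Rightarrow> (nat + nat, real) mpoly ring" where
  "poly_ring n m =
     \<lparr>carrier = {p. mvars p \<subseteq> bip_verts n m}, monoid.mult = (*), one = 1, zero = 0, add = (+)\<rparr>"

definition graph_ideal_gens :: "nat \<Rightarrow> nat \<Rightarrow> (nat \<times> nat) set \<Rightarrow> (nat + nat, real) mpoly set" where
  "graph_ideal_gens n m E =
     {mvar (Inl i) * mvar (Inl j) | i j. i \<in> {1..n} \<and> j \<in> {1..n} \<and> i < j} \<union>
     {mvar (Inr i) * mvar (Inr j) | i j. i \<in> {1..m} \<and> j \<in> {1..m} \<and> i < j} \<union>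
     {mvar (Inl i) * mvar (Inr j) | i j. i \<in> {1..n} \<and> j \<in> {1..m} \<and> (i, j) \<notin> E}"

definition graph_ideal :: "nat \<Rightarrow> nat \<Rightarrow> (nat \<times> nat) set \<Rightarrow> (nat + nat, real) mpoly set" where
  "graph_ideal n m E = Idl\<^bsub>poly_ring n m\<^esub> (graph_ideal_gens n m E)"

definition graph_ring :: "nat \<Rightarrow> nat \<Rightarrow> (nat \<times> nat) set \<Rightarrow> (nat + nat, real) mpoly set ring" where
  "graph_ring n m E = poly_ring n m Quot graph_ideal n m E"

definition residue_class ::
  "nat \<Rightarrow> nat \<Rightarrow> (nat \<times> nat) set \<Rightarrow> (nat + nat, real) mpoly \<Rightarrow> (nat + nat, real) mpoly set" where
  "residue_class n m E p = graph_ideal n m E +>\<^bsub>poly_ring n m\<^esub> p"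

text \<open>The real linear span in \<open>\<real>[G]\<close> of a family \<open>f\<close> indexed by a finite set \<open>K\<close>.\<close>

definition graph_ring_span ::
  "nat \<Rightarrow> nat \<Rightarrow> (nat \<times> nat) set \<Rightarrow> ('k \<Rightarrow> (nat + nat, real) mpoly set) \<Rightarrow> 'k set
     \<Rightarrow> (nat + nat, real) mpoly set set" where
  "graph_ring_span n m E f K =
     {\<Oplus>\<^bsub>graph_ring n m E\<^esub>k\<in>K. residue_class n m E (mconst (c k)) \<otimes>\<^bsub>graph_ring n m E\<^esub> f k
        | c :: 'k \<Rightarrow> real. True}"


section \<open>Balanced shifting\<close>

definition theta_A :: "nat \<Rightarrow> (nat \<Rightarrow> nat \<Rightarrow> real) \<Rightarrow> nat \<Rightarrow> (nat + nat, real) mpoly" where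
  "theta_A n a i = (\<Sum>j\<in>{1..n}. mconst (a i j) * mvar (Inl j))"

definition theta_B :: "nat \<Rightarrow> (nat \<Rightarrow> nat \<Rightarrow> real) \<Rightarrow> nat \<Rightarrow> (nat + nat, real) mpoly" where
  "theta_B m b s = (\<Sum>t\<in>{1..m}. mconst (b s t) * mvar (Inr t))"

definition theta_prod ::
  "nat \<Rightarrow> nat \<Rightarrow> (nat \<times> nat) set \<Rightarrow> (nat \<Rightarrow> nat \<Rightarrow> real) \<Rightarrow> (nat \<Rightarrow> nat \<Rightarrow> real)
     \<Rightarrow> nat \<times> nat \<Rightarrow> (nat + nat, real) mpoly set" where
  "theta_prod n m E a b ij = residue_class n m E (theta_A n a (fst ij) * theta_B m b (snd ij))"

definition bip_order :: "nat \<Rightarrow> nat \<Rightarrow> (nat + nat) rel \<Rightarrow> bool" where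
  "bip_order n m r \<longleftrightarrow>
     strict_linear_order_on (bip_verts n m) r \<and>
     (\<forall>i\<in>{1..n}. \<forall>j\<in>{1..n}. i < j \<longrightarrow> (Inl i, Inl j) \<in> r) \<and>
     (\<forall>i\<in>{1..m}. \<forall>j\<in>{1..m}. i < j \<longrightarrow> (Inr i, Inr j) \<in> r)"

text \<open>
  Lexicographic order on finite sets: the least element of the symmetric difference of \<open>S\<close> and
  \<open>T\<close> belongs to \<open>S\<close>. For two-element sets this compares the smaller elements first, then the
  larger ones, whichever of the two sides they lie on.
\<close>

definition lex_less :: "'v rel \<Rightarrow> 'v set \<Rightarrow> 'v set \<Rightarrow> bool" where
  "lex_less r S T \<longleftrightarrow>
     (\<exists>x\<in>S - T. \<forall>y\<in>(S - T) \<union> (T - S). y \<noteq> x \<longrightarrow> (x, y) \<in> r)"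

definition balanced_shifting ::
  "nat \<Rightarrow> nat \<Rightarrow> (nat \<times> nat) set \<Rightarrow> (nat \<Rightarrow> nat \<Rightarrow> real) \<Rightarrow> (nat \<Rightarrow> nat \<Rightarrow> real)
     \<Rightarrow> (nat + nat) rel \<Rightarrow> (nat \<times> nat) set" where
  "balanced_shifting n m E a b r =
     {ij \<in> {1..n} \<times> {1..m}. theta_prod n m E a b ij \<notin>
        graph_ring_span n m E (theta_prod n m E a b)
          {pq \<in> {1..n} \<times> {1..m}. lex_less r (pair_set pq) (pair_set ij)}}"

text \<open>
  If \<open>k > n\<close> or \<open>l > m\<close>, the initial segment consists of those among \<open>1, \<dots>, k, 1', \<dots>, l'\<close>
  that are vertices.
\<close>

definition admissible :: "nat \<Rightarrow> nat \<Rightarrow> nat \<Rightarrow> nat \<Rightarrow> (nat + nat) rel \<Rightarrow> bool" where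
  "admissible n m k l r \<longleftrightarrow>
     bip_order n m r \<and>
     (\<forall>v\<in>bip_verts n m. \<forall>w\<in>bip_verts n m \<inter> bip_verts k l. (v, w) \<in> r \<longrightarrow> v \<in> bip_verts k l)"

definition stress_free ::
  "nat \<Rightarrow> nat \<Rightarrow> (nat \<times> nat) set \<Rightarrow> (nat \<Rightarrow> nat \<Rightarrow> real) \<Rightarrow> (nat \<Rightarrow> nat \<Rightarrow> real)
     \<Rightarrow> nat \<Rightarrow> nat \<Rightarrow> bool" where
  "stress_free n m E a b k l \<longleftrightarrow>
     (\<exists>r. admissible n m k l r \<and> (k + 1, l + 1) \<notin> balanced_shifting n m E a b r)"

lemma lex_below_admissible:
  assumes adm: "admissible n m k l r" and kn: "k + 1 \<le> n" and lm: "l + 1 \<le> m"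
  shows "{pq \<in> {1..n} \<times> {1..m}. lex_less r (pair_set pq) (pair_set (k + 1, l + 1))} =
         {pq \<in> {1..n} \<times> {1..m}. fst pq \<le> k \<or> snd pq \<le> l}"
proof -
  have trans: "trans r" and irr: "irrefl r" and tot: "total_on (bip_verts n m) r"
    using adm by (auto simp: admissible_def bip_order_def strict_linear_order_on_def)
  have ordA: "(Inl i, Inl j) \<in> r" if "1 \<le> i" "i < j" "j \<le> n" for i j
    using adm that by (auto simp: admissible_def bip_order_def)
  have ordB: "(Inr i, Inr j) \<in> r" if "1 \<le> i" "i < j" "j \<le> m" for i j
    using adm that by (auto simp: admissible_def bip_order_def)
  have asym: "(v, u) \<notin> r" if "(u, v) \<in> r" for u v
    using transD[OF trans that] irreflD[OF irr] by blast
  have init: "(u, w) \<in> r"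
    if "u \<in> bip_verts n m" "u \<in> bip_verts k l" "w \<in> bip_verts n m" "w \<notin> bip_verts k l" for u w
  proof -
    have "u \<noteq> w" using that by auto
    then have "(u, w) \<in> r \<or> (w, u) \<in> r" using tot that unfolding total_on_def by simp
    moreover have "(w, u) \<notin> r" using adm that unfolding admissible_def by blast
    ultimately show ?thesis by simp
  qed
  have "lex_less r (pair_set (p, q)) (pair_set (k + 1, l + 1)) \<longleftrightarrow> p \<le> k \<or> q \<le> l"
    if pq: "1 \<le> p" "p \<le> n" "1 \<le> q" "q \<le> m" for p q
  proof
    assume lex: "lex_less r (pair_set (p, q)) (pair_set (k + 1, l + 1))"
    show "p \<le> k \<or> q \<le> l"
    proof (rule ccontr)
      assume "\<not> (p \<le> k \<or> q \<le> l)"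
      then have "k < p" "l < q" by auto
      with lex have "k + 1 < p \<and> (Inl p, Inl (k + 1)) \<in> r \<or> l + 1 < q \<and> (Inr q, Inr (l + 1)) \<in> r"
        by (auto simp: lex_less_def pair_set_def)
      then show False
        using asym ordA[of "k + 1" p] ordB[of "l + 1" q] pq by auto
    qed
  next
    assume low: "p \<le> k \<or> q \<le> l"
    have V: "Inl p \<in> bip_verts n m" "Inr q \<in> bip_verts n m"
        "Inl (k + 1) \<in> bip_verts n m" "Inr (l + 1) \<in> bip_verts n m"
      and K: "Inl (k + 1) \<notin> bip_verts k l" "Inr (l + 1) \<notin> bip_verts k l"
        "Inl p \<in> bip_verts k l \<longleftrightarrow> p \<le> k" "Inr q \<in> bip_verts k l \<longleftrightarrow> q \<le> l"
      using pq kn lm by (auto simp: bip_verts_def)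
    consider "p \<le> k" "q \<le> l" "(Inl p, Inr q) \<in> r" | "p \<le> k" "q \<le> l" "(Inr q, Inl p) \<in> r"
      | "p \<le> k" "\<not> q \<le> l" | "\<not> p \<le> k" "q \<le> l"
      using low V tot unfolding total_on_def by blast
    then show "lex_less r (pair_set (p, q)) (pair_set (k + 1, l + 1))"
    proof cases
      case 1
      then show ?thesis
        using init[OF V(1) _ V(3)] init[OF V(1) _ V(4)] K
        unfolding lex_less_def pair_set_def by (intro bexI[of _ "Inl p"]) auto
    next
      case 2
      then show ?thesis
        using init[OF V(2) _ V(3)] init[OF V(2) _ V(4)] K
        unfolding lex_less_def pair_set_def by (intro bexI[of _ "Inr q"]) auto
    next
      case 3
      then show ?thesis
        using init[OF V(1) _ V(3)] init[OF V(1) _ V(4)] init[OF V(1) _ V(2)] K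
        unfolding lex_less_def pair_set_def by (intro bexI[of _ "Inl p"]) auto
    next
      case 4
      then show ?thesis
        using init[OF V(2) _ V(3)] init[OF V(2) _ V(4)] init[OF V(2) _ V(1)] K
        unfolding lex_less_def pair_set_def by (intro bexI[of _ "Inr q"]) auto
    qed
  qed
  then show ?thesis by auto
qed

text \<open>Stress freeness does not depend on the admissible order.\<close>

lemma stress_free_iff:
  assumes "admissible n m k l r"
  shows "stress_free n m E a b k l \<longleftrightarrow> (k + 1, l + 1) \<notin> balanced_shifting n m E a b r"
proof -
  have "(k + 1, l + 1) \<in> balanced_shifting n m E a b r \<longleftrightarrow>
        k + 1 \<le> n \<and> l + 1 \<le> m \<and> theta_prod n m E a b (k + 1, l + 1) \<notin>
          graph_ring_span n m E (theta_prod n m E a b)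
            {pq \<in> {1..n} \<times> {1..m}. fst pq \<le> k \<or> snd pq \<le> l}"
    if "admissible n m k l r" for r
  proof (cases "k + 1 \<le> n \<and> l + 1 \<le> m")
    case True
    then show ?thesis
      using lex_below_admissible[OF that] by (simp add: balanced_shifting_def)
  next
    case False
    then show ?thesis by (auto simp: balanced_shifting_def)
  qed
  then show ?thesis
    using assms unfolding stress_free_def by blast
qed

end

theory Submission
  imports Defs "Jordan_Normal_Form.Determinant"
begin

text \<open>
  A linear functional on \<open>\<real>[G]\<close> in degree \<open>(1, 1)\<close> which kills all \<open>\<theta>\<^sub>p\<theta>\<^sub>q\<^sub>'\<close> with \<open>p \<le> 2\<close> or \<open>q \<le> 2\<close>
  is a stress: a weight on the edges such that at every vertex the weighted sum of the (generic,
  planar) position vectors of its neighbours is zero. If there is no nonzero stress, these products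
  span and no \<open>ij'\<close> with \<open>i, j \<ge> 3\<close> survives in the shifted graph.

  Planarity enters only through the absence of a \<open>K\<^sub>3\<^sub>,\<^sub>3\<close> minor, which follows from Janiszewski's
  theorem. A minimal bipartite graph without \<open>K\<^sub>3\<^sub>,\<^sub>3\<close> minor that carries a stress has no vertex of
  degree at most \<open>2\<close>, and since deleting any edge leaves it stress free, it has fewer than \<open>2|V|\<close>
  edges, hence a vertex \<open>z\<close> with exactly three neighbours \<open>u, v, w\<close>. If \<open>u\<close> and \<open>v\<close> have at most two
  common neighbours, identify them: no \<open>K\<^sub>3\<^sub>,\<^sub>3\<close> minor arises because \<open>z\<close> has degree three, and
  a stress of the original graph in the special position \<open>u = v\<close> would survive the identification;
  genericity moves the conclusion to the given position. Otherwise \<open>u\<close> and \<open>v\<close> have two further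
  common neighbours \<open>c, c'\<close>. Either one of the paths \<open>u c v\<close>, \<open>u c' v\<close> separates the graph, and
  stress freeness of the two sides glues along it, or the component of \<open>w\<close> in
  \<open>G - {u, v, z, c, c'}\<close> completes \<open>u, v; z, c, c'\<close> to a \<open>K\<^sub>3\<^sub>,\<^sub>3\<close> minor.
\<close>

section \<open>Planar graphs have no \<open>K\<^sub>3\<^sub>,\<^sub>3\<close> minor\<close>

text \<open>Some point \<open>v\<close> is separated from \<open>x\<close> by \<open>P\<close>,
  \<open>Q\<close> and the arms \<open>1\<close> and \<open>2\<close>. For each of these two arms,
  however, \<open>v\<close> can be joined to \<open>x\<close> off the theta arcs of that arm and of
  arm \<open>0\<close>. Janiszewski's theorem then joins them off all three arcs, a
  contradiction.\<close>

lemma theta_no_tripod: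
  fixes P Q :: "complex set" and A D :: "nat \<Rightarrow> complex set"
  assumes P: "compact P" "connected P" and Q: "compact Q" "connected Q" and PQ: "P \<inter> Q = {}"
    and A: "\<And>j. j < 3 \<Longrightarrow> compact (A j)" "\<And>j. j < 3 \<Longrightarrow> connected (A j)"
    and AP: "\<And>j. j < 3 \<Longrightarrow> A j \<inter> P \<noteq> {}" and AQ: "\<And>j. j < 3 \<Longrightarrow> A j \<inter> Q \<noteq> {}"
    and AA: "\<And>i j. i < 3 \<Longrightarrow> j < 3 \<Longrightarrow> i \<noteq> j \<Longrightarrow> A i \<inter> A j \<subseteq> P \<union> Q"
    and inner: "\<And>j. j < 3 \<Longrightarrow> connected (A j - (P \<union> Q))"
    and nosep: "\<And>j. j < 3 \<Longrightarrow> connected (- (P \<union> A j \<union> Q))"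
    and D: "\<And>j. j < 3 \<Longrightarrow> connected (D j)" "\<And>j. j < 3 \<Longrightarrow> x \<in> D j"
    and DP: "\<And>j. j < 3 \<Longrightarrow> D j \<inter> (P \<union> Q) = {}"
    and DA: "\<And>j. j < 3 \<Longrightarrow> D j \<inter> A j \<noteq> {}"
    and DA': "\<And>i j. i < 3 \<Longrightarrow> j < 3 \<Longrightarrow> i \<noteq> j \<Longrightarrow> D j \<inter> A i = {}"
  shows False
proof -
  define B where "B j = A j - (P \<union> Q)" for j
  define T where "T j = P \<union> A j \<union> Q" for j
  have T: "compact (T j)" "connected (T j)" "connected (- T j)" if "j < 3" for j
  proof -
    show "compact (T j)" unfolding T_def using P Q A that by (intro compact_Un) auto
    have "connected (P \<union> A j)" using P A AP that by (intro connected_Un) auto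
    then show "connected (T j)" unfolding T_def using Q AQ[OF that]
      by (intro connected_Un[of "P \<union> A j"]) auto
    show "connected (- T j)" using nosep that by (simp add: T_def)
  qed
  \<comment> \<open>Along the leg \<open>D k\<close> the point \<open>x\<close> reaches the inner
    part of arm \<open>k\<close> without touching the other two arcs.\<close>
  have Bx: "connected_component (- (T i \<union> T j)) x b"
    if lt: "i < 3" "j < 3" "k < 3" and ne: "i \<noteq> k" "j \<noteq> k" and b: "b \<in> B k" for i j k b
  proof -
    have "connected (D k \<union> B k)"
      using D(1)[OF lt(3)] inner[OF lt(3)] DA[OF lt(3)] DP[OF lt(3)]
      unfolding B_def by (intro connected_Un) blast+
    moreover have "D k \<union> B k \<subseteq> - (T i \<union> T j)"
      using DP DA' AA lt ne unfolding T_def B_def by blast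
    ultimately show ?thesis
      using D(2)[OF \<open>k < 3\<close>] b unfolding connected_component_def by blast
  qed
  have B_ne: "B j \<noteq> {}" if "j < 3" for j
    using DA DP that unfolding B_def by blast
  have "\<not> connected (P \<union> Q)"
  proof
    assume "connected (P \<union> Q)"
    then have "P \<inter> (P \<union> Q) = {} \<or> Q \<inter> (P \<union> Q) = {}"
      by (rule connected_closedD) (use P Q PQ in \<open>auto intro: compact_imp_closed\<close>)
    then show False using AP[of 0] AQ[of 0] by auto
  qed
  moreover have "T 1 \<inter> T 2 = P \<union> Q" using AA[of 1 2] by (auto simp: T_def)
  \<comment> \<open>Two continua with disconnected intersection have a union that separates the
    plane.\<close>
  ultimately have "\<not> connected (- (T 1 \<union> T 2))"
    using Janiszewski_dual[of "T 1" "T 2"] T by auto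
  then obtain v where v: "v \<in> - (T 1 \<union> T 2)" "\<not> connected_component (- (T 1 \<union> T 2)) x v"
    unfolding connected_iff_connected_component
    by (meson connected_component_sym connected_component_trans)
  define V where "V = connected_component_set (- (T 1 \<union> T 2)) v"
  have "v \<in> V" using v by (simp add: V_def)
  have V: "connected V" "V \<subseteq> - (T 1 \<union> T 2)"
    unfolding V_def using connected_component_subset by (simp, blast)
  have "open V" unfolding V_def using T(1)[of 1] T(1)[of 2]
    by (intro open_connected_component open_Compl closed_Un compact_imp_closed) auto
  have "frontier V \<subseteq> T 1 \<union> T 2"
  proof
    fix y assume y: "y \<in> frontier V"
    show "y \<in> T 1 \<union> T 2"
    proof (rule ccontr)
      assume ny: "y \<notin> T 1 \<union> T 2"
      have "connected (insert y V)"
        using y by (intro connected_intermediate_closure[OF V(1)]) (auto simp: frontier_def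
            closure_subset[THEN subsetD])
      then have "insert y V \<subseteq> V"
        using \<open>v \<in> V\<close> V(2) ny unfolding V_def by (intro connected_component_maximal) auto
      then show False using y \<open>open V\<close> by (auto simp: frontier_def interior_open)
    qed
  qed
  have VB0: "V \<inter> B 0 = {}"
  proof -
    have "\<not> connected_component (- (T 1 \<union> T 2)) v b" if "b \<in> B 0" for b
    proof
      assume "connected_component (- (T 1 \<union> T 2)) v b"
      then have "connected_component (- (T 1 \<union> T 2)) b v" by (rule connected_component_sym)
      then have "connected_component (- (T 1 \<union> T 2)) x v"
        using Bx[of 1 2 0 b] that by (intro connected_component_trans[of _ x b v]) auto
      with v(2) show False ..
    qed
    then show ?thesis unfolding V_def by blast
  qed
  have main: "connected_component (- (T 0 \<union> T k)) x v" if jk: "{j, k} = {1, 2}" for j k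
  proof -
    have lt: "j < 3" "k < 3" "j \<noteq> k" "0 < j" "0 < k" and T12: "T 1 \<union> T 2 = T j \<union> T k" using jk
      by (auto simp: doubleton_eq_iff)
    \<comment> \<open>Otherwise the frontier of \<open>V\<close> lies in \<open>T k\<close> alone
      and cuts \<open>V\<close> off from \<open>B j\<close>, although \<open>T k\<close> does not
      separate the plane.\<close>
    have "closure V \<inter> B j \<noteq> {}"
    proof
      assume no: "closure V \<inter> B j = {}"
      have "frontier V \<subseteq> T k"
        using \<open>frontier V \<subseteq> T 1 \<union> T 2\<close> no T12 by (auto simp: frontier_def T_def B_def)
      moreover have "(- T k) \<inter> V \<noteq> {}" using \<open>v \<in> V\<close> V T12 by auto
      moreover have "B j \<subseteq> (- T k) - V"
        using no closure_subset AA[of j k] lt by (auto simp: B_def T_def)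
      ultimately show False
        using connected_Int_frontier[OF T(3)[OF lt(2)]] B_ne[OF lt(1)] by blast
    qed
    then obtain b where b: "b \<in> closure V" "b \<in> B j" by blast
    have "connected (insert b V)"
      using b by (intro connected_intermediate_closure[OF V(1)]) (auto simp: closure_subset[THEN
          subsetD])
    moreover have "insert b V \<subseteq> - (T 0 \<union> T k)"
      using V VB0 T12 b AA[of j k] AA[of j 0] lt by (auto simp: B_def T_def)
    ultimately have "connected_component (- (T 0 \<union> T k)) v b"
      using \<open>v \<in> V\<close> unfolding connected_component_def by blast
    moreover have "connected_component (- (T 0 \<union> T k)) x b"
      using Bx[of 0 k j] b lt by auto
    ultimately show ?thesis
      by (meson connected_component_sym connected_component_trans)
  qed
  \<comment> \<open>Neither union separates \<open>x\<close> from \<open>v\<close>, and their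
    intersection is the connected set \<open>T 0\<close>, as Janiszewski's theorem requires.\<close>
  have "(T 0 \<union> T 1) \<inter> (T 0 \<union> T 2) = T 0" using \<open>T 1 \<inter> T 2 = P \<union> Q\<close> by (auto simp: T_def)
  then have "connected_component (- ((T 0 \<union> T 1) \<union> (T 0 \<union> T 2))) x v"
    using T(1)[of 0] T(1)[of 1] T(1)[of 2] T(2)[of 0] main[of 2 1] main[of 1 2]
    by (intro Janiszewski[of "T 0 \<union> T 1"] compact_Un[of "T 0"] closed_Un[of
        "T 0"] compact_imp_closed)
      (simp_all add: insert_commute)
  then show False
    using v(2) unfolding connected_component_def by blast
qed


section \<open>Branch sets and minor models\<close>

definition linked :: "('v \<times> 'v) set \<Rightarrow> 'v set \<Rightarrow> bool" where
  "linked E S \<longleftrightarrow> S \<noteq> {} \<and> (\<forall>x\<in>S. \<forall>y\<in>S. (x, y) \<in> (E \<inter> S \<times> S)\<^sup>*)"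

text \<open>The \<open>Z i\<close> are the branch sets of a pattern with vertices \<open>I\<close>
  and adjacency \<open>F\<close>. Nothing confines them to a vertex set.\<close>

definition minor_model ::
    "('v \<times> 'v) set \<Rightarrow> 'i set \<Rightarrow> ('i \<times> 'i) set \<Rightarrow> ('i \<Rightarrow> 'v set) \<Rightarrow> bool" where
  "minor_model E I F Z \<longleftrightarrow>
     (\<forall>i\<in>I. linked E (Z i)) \<and>
     (\<forall>i\<in>I. \<forall>j\<in>I. i \<noteq> j \<longrightarrow> Z i \<inter> Z j = {}) \<and>
     (\<forall>(i, j)\<in>F. \<exists>x\<in>Z i. \<exists>y\<in>Z j. (x, y) \<in> E)"

text \<open>Both orientations are listed, which makes the pattern a symmetric relation with classes
  \<open>0, 1, 2\<close> and \<open>3, 4, 5\<close>.\<close>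

definition K33_edges :: "(nat \<times> nat) set" where
  "K33_edges = {..<3} \<times> {3..<6} \<union> {3..<6} \<times> {..<3}"

definition K33_minor :: "('v \<times> 'v) set \<Rightarrow> bool" where
  "K33_minor E \<longleftrightarrow> (\<exists>Z. minor_model E {..<6} K33_edges Z)"

lemma linked_proper_subset_edge:
  assumes "linked E S" "R \<subseteq> S" "R \<noteq> {}" "R \<noteq> S"
  obtains x y where "x \<in> R" "y \<in> S - R" "(x, y) \<in> E"
proof -
  obtain a b where a: "a \<in> R" and b: "b \<in> S - R" using assms by blast
  then have "(a, b) \<in> (E \<inter> S \<times> S)\<^sup>*" using assms(1,2) by (auto simp: linked_def)
  then have "b \<in> R \<or> (\<exists>x\<in>R. \<exists>y\<in>S - R. (x, y) \<in> E)"
    by (induction rule: rtrancl_induct) (use a in auto)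
  then show thesis using b that by blast
qed

section \<open>Plane drawings with continua as edges\<close>

text \<open>In place of parametrised arcs only the sets \<open>L x y\<close> are kept, with the
  properties that the argument uses: each is a continuum, does not separate the plane, stays
  connected without its start, and meets vertices and other edges only as a drawing allows.\<close>

locale plane_drawing =
  fixes V :: "'v set" and E :: "('v \<times> 'v) set"
    and pos :: "'v \<Rightarrow> complex" and L :: "'v \<Rightarrow> 'v \<Rightarrow> complex set"
  assumes finV: "finite V" and EV: "E \<subseteq> V \<times> V" and inj: "inj_on pos V"
    and L_compact: "(x, y) \<in> E \<Longrightarrow> compact (L x y)"
    and L_connected: "(x, y) \<in> E \<Longrightarrow> connected (L x y)"
    and L_nosep: "(x, y) \<in> E \<Longrightarrow> connected (- L x y)"
    and L_minus_start: "(x, y) \<in> E \<Longrightarrow> connected (L x y - {pos x})"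
    and L_pos: "(x, y) \<in> E \<Longrightarrow> L x y \<inter> pos ` V = {pos x, pos y}"
    and L_Int: "(x, y) \<in> E \<Longrightarrow> (x', y') \<in> E \<Longrightarrow> {x, y} \<noteq> {x', y'} \<Longrightarrow>
      L x y \<inter> L x' y' \<subseteq> pos ` ({x, y} \<inter> {x', y'})"
begin

definition drawing :: "'v set \<Rightarrow> complex set" where
  "drawing S = pos ` S \<union> \<Union>{L x y | x y. x \<in> S \<and> y \<in> S \<and> (x, y) \<in> E}"

lemma pos_in_drawing_iff:
  assumes "x \<in> V" "S \<subseteq> V"
  shows "pos x \<in> drawing S \<longleftrightarrow> x \<in> S"
proof
  assume "pos x \<in> drawing S"
  moreover have "x = y" if "pos x = pos y" "y \<in> S" for y
    using inj assms that by (auto dest: inj_onD)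
  moreover have "x = y \<or> x = z" if "pos x \<in> L y z" "(y, z) \<in> E" for y z
  proof -
    have "pos x \<in> {pos y, pos z}" using L_pos[OF that(2)] that(1) assms by blast
    then show ?thesis using inj assms that(2) EV by (auto dest: inj_onD)
  qed
  ultimately show "x \<in> S" unfolding drawing_def by blast
qed (simp add: drawing_def)

lemma drawing_disjoint:
  assumes "S \<subseteq> V" "S' \<subseteq> V" "S \<inter> S' = {}" "a \<in> drawing S" "a \<in> drawing S'"
  shows False
proof -
  have "a \<notin> pos ` V"
    using assms pos_in_drawing_iff by blast
  then obtain x y x' y' where "a \<in> L x y" "a \<in> L x' y'" "(x, y) \<in> E" "(x', y') \<in> E"
      "x \<in> S" "y \<in> S" "x' \<in> S'" "y' \<in> S'"
    using assms unfolding drawing_def by blast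
  moreover from this have "{x, y} \<inter> {x', y'} = {}" using assms(3) by auto
  ultimately show False using L_Int[of x y x' y'] by auto
qed

lemma drawing_Int_L:
  assumes "S \<subseteq> V" "(x, y) \<in> E" "\<not> (x \<in> S \<and> y \<in> S)"
  shows "drawing S \<inter> L x y = pos ` (S \<inter> {x, y})"
proof
  show "drawing S \<inter> L x y \<subseteq> pos ` (S \<inter> {x, y})"
  proof
    fix a assume a: "a \<in> drawing S \<inter> L x y"
    show "a \<in> pos ` (S \<inter> {x, y})"
    proof (cases "a \<in> pos ` V")
      case True
      then obtain v where v: "v \<in> V" "a = pos v" by blast
      then have "v \<in> S" using a pos_in_drawing_iff assms(1) by blast
      moreover have "pos v \<in> {pos x, pos y}" using L_pos[OF assms(2)] a v by blast
      then have "v \<in> {x, y}" using inj v assms(2) EV by (auto dest: inj_onD)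
      ultimately show ?thesis using v by blast
    next
      case False
      then obtain x' y' where "a \<in> L x' y'" "(x', y') \<in> E" "x' \<in> S" "y' \<in> S"
        using a assms(1) unfolding drawing_def by blast
      moreover from this have "{x', y'} \<noteq> {x, y}" using assms(3) by (auto simp: doubleton_eq_iff)
      ultimately show ?thesis using L_Int[of x' y' x y] a assms(2) by auto
    qed
  qed
  show "pos ` (S \<inter> {x, y}) \<subseteq> drawing S \<inter> L x y"
    using L_pos[OF assms(2)] by (auto simp: drawing_def)
qed

text \<open>The full drawing of a linked set may contain cycles and so separate the plane; a
  spanning tree does not. A maximal vertex set with a good drawing is all of \<open>S\<close>,
  because a further edge meets the tree in one point and Janiszewski's theorem keeps the complement
  connected.\<close>

lemma linked_tree_drawing:
  assumes S: "linked E S" "S \<subseteq> V"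
  obtains T where "compact T" "connected T" "connected (- T)" "pos ` S \<subseteq> T" "T \<subseteq> drawing S"
proof -
  define good where "good R \<longleftrightarrow> (\<exists>T. compact T \<and> connected T \<and> connected (- T) \<and>
    pos ` R \<subseteq> T \<and> T \<subseteq> drawing R)" for R
  have "finite S" using S(2) finV finite_subset by blast
  obtain s where s: "s \<in> S" using S(1) by (auto simp: linked_def)
  have "connected (- {pos s})"
    by (intro connected_punctured_universe) auto
  then have "good {s}" unfolding good_def
  proof (intro exI conjI)
    show "{pos s} \<subseteq> drawing {s}" by (simp add: drawing_def)
  qed auto
  let ?M = "{R. R \<subseteq> S \<and> R \<noteq> {} \<and> good R}"
  have "?M \<subseteq> Pow S" by blast
  then have fin: "finite ?M" using \<open>finite S\<close> finite_subset by blast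
  have "{s} \<in> ?M" using \<open>good {s}\<close> s by simp
  then have ne: "?M \<noteq> {}" by (metis empty_iff)
  obtain R where "R \<in> ?M" and "\<forall>R'\<in>?M. R \<subseteq> R' \<longrightarrow> R = R'"
    using finite_has_maximal[OF fin ne] by (elim bexE)
  then have R: "R \<subseteq> S" "R \<noteq> {}" "good R"
    and max: "\<And>R'. R' \<subseteq> S \<Longrightarrow> R' \<noteq> {} \<Longrightarrow> good R' \<Longrightarrow> R \<subseteq> R' \<Longrightarrow> R = R'"
    by simp_all
  have "R = S"
  proof (rule ccontr)
    assume "R \<noteq> S"
    then obtain x y where xy: "x \<in> R" "y \<in> S - R" "(x, y) \<in> E"
      using linked_proper_subset_edge[OF S(1) R(1,2)] by blast
    obtain T where T: "compact T" "connected T" "connected (- T)" "pos ` R \<subseteq> T" "T \<subseteq> drawing R"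
      using R(3) unfolding good_def by blast
    have "drawing R \<inter> L x y = pos ` (R \<inter> {x, y})"
      using xy R S by (intro drawing_Int_L) auto
    moreover have "R \<inter> {x, y} = {x}" using xy by auto
    moreover have "pos x \<in> L x y" "pos y \<in> L x y" using L_pos[OF xy(3)] by auto
    ultimately have TL: "T \<inter> L x y = {pos x}" using T xy by auto
    have "good (insert y R)" unfolding good_def
    proof (intro exI conjI)
      show "compact (T \<union> L x y)" using T L_compact[OF xy(3)] by auto
      show "connected (T \<union> L x y)" using T L_connected[OF xy(3)] TL by (intro connected_Un) auto
      show "connected (- (T \<union> L x y))"
        using T L_nosep[OF xy(3)] L_compact[OF xy(3)] TL
        by (intro Janiszewski_connected) (auto intro: compact_imp_closed)
      show "pos ` insert y R \<subseteq> T \<union> L x y" using T \<open>pos y \<in> L x y\<close> by auto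
      have "drawing R \<subseteq> drawing (insert y R)" unfolding drawing_def by blast
      moreover have "L x y \<subseteq> drawing (insert y R)" unfolding drawing_def using xy by blast
      ultimately show "T \<union> L x y \<subseteq> drawing (insert y R)" using T by blast
    qed
    then show False using max[of "insert y R"] xy R by auto
  qed
  then show thesis using R(3) that unfolding good_def by blast
qed

lemma L_ends:
  assumes "(x, y) \<in> E"
  shows "pos x \<in> L x y" "pos y \<in> L x y" "x \<in> V" "y \<in> V"
  using L_pos[OF assms] EV assms by auto

text \<open>Used for branch sets: edges stay inside \<open>V\<close>, so one vertex of
  \<open>V\<close> in a linked set draws in all the others.\<close>

lemma linked_subset_vertices:
  assumes "linked E S" "x \<in> S" "x \<in> V"
  shows "S \<subseteq> V"
proof
  fix y assume "y \<in> S"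
  then have "(x, y) \<in> (E \<inter> S \<times> S)\<^sup>*" using assms by (auto simp: linked_def)
  then show "y \<in> V" by (induction rule: rtrancl_induct) (use assms EV in auto)
qed

text \<open>The branch sets \<open>0\<close> and \<open>1\<close> play the roles of \<open>P\<close>
  and \<open>Q\<close>, the branch sets \<open>3 + j\<close> are the middles of the three arms, and
  branch set \<open>2\<close> is the centre of the tripod.\<close>

theorem no_K33_minor: 
  assumes sym: "sym E" and Lsym: "\<And>x y. L x y = L y x"
  shows "\<not> K33_minor E"
proof
  assume "K33_minor E"
  then obtain Z where Z: "minor_model E {..<6} K33_edges Z" unfolding K33_minor_def ..
  have linked: "linked E (Z i)" if "i < 6" for i
    using Z that by (simp add: minor_model_def)
  have disj: "Z i \<inter> Z j = {}" if "i < 6" "j < 6" "i \<noteq> j" for i j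
    using Z that by (simp add: minor_model_def)
  have "\<exists>x y. x \<in> Z i \<and> y \<in> Z (3 + j) \<and> (x, y) \<in> E" if "i < 3" "j < 3" for i j
  proof -
    have "(i, 3 + j) \<in> K33_edges" using that by (auto simp: K33_edges_def)
    then show ?thesis using Z unfolding minor_model_def by blast
  qed
  then obtain x y where xy:
      "\<And>i j. i < 3 \<Longrightarrow> j < 3 \<Longrightarrow> x i j \<in> Z i \<and> y i j \<in> Z (3 + j) \<and> (x i j, y i j) \<in> E"
    by metis
  have ZV: "Z i \<subseteq> V" if "i < 6" for i
  proof (cases "i < 3")
    case True
    then have "x i 0 \<in> Z i" "x i 0 \<in> V" using xy[of i 0] EV by auto
    then show ?thesis using linked_subset_vertices[OF linked[OF that]] by blast
  next
    case False
    then have "y 0 (i - 3) \<in> Z i" "y 0 (i - 3) \<in> V" using xy[of 0 "i - 3"] EV that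
      by (auto simp: less_diff_conv2)
    then show ?thesis using linked_subset_vertices[OF linked[OF that]] by blast
  qed
  have "\<exists>T. compact T \<and> connected T \<and> connected (- T) \<and> pos ` Z i \<subseteq> T \<and> T \<subseteq> drawing (Z i)"
    if "i < 6" for i
    using linked_tree_drawing[OF linked[OF that] ZV[OF that]] by metis
  then obtain T where T: "\<And>i. i < 6 \<Longrightarrow> compact (T i)" "\<And>i. i < 6 \<Longrightarrow> connected (T i)"
      "\<And>i. i < 6 \<Longrightarrow> connected (- T i)"
      "\<And>i. i < 6 \<Longrightarrow> pos ` Z i \<subseteq> T i" "\<And>i. i < 6 \<Longrightarrow> T i \<subseteq> drawing (Z i)"
    by metis
  \<comment> \<open>One chosen edge for each adjacency of the model; other edges between branch sets
    are discarded.\<close>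
  define M where "M i j = L (x i j) (y i j)" for i j
  have xyE: "(x i j, y i j) \<in> E" "(y i j, x i j) \<in> E" "x i j \<in> Z i" "y i j \<in> Z (3 + j)"
    if "i < 3" "j < 3" for i j
    using xy[OF that] sym by (auto dest: symD)
  have TT: "T i \<inter> T j = {}" if "i < 6" "j < 6" "i \<noteq> j" for i j
    using drawing_disjoint[OF ZV ZV disj] T(5) that by blast
  have MT: "M i j \<inter> T k = pos ` (Z k \<inter> {x i j, y i j})" if "i < 3" "j < 3" "k < 6" for i j k
  proof -
    have "\<not> (x i j \<in> Z k \<and> y i j \<in> Z k)"
    proof
      assume "x i j \<in> Z k \<and> y i j \<in> Z k"
      then have "k = i" "k = 3 + j" using disj[of k i] disj[of k "3 + j"] xyE[of i j] that by auto
      then show False using that by simp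
    qed
    then have "drawing (Z k) \<inter> M i j = pos ` (Z k \<inter> {x i j, y i j})"
      unfolding M_def using drawing_Int_L ZV xyE that by presburger
    moreover have "pos ` (Z k \<inter> {x i j, y i j}) \<subseteq> T k" using T(4)[of k] that by blast
    ultimately show ?thesis using T(5)[of k] that by blast
  qed
  have MTx: "M i j \<inter> T i = {pos (x i j)}" if "i < 3" "j < 3" for i j
  proof -
    have "Z i \<inter> {x i j, y i j} = {x i j}" using disj[of i "3 + j"] xyE[of i j] that by auto
    then show ?thesis using MT[of i j i] that by auto
  qed
  have MTy: "M i j \<inter> T (3 + j) = {pos (y i j)}" if "i < 3" "j < 3" for i j
  proof -
    have "Z (3 + j) \<inter> {x i j, y i j} = {y i j}" using disj[of i "3 + j"] xyE[of i j] that by auto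
    then show ?thesis using MT[of i j "3 + j"] that by auto
  qed
  have MT0: "M i j \<inter> T k = {}" if "i < 3" "j < 3" "k < 6" "k \<noteq> i" "k \<noteq> 3 + j" for i j k
  proof -
    have "Z k \<inter> {x i j, y i j} = {}" using disj[of k "3 + j"] disj[of k i] xyE[of i j] that by auto
    then show ?thesis using MT[of i j k] that by auto
  qed
  have MM: "M i j \<inter> M i' j' \<subseteq> pos ` ({x i j, y i j} \<inter> {x i' j', y i' j'})"
    if "i < 3" "j < 3" "i' < 3" "j' < 3" "j \<noteq> j'" for i j i' j'
  proof -
    have "y i j \<noteq> y i' j'" "y i j \<noteq> x i' j'"
      using disj[of "3 + j" "3 + j'"] disj[of "3 + j" i'] xyE[of i j] xyE[of i' j'] that by auto
    then have "{x i j, y i j} \<noteq> {x i' j', y i' j'}" by auto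
    then show ?thesis unfolding M_def using xyE that by (intro L_Int) auto
  qed
  \<comment> \<open>Two chosen edges may share their end in branch set \<open>i\<close>, hence an
    inclusion instead of disjointness.\<close>
  have MMx: "M i j \<inter> M i j' \<subseteq> T i" if "i < 3" "j < 3" "j' < 3" "j \<noteq> j'" for i j j'
  proof -
    have "{x i j, y i j} \<inter> {x i j', y i j'} \<subseteq> Z i"
      using disj[of "3 + j" "3 + j'"] disj[of "3 + j" i] xyE[of i j] xyE[of i j'] that by auto
    then show ?thesis using MM[of i j i j'] T(4)[of i] that by fastforce
  qed
  have MM0: "M i j \<inter> M i' j' = {}" if "i < 3" "j < 3" "i' < 3" "j' < 3" "j \<noteq> j'" "i \<noteq> i'"
    for i j i' j'
  proof -
    have "{x i j, y i j} \<inter> {x i' j', y i' j'} = {}"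
      using disj[of "3 + j" "3 + j'"] disj[of "3 + j" i'] disj[of i "3 + j'"] disj[of i i']
        xyE[of i j] xyE[of i' j'] that by auto
    then show ?thesis using MM[of i j i' j'] that by auto
  qed
  have M: "compact (M i j)" "connected (M i j)" "connected (- M i j)"
      "connected (M i j - {pos (x i j)})" "connected (M i j - {pos (y i j)})"
      "pos (x i j) \<in> M i j" "pos (y i j) \<in> M i j" "pos (x i j) \<in> T i" "pos (y i j) \<in> T (3 + j)"
      "pos (x i j) \<noteq> pos (y i j)"
    if ij: "i < 3" "j < 3" for i j
  proof -
    show xT: "pos (x i j) \<in> T i" and "pos (y i j) \<in> T (3 + j)"
      using T(4)[of i] T(4)[of "3 + j"] xyE[OF ij] that by auto
    then show "pos (x i j) \<noteq> pos (y i j)" using TT[of i "3 + j"] that by auto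
    show "connected (M i j - {pos (y i j)})"
      using L_minus_start[OF xyE(2)[OF ij]] unfolding M_def Lsym[of "x i j"] .
  qed (use xyE[OF ij] in \<open>auto simp: M_def L_compact L_connected L_nosep L_minus_start L_ends\<close>)
  define A where "A j = M 0 j \<union> T (3 + j) \<union> M 1 j" for j
  define D where "D j = T 2 \<union> M 2 j" for j
  obtain z where z: "z \<in> Z 2" using linked[of 2] by (auto simp: linked_def)
  show False
  proof (rule theta_no_tripod[of "T 0" "T 1" A D "pos z"])
    show "compact (T 0)" "connected (T 0)" "compact (T 1)" "connected (T 1)" "T 0 \<inter> T 1 = {}"
      using T TT by auto
  next
    fix j :: nat assume j: "j < 3"
    note Mj = M[of 0 j] M[of 1 j] M[of 2 j]
    show "compact (A j)"
      unfolding A_def using T(1)[of "3 + j"] Mj j by (intro compact_Un) auto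
    have 1: "connected (M 0 j \<union> T (3 + j))"
      using T(2)[of "3 + j"] Mj j by (intro connected_Un) auto
    then show "connected (A j)" unfolding A_def
      using Mj j by (intro connected_Un[of "M 0 j \<union> T (3 + j)"]) auto
    show "A j \<inter> T 0 \<noteq> {}" "A j \<inter> T 1 \<noteq> {}" unfolding A_def using Mj j by auto
    have "A j - (T 0 \<union> T 1) = ((M 0 j - {pos (x 0 j)}) \<union> T (3 + j)) \<union> (M 1 j - {pos (x 1 j)})"
      using MTx[of 0 j] MTx[of 1 j] MT0[of 0 j 1] MT0[of 1 j 0] TT[of "3 + j" 0] TT[of "3 + j" 1] j
      unfolding A_def by (auto simp: disjoint_iff)
    moreover have "connected ((M 0 j - {pos (x 0 j)}) \<union> T (3 + j))"
      using T(2)[of "3 + j"] Mj(4,7,9,10) j by (intro connected_Un) auto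
    then have "connected (((M 0 j - {pos (x 0 j)}) \<union> T (3 + j)) \<union> (M 1 j - {pos (x 1 j)}))"
      using Mj(14,17,19,20) j by (intro connected_Un[of "(M 0 j - {pos (x 0 j)}) \<union> T (3 + j)"]) auto
    ultimately show "connected (A j - (T 0 \<union> T 1))" by simp
    \<comment> \<open>The arm and then \<open>T 1\<close> are added to \<open>T 0\<close> piece by
      piece. Each piece meets what is already there in a single point, so the complement stays
      connected.\<close>
    have a: "connected (- (T 0 \<union> M 0 j))"
      using T(1,3)[of 0] Mj(1,3) MTx[of 0 j] j
      by (intro Janiszewski_connected) (auto intro: compact_imp_closed simp: Int_commute)
    have b: "connected (- (T 0 \<union> M 0 j \<union> T (3 + j)))"
    proof -
      have "(T 0 \<union> M 0 j) \<inter> T (3 + j) = {pos (y 0 j)}" using MTy[of 0 j] TT[of 0 "3 + j"] j by auto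
      then show ?thesis using a T(1,3)[of "3 + j"] T(1)[of 0] Mj(1) j
        by (intro Janiszewski_connected[of "T 0 \<union> M 0 j"]) (auto intro: compact_imp_closed)
    qed
    have c: "connected (- (T 0 \<union> M 0 j \<union> T (3 + j) \<union> M 1 j))"
    proof -
      have ne: "y 0 j \<noteq> x 1 j" "x 0 j \<noteq> y 1 j" "x 0 j \<noteq> x 1 j"
        using disj[of "3 + j" 1] disj[of 0 "3 + j"] disj[of 0 1] xyE[of 0 j] xyE[of 1 j] j by auto
      then have "{x 0 j, y 0 j} \<noteq> {x 1 j, y 1 j}" by (auto simp: doubleton_eq_iff)
      then have "M 0 j \<inter> M 1 j \<subseteq> pos ` ({x 0 j, y 0 j} \<inter> {x 1 j, y 1 j})"
        unfolding M_def using xyE j by (intro L_Int) auto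
      also have "\<dots> \<subseteq> {pos (y 1 j)}" using ne by auto
      finally have "(T 0 \<union> M 0 j \<union> T (3 + j)) \<inter> M 1 j = {pos (y 1 j)}"
        using MTy[of 1 j] MT0[of 1 j 0] j by auto
      then show ?thesis using b T(1)[of 0] T(1)[of "3 + j"] Mj(1,11,13) j
        by (intro Janiszewski_connected[of
            "T 0 \<union> M 0 j \<union> T (3 + j)"]) (auto intro: compact_imp_closed)
    qed
    have "(T 0 \<union> A j) \<inter> T 1 = {pos (x 1 j)}"
      using MTx[of 1 j] MT0[of 0 j 1] TT[of 0 1] TT[of "3 + j" 1] j unfolding A_def by auto
    moreover have "compact (T 0 \<union> A j)" using T(1)[of 0] \<open>compact (A j)\<close> by auto
    moreover have "connected (- (T 0 \<union> A j))" using c by (simp add: A_def Un_assoc)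
    ultimately show "connected (- (T 0 \<union> A j \<union> T 1))"
      using T(1,3)[of 1] by (intro Janiszewski_connected[of
          "T 0 \<union> A j"]) (auto intro: compact_imp_closed)
    show "connected (D j)" unfolding D_def using T(2)[of 2] Mj(22,26,28) j
      by (intro connected_Un) auto
    show "pos z \<in> D j" using T(4)[of 2] z by (auto simp: D_def)
    show "D j \<inter> (T 0 \<union> T 1) = {}"
      using TT[of 2 0] TT[of 2 1] MT0[of 2 j 0] MT0[of 2 j 1] j unfolding D_def by auto
    show "D j \<inter> A j \<noteq> {}" unfolding D_def A_def using Mj(27,29) j by auto
  next
    fix i j :: nat assume ij: "i < 3" "j < 3" "i \<noteq> j"
    have "M 0 i \<inter> M 0 j \<subseteq> T 0" "M 1 i \<inter> M 1 j \<subseteq> T 1"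
      using ij by (simp_all add: MMx)
    moreover have "M 0 i \<inter> M 1 j = {}" "M 1 i \<inter> M 0 j = {}"
        "M 0 i \<inter> T (3 + j) = {}" "M 1 i \<inter> T (3 + j) = {}"
        "M 0 j \<inter> T (3 + i) = {}" "M 1 j \<inter> T (3 + i) = {}" "T (3 + i) \<inter> T (3 + j) = {}"
      using ij by (simp_all add: MM0 MT0 TT)
    ultimately show "A i \<inter> A j \<subseteq> T 0 \<union> T 1" unfolding A_def by blast
    have "M 0 i \<inter> T 2 = {}" "M 1 i \<inter> T 2 = {}" "T 2 \<inter> T (3 + i) = {}"
        "M 2 j \<inter> M 0 i = {}" "M 2 j \<inter> M 1 i = {}" "M 2 j \<inter> T (3 + i) = {}"
      using ij by (simp_all add: MM0 MT0 TT)
    then show "D j \<inter> A i = {}" unfolding D_def A_def by blast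
  qed
qed

end

section \<open>Jordan arcs as edges\<close>

text \<open>What remains of the arc is the continuous image of a half-open interval.\<close>

lemma connected_arc_minus_end:
  fixes g :: "real \<Rightarrow> 'a::topological_space"
  assumes "arc g" and "p \<in> {pathstart g, pathfinish g}"
  shows "connected (path_image g - {p})"
proof -
  have inj: "inj_on g {0..1}" and cont: "continuous_on {0..1} g"
    using assms(1) by (auto simp: arc_def path_def)
  obtain t :: real where t: "t = 0 \<or> t = 1" "p = g t"
    using assms(2) by (auto simp: pathstart_def pathfinish_def)
  then have "{t} \<subseteq> {0..1}" by auto
  then have "path_image g - {p} = g ` ({0..1} - {t})"
    using inj_on_image_set_diff[OF inj, of "{0..1}" "{t}"] t(2) unfolding path_image_def by simp
  moreover have "{0..1} - {0::real} = {0<..1}" "{0..1} - {1::real} = {0..<1}" by auto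
  then have "connected ({0..1} - {t})" using t(1) by (metis connected_Ioc connected_Ico)
  then have "connected (g ` ({0..1} - {t}))"
    by (intro connected_continuous_image continuous_on_subset[OF cont]) auto
  ultimately show ?thesis by simp
qed

lemma planar_no_K33_minor:
  fixes G :: "'v graph"
  assumes "planar G" and fin: "finite (fst G)" and "sym E"
    and E: "\<And>x y. (x, y) \<in> E \<Longrightarrow> {x, y} \<in> snd G \<and> x \<in> fst G \<and> y \<in> fst G"
  shows "\<not> K33_minor E"
proof -
  obtain pos :: "'v \<Rightarrow> complex" and curve where inj: "inj_on pos (fst G)"
    and arc: "\<forall>e\<in>snd G. arc (curve e) \<and> {pathstart (curve e), pathfinish (curve e)} = pos ` e \<and>
           path_image (curve e) \<inter> pos ` fst G = pos ` e"
    and cross: "\<forall>e\<in>snd G. \<forall>e'\<in>snd G. e \<noteq> e' \<longrightarrow>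
           path_image (curve e) \<inter> path_image (curve e') \<subseteq> pos ` (e \<inter> e')"
    using assms(1) unfolding planar_def by blast
  interpret plane_drawing "fst G" E pos "\<lambda>x y. path_image (curve {x, y})"
  proof
    fix x y assume xy: "(x, y) \<in> E"
    then have a: "arc (curve {x, y})" 
      and ends: "{pathstart (curve {x, y}), pathfinish (curve {x, y})} = pos ` {x, y}"
      using arc E by blast+
    show "compact (path_image (curve {x, y}))" "connected (path_image (curve {x, y}))"
      using a by (auto simp: compact_arc_image connected_arc_image)
    show "connected (- path_image (curve {x, y}))" using a by (intro connected_arc_complement) auto
    show "connected (path_image (curve {x, y}) - {pos x})"
      using a ends by (intro connected_arc_minus_end) auto
    show "path_image (curve {x, y}) \<inter> pos ` fst G = {pos x, pos y}"
      using arc E[OF xy] by auto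
  qed (use fin inj E cross in auto)
  show ?thesis using \<open>sym E\<close> by (intro no_K33_minor) (auto simp: insert_commute)
qed

section \<open>Folding at a vertex of degree three\<close>

lemma minor_model_mono:
  assumes "minor_model E I F Z" "E \<subseteq> E'"
  shows "minor_model E' I F Z"
proof -
  have "(E \<inter> S \<times> S)\<^sup>* \<subseteq> (E' \<inter> S \<times> S)\<^sup>*" for S
    using assms(2) by (intro rtrancl_mono) auto
  then have "linked E S \<Longrightarrow> linked E' S" for S unfolding linked_def by blast
  then show ?thesis using assms unfolding minor_model_def by (auto; blast)
qed

lemma minor_modelI:
  assumes "\<And>i. i \<in> I \<Longrightarrow> linked E (Z i)"
    and "\<And>i j. i \<in> I \<Longrightarrow> j \<in> I \<Longrightarrow> i \<noteq> j \<Longrightarrow> Z i \<inter> Z j = {}"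
    and "\<And>i j. (i, j) \<in> F \<Longrightarrow> \<exists>x\<in>Z i. \<exists>y\<in>Z j. (x, y) \<in> E"
  shows "minor_model E I F Z"
  using assms by (simp add: minor_model_def split_beta)

lemma K33_minor_mono: "K33_minor E \<Longrightarrow> E \<subseteq> E' \<Longrightarrow> K33_minor E'"
  unfolding K33_minor_def using minor_model_mono by metis

lemma linked_from:
  assumes "sym E" "x \<in> S" "\<And>y. y \<in> S \<Longrightarrow> (x, y) \<in> (E \<inter> S \<times> S)\<^sup>*"
  shows "linked E S"
proof -
  have "sym (E \<inter> S \<times> S)" using assms(1) by (auto simp: sym_def)
  then have "sym ((E \<inter> S \<times> S)\<^sup>*)" by (rule sym_rtrancl)
  then show ?thesis unfolding linked_def using assms(2,3) by (blast dest: symD intro: rtrancl_trans)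
qed

lemma linked_reachable:
  assumes "sym E" "x \<in> S"
  shows "linked E {y. (x, y) \<in> (E \<inter> S \<times> S)\<^sup>*}" (is "linked E ?R")
proof (rule linked_from[OF assms(1), of x])
  fix y assume "y \<in> ?R"
  then have "(x, y) \<in> (E \<inter> S \<times> S)\<^sup>*" by simp
  then show "(x, y) \<in> (E \<inter> ?R \<times> ?R)\<^sup>*"
  proof (induction rule: rtrancl_induct)
    case (step y z)
    then have "(y, z) \<in> E \<inter> ?R \<times> ?R" by (auto intro: rtrancl_into_rtrancl)
    with step.IH show ?case by (rule rtrancl_into_rtrancl)
  qed simp
qed simp

section \<open>Identifying two vertices and lifting minors\<close>

text \<open>The merged vertex keeps the name \<open>u\<close>; for \<open>u \<noteq> v\<close> no
  edge of the folded relation contains \<open>v\<close>.\<close>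

definition fold_vertex :: "'v \<Rightarrow> 'v \<Rightarrow> 'v \<Rightarrow> 'v" where
  "fold_vertex u v x = (if x = v then u else x)"

definition fold_edges :: "'v \<Rightarrow> 'v \<Rightarrow> ('v \<times> 'v) set \<Rightarrow> ('v \<times> 'v) set" where
  "fold_edges u v E = {(fold_vertex u v a, fold_vertex u v b) | a b. (a, b) \<in> E}"

lemma sym_fold_edges: "sym E \<Longrightarrow> sym (fold_edges u v E)"
  unfolding sym_def fold_edges_def by blast

text \<open>
  A branch set of the folded graph that contains the merged vertex is made connected again by
  moving \<open>z\<close> into it; the branch set which loses \<open>z\<close> keeps the neighbour \<open>w\<close> of \<open>z\<close>.
\<close>

lemma minor_model_unfold:
  assumes sym: "sym E" and N: "E `` {z} = {u, v, w}"
    and dist: "u \<noteq> v" "w \<noteq> u" "w \<noteq> v" "z \<notin> {u, v, w}"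
    and F: "F \<subseteq> I \<times> I" "sym F" "irrefl F" "\<And>i. i \<in> I \<Longrightarrow> card (F `` {i}) \<ge> 3"
    and Z: "minor_model (fold_edges u v E) I F Z"
  shows "\<exists>Z'. minor_model E I F Z'"
proof -
  define f where "f = fold_vertex u v"
  define E' where "E' = fold_edges u v E"
  have E'_iff: "(x, y) \<in> E' \<longleftrightarrow> (\<exists>a b. (a, b) \<in> E \<and> x = f a \<and> y = f b)" for x y
    unfolding E'_def fold_edges_def f_def by blast
  have f_simps: "f v = u" "f u = u" "f w = w" "f z = z" "\<And>x. x \<noteq> v \<Longrightarrow> f x = x"
    using dist by (auto simp: f_def fold_vertex_def)
  have f_eq: "f x = u \<longleftrightarrow> x = u \<or> x = v" "f x = z \<longleftrightarrow> x = z" "f x \<noteq> v" for x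
    using dist by (auto simp: f_def fold_vertex_def)
  have "sym E'" unfolding E'_def using sym by (rule sym_fold_edges)
  have linked: "linked E' (Z i)" if "i \<in> I" for i
    using Z that unfolding minor_model_def E'_def by blast
  have disj: "i = j" if "x \<in> Z i" "x \<in> Z j" "i \<in> I" "j \<in> I" for i j x
    using Z that unfolding minor_model_def by blast
  have adj: "\<exists>x\<in>Z i. \<exists>y\<in>Z j. (x, y) \<in> E'" if "(i, j) \<in> F" for i j
    using Z that unfolding minor_model_def E'_def by blast
  have zN: "(z, x) \<in> E \<longleftrightarrow> x = u \<or> x = v \<or> x = w" for x using N by auto
  have zE': "(z, x) \<in> E' \<longleftrightarrow> x = u \<or> x = w" for x
    unfolding E'_iff using zN f_simps f_eq(2) by metis
  \<comment> \<open>No edge is left at \<open>v\<close> after folding, so its branch set would be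
    \<open>{v}\<close> without neighbours, against the degree condition on \<open>F\<close>.\<close>
  have vZ: "v \<notin> Z i" if i: "i \<in> I" for i
  proof
    assume v: "v \<in> Z i"
    have no: "(v, x) \<notin> E'" for x using E'_iff f_eq(3) by metis
    have "Z i = {v}"
    proof -
      have "x = v" if "x \<in> Z i" for x
      proof -
        have "(v, x) \<in> (E' \<inter> Z i \<times> Z i)\<^sup>*" using linked[OF i] v that by (auto simp: linked_def)
        then show ?thesis using no by (auto elim: converse_rtranclE)
      qed
      with v show ?thesis by blast
    qed
    have "F `` {i} \<noteq> {}" using F(4)[OF i] by (metis card.empty not_numeral_le_zero)
    then obtain j where "(i, j) \<in> F" by blast
    then obtain x y where "x \<in> Z i" "(x, y) \<in> E'" using adj by blast
    then show False using \<open>Z i = {v}\<close> no by simp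
  qed
  show ?thesis
  proof (cases "\<exists>k\<in>I. u \<in> Z k")
    case False
    then have nu: "u \<notin> Z i" if "i \<in> I" for i using that by blast
    have E'E: "(x, y) \<in> E" if "(x, y) \<in> E'" "x \<noteq> u" "y \<noteq> u" for x y
      using that f_simps unfolding E'_iff by metis
    have "linked E (Z i)" if i: "i \<in> I" for i
    proof -
      have "E' \<inter> Z i \<times> Z i \<subseteq> E \<inter> Z i \<times> Z i" using E'E nu[OF i] by auto
      then show ?thesis using linked[OF i] rtrancl_mono unfolding linked_def by blast
    qed
    moreover have "\<exists>x\<in>Z i. \<exists>y\<in>Z j. (x, y) \<in> E" if "(i, j) \<in> F" for i j
      using adj[OF that] E'E nu that F(1) by (metis SigmaD1 SigmaD2 subset_eq)
    ultimately have "minor_model E I F Z" using disj by (intro minor_modelI) auto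
    then show ?thesis by blast
  next
    case True
    then obtain k where k: "k \<in> I" "u \<in> Z k" by blast
    define Z' where "Z' i = (if i = k then insert z (insert v (Z k)) else Z i - {z})" for i
    have pre: "a \<in> insert v (Z k) \<longleftrightarrow> f a \<in> Z k" for a
      using k f_simps(1,5) by (cases "a = v") auto
    have nu: "u \<notin> Z i" if "i \<in> I" "i \<noteq> k" for i using disj k that by blast
    have wz: "w \<in> Z i \<and> linked E (Z i - {z})" if i: "i \<in> I" "i \<noteq> k" "z \<in> Z i" for i
    proof -
      \<comment> \<open>After folding \<open>z\<close> has only the neighbours \<open>u\<close> and
        \<open>w\<close>, so \<open>{z}\<close> would be adjacent to at most two branch sets. If no
        branch set contains \<open>w\<close>, the definite description is an arbitrary index and the
        bound still holds.\<close>
      have "Z i \<noteq> {z}"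
      proof
        assume Zi: "Z i = {z}"
        have "F `` {i} \<subseteq> {j. j \<in> I \<and> (u \<in> Z j \<or> w \<in> Z j)}"
          using adj Zi zE' F(1) by fastforce
        moreover have "{j. j \<in> I \<and> (u \<in> Z j \<or> w \<in> Z j)} \<subseteq> {k, (THE j. j \<in> I \<and> w \<in> Z j)}"
          using disj k by (auto intro!: the_equality[symmetric])
        ultimately have "card (F `` {i}) \<le> card {k, (THE j. j \<in> I \<and> w \<in> Z j)}"
          by (intro card_mono) auto
        also have "\<dots> \<le> 2" by (simp add: card_insert_if)
        finally show False using F(4)[OF i(1)] by simp
      qed
      then obtain y where "y \<in> Z i - {z}" "(z, y) \<in> E'"
        using linked_proper_subset_edge[OF linked[OF i(1)], of "{z}"] i(3) by auto
      then have wi: "w \<in> Z i" using zE' nu[OF i(1,2)] by auto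
      have "w \<noteq> z" using dist by auto
      have "linked E (Z i - {z})"
      proof (rule linked_from[OF sym, of w])
        show "w \<in> Z i - {z}" using wi \<open>w \<noteq> z\<close> by simp
        fix y assume y: "y \<in> Z i - {z}"
        then have "(w, y) \<in> (E' \<inter> Z i \<times> Z i)\<^sup>*" using linked[OF i(1)] wi by (auto simp: linked_def)
        then have "y \<noteq> z \<longrightarrow> (w, y) \<in> (E \<inter> (Z i - {z}) \<times> (Z i - {z}))\<^sup>*"
        proof (induction rule: rtrancl_induct)
          case (step a b)
          show ?case
          proof (cases "a = z")
            case True
            then have "b = w" using step.hyps zE' nu[OF i(1,2)] by auto
            then show ?thesis by simp
          next
            case False
            have "(a, b) \<in> E"
              using step.hyps nu[OF i(1,2)] unfolding E'_iff using f_simps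
                by (metis IntE SigmaE2 E'_iff)
            then show ?thesis using False step by (auto intro: rtrancl_into_rtrancl)
          qed
        qed simp
        then show "(w, y) \<in> (E \<inter> (Z i - {z}) \<times> (Z i - {z}))\<^sup>*" using y by simp
      qed
      with wi show ?thesis ..
    qed
    have linked': "linked E (Z' i)" if i: "i \<in> I" for i
    proof (cases "i = k")
      case True
      let ?S = "insert z (insert v (Z k))"
      \<comment> \<open>Every lift of a vertex reached from \<open>u\<close> is reached from
        \<open>z\<close>: the lifts \<open>u\<close> and \<open>v\<close> of the merged vertex are
        neighbours of \<open>z\<close>, and any other vertex has at most one lift.\<close>
      have reach: "\<forall>b. f b = y \<longrightarrow> (z, b) \<in> (E \<inter> ?S \<times> ?S)\<^sup>*" if y: "(u, y) \<in> (E' \<inter> Z k \<times> Z k)\<^sup>*" for y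
        using y
      proof (induction rule: rtrancl_induct)
        case base
        then show ?case using f_eq(1) zN k(2) by (auto intro!: r_into_rtrancl)
      next
        case (step y y')
        obtain a b where ab: "(a, b) \<in> E" "y = f a" "y' = f b" using step.hyps(2)
          by (auto simp: E'_iff)
        show ?case
        proof (cases "y' = u")
          case True
          then show ?thesis using f_eq(1) zN k(2) by (auto intro!: r_into_rtrancl)
        next
          case False
          have "(z, a) \<in> (E \<inter> ?S \<times> ?S)\<^sup>*" using step.IH ab by blast
          moreover have "(a, b) \<in> E \<inter> ?S \<times> ?S" using ab step.hyps(2) pre by blast
          ultimately have "(z, b) \<in> (E \<inter> ?S \<times> ?S)\<^sup>*" by (rule rtrancl_into_rtrancl)
          moreover have "c = b" if "f c = y'" for c
            using that ab(3) False f_simps by metis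
          ultimately show ?thesis by blast
        qed
      qed
      have "linked E ?S"
      proof (rule linked_from[OF sym, of z])
        fix y assume "y \<in> ?S"
        then consider "y = z" | "f y \<in> Z k" using pre by blast
        then show "(z, y) \<in> (E \<inter> ?S \<times> ?S)\<^sup>*"
        proof cases
          case 2
          then have "(u, f y) \<in> (E' \<inter> Z k \<times> Z k)\<^sup>*" using linked[OF k(1)] k(2)
            by (auto simp: linked_def)
          then show ?thesis using reach by blast
        qed simp
      qed simp
      then show ?thesis using True by (simp add: Z'_def)
    next
      case False
      show ?thesis
      proof (cases "z \<in> Z i")
        case True
        then show ?thesis using wz[OF i False] False by (simp add: Z'_def)
      next
        case nz: False
        have "E' \<inter> Z i \<times> Z i \<subseteq> E \<inter> Z i \<times> Z i"
          using nu[OF i False] E'_iff f_simps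
            by (smt (verit, best) IntE IntI SigmaD1 SigmaD2 subrelI)
        then have "linked E (Z i)" using linked[OF i] rtrancl_mono unfolding linked_def by blast
        then show ?thesis using nz False by (simp add: Z'_def)
      qed
    qed
    have disj': "Z' i \<inter> Z' j = {}" if "i \<in> I" "j \<in> I" "i \<noteq> j" for i j
      using disj[OF _ _ that(1,2)] vZ[OF that(1)] vZ[OF that(2)] that unfolding Z'_def by auto
    \<comment> \<open>An adjacency that used an edge from \<open>z\<close> must lead to the merged
      vertex, hence to branch set \<open>k\<close>. The edge from \<open>w\<close> to
      \<open>z\<close> replaces it, since \<open>z\<close> now belongs to
      \<open>Z' k\<close>.\<close>
    have adj_z: "(\<exists>x\<in>Z' i. \<exists>y\<in>Z' j. (x, y) \<in> E)"
      if ij: "(i, j) \<in> F" and ab: "(a, b) \<in> E" "f a \<in> Z i" "f b \<in> Z j" and a: "a = z" "i \<noteq> k"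
        for i j a b
    proof -
      have I: "i \<in> I" "j \<in> I" "i \<noteq> j" using ij F(1,3) by (auto simp: irrefl_def)
      have zi: "z \<in> Z i" using ab(2) a f_simps by simp
      have "w \<in> Z i" using wz[OF I(1) a(2) zi] ..
      then have "w \<notin> Z j" using disj I by blast
      then have "b \<noteq> w" using ab(3) f_simps by metis
      then have "f b = u" using ab(1) a zN f_simps by metis
      then have "j = k" using ab(3) disj I k by blast
      moreover have "w \<in> Z' i" using \<open>w \<in> Z i\<close> a(2) dist by (auto simp: Z'_def)
      moreover have "(w, z) \<in> E" using zN sym by (auto dest: symD)
      ultimately show ?thesis by (auto simp: Z'_def)
    qed
    have adj': "\<exists>x\<in>Z' i. \<exists>y\<in>Z' j. (x, y) \<in> E" if ij: "(i, j) \<in> F" for i j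
    proof -
      have I: "i \<in> I" "j \<in> I" using ij F(1) by auto
      obtain a b where ab: "(a, b) \<in> E" "f a \<in> Z i" "f b \<in> Z j" using adj[OF ij] E'_iff by metis
      have in': "c \<in> Z' l" if "f c \<in> Z l" "l \<in> I" "\<not> (c = z \<and> l \<noteq> k)" for c l
        using that pre[of c] nu[of l] f_simps unfolding Z'_def by (cases "c = v") auto
      consider "a = z" "i \<noteq> k" | "b = z" "j \<noteq> k" | "a \<in> Z' i" "b \<in> Z' j"
        using in'[OF ab(2) I(1)] in'[OF ab(3) I(2)] by blast
      then show ?thesis
      proof cases
        case 1
        then show ?thesis using adj_z[OF ij ab] by blast
      next
        case 2
        have "(j, i) \<in> F" "(b, a) \<in> E" using ij ab(1) F(2) sym by (auto dest: symD)
        then have "\<exists>y\<in>Z' j. \<exists>x\<in>Z' i. (y, x) \<in> E" using adj_z ab 2 by blast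
        then show ?thesis using sym by (blast dest: symD)
      next
        case 3
        then show ?thesis using ab(1) by blast
      qed
    qed
    have "minor_model E I F Z'"
      using linked' disj' adj' by (rule minor_modelI)
    then show ?thesis by blast
  qed
qed

text \<open>Every vertex of the pattern has three neighbours, which is the degree condition for
  unfolding.\<close>

lemma K33_minor_unfold:
  assumes "sym E" "E `` {z} = {u, v, w}" "u \<noteq> v" "w \<noteq> u" "w \<noteq> v" "z \<notin> {u, v, w}"
    and "K33_minor (fold_edges u v E)"
  shows "K33_minor E"
proof -
  obtain Z where Z: "minor_model (fold_edges u v E) {..<6} K33_edges Z"
    using assms(7) unfolding K33_minor_def ..
  have "card (K33_edges `` {i}) \<ge> 3" if "i \<in> {..<6}" for i
  proof (cases "i < 3")
    case True
    then have "K33_edges `` {i} = {3..<6}" by (auto simp: K33_edges_def)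
    then show ?thesis by simp
  next
    case False
    then have "K33_edges `` {i} = {..<3}" using that by (auto simp: K33_edges_def)
    then show ?thesis by simp
  qed
  then show ?thesis
    unfolding K33_minor_def
    by (intro minor_model_unfold[OF assms(1-6) _ _ _ _ Z])
      (auto simp: K33_edges_def sym_def irrefl_def)
qed

lemma K33_minorI:
  assumes sym: "sym E" and X: "linked E X" "u \<notin> X" "v \<notin> X" "z \<notin> X" "c \<notin> X" "c' \<notin> X"
    and dist: "distinct [u, v, z, c, c']"
    and adj: "{u, v} \<times> {z, c, c'} \<subseteq> E" "\<forall>y\<in>{z, c, c'}. \<exists>x\<in>X. (x, y) \<in> E"
  shows "K33_minor E"
proof -
  \<comment> \<open>The entry at position 2 of the list is a filler that is never read.\<close>
  define Z where "Z i = (if i = 2 then X else {[u, v, z, z, c, c'] ! i})" for i :: nat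
  have six: "i < 6 \<longleftrightarrow> i = 0 \<or> i = 1 \<or> i = 2 \<or> i = 3 \<or> i = 4 \<or> i = 5" for i :: nat by auto
  have "minor_model E {..<6} K33_edges Z" unfolding minor_model_def
  proof (intro conjI ballI impI)
    fix i :: nat assume "i \<in> {..<6}"
    then show "linked E (Z i)" using X(1) by (auto simp: Z_def linked_def)
  next
    fix i j :: nat assume "i \<in> {..<6}" "j \<in> {..<6}" "i \<noteq> j"
    then show "Z i \<inter> Z j = {}" using X dist by (auto simp: Z_def six)
  next
    have main: "\<exists>x\<in>Z i. \<exists>y\<in>Z j. (x, y) \<in> E" if "i < 3" "3 \<le> j" "j < 6" for i j
    proof -
      have "i = 0 \<or> i = 1 \<or> i = 2" "j = 3 \<or> j = 4 \<or> j = 5" using that by auto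
      then show ?thesis using adj by (auto simp: Z_def)
    qed
    fix e assume "e \<in> K33_edges"
    then consider i j where "e = (i, j)" "i < 3" "3 \<le> j" "j < 6" | i j
      where "e = (j, i)" "i < 3" "3 \<le> j" "j < 6"
      by (auto simp: K33_edges_def)
    then show "case e of (i, j) \<Rightarrow> \<exists>x\<in>Z i. \<exists>y\<in>Z j. (x, y) \<in> E"
    proof cases
      case 1
      then show ?thesis using main by simp
    next
      case 2
      then show ?thesis using main[of i j] sym by (auto dest: symD)
    qed
  qed
  then show ?thesis unfolding K33_minor_def by blast
qed

section \<open>Stresses\<close>

text \<open>Gaussian elimination by induction on the equations: one with a nonzero coefficient at
  \<open>v\<close> is solved for that unknown and substituted into the others, which removes one
  equation and one unknown.\<close>

lemma homogeneous_system_nonzero_solution: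
  fixes c :: "'k \<Rightarrow> 'u \<Rightarrow> 'f::field"
  assumes "finite K" "finite U" "card K < card U"
  obtains x where "\<And>k. k \<in> K \<Longrightarrow> (\<Sum>u\<in>U. c k u * x u) = 0" "\<exists>u\<in>U. x u \<noteq> 0"
proof -
  have "\<exists>x. (\<forall>k\<in>K. (\<Sum>u\<in>U. c k u * x u) = 0) \<and> (\<exists>u\<in>U. x u \<noteq> 0)"
    using assms
  proof (induction K arbitrary: U c rule: finite_induct)
    case empty
    then have "U \<noteq> {}" by auto
    then show ?case by (intro exI[of _ "\<lambda>_. 1"]) auto
  next
    case (insert k K)
    show ?case
    proof (cases "\<forall>u\<in>U. c k u = 0")
      case True
      have "card K < card U" using insert by simp
      with insert.IH[OF insert.prems(1), of c]
      obtain x where "\<forall>k\<in>K. (\<Sum>u\<in>U. c k u * x u) = 0" "\<exists>u\<in>U. x u \<noteq> 0" by blast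
      then show ?thesis using True by (intro exI[of _ x]) auto
    next
      case False
      then obtain v where v: "v \<in> U" "c k v \<noteq> 0" by blast
      define U' where "U' = U - {v}"
      have U': "finite U'" "v \<notin> U'" "U = insert v U'" "card K < card U'"
        using insert v by (auto simp: U'_def)
      define d where "d l u = c l u - c l v * c k u / c k v" for l u
      obtain x where x: "\<forall>l\<in>K. (\<Sum>u\<in>U'. d l u * x u) = 0" "\<exists>u\<in>U'. x u \<noteq> 0"
        using insert.IH[OF U'(1,4), of d] by blast
      define y where "y = x(v := - (\<Sum>u\<in>U'. c k u * x u) / c k v)"
      have y: "(\<Sum>u\<in>U. c l u * y u) = c l v * y v + (\<Sum>u\<in>U'. c l u * x u)" for l
      proof -
        have "(\<Sum>u\<in>U'. c l u * y u) = (\<Sum>u\<in>U'. c l u * x u)"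
          using U'(2) by (intro sum.cong) (auto simp: y_def)
        then show ?thesis using U' by simp
      qed
      have "(\<Sum>u\<in>U. c k u * y u) = 0" unfolding y using v by (simp add: y_def)
      moreover have "(\<Sum>u\<in>U. c l u * y u) = 0" if "l \<in> K" for l
      proof -
        have "d l u * x u = c l u * x u - c l v / c k v * (c k u * x u)" for u
          by (simp add: d_def left_diff_distrib)
        then have "(\<Sum>u\<in>U'. d l u * x u) =
            (\<Sum>u\<in>U'. c l u * x u) - c l v / c k v * (\<Sum>u\<in>U'. c k u * x u)"
          by (simp add: sum_subtractf sum_distrib_left)
        then have "(\<Sum>u\<in>U. c l u * y u) = (\<Sum>u\<in>U'. d l u * x u)"
          unfolding y by (simp add: y_def)
        then show ?thesis using x that by simp
      qed
      moreover have "\<exists>u\<in>U. y u \<noteq> 0" using x(2) U' by (auto simp: y_def)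
      ultimately show ?thesis by (intro exI[of _ y]) auto
    qed
  qed
  then show thesis using that by blast
qed

text \<open>The Fredholm alternative, by induction on the spanning vectors. It turns the spanning
  question for the products of linear forms into one about stresses.\<close>

lemma span_or_separating_functional:
  fixes c :: "'k \<Rightarrow> 'u \<Rightarrow> real" and t :: "'u \<Rightarrow> real"
  assumes "finite K" "finite U"
  shows "(\<exists>y. \<forall>u\<in>U. t u = (\<Sum>k\<in>K. y k * c k u)) \<or>
    (\<exists>x. (\<forall>k\<in>K. (\<Sum>u\<in>U. c k u * x u) = 0) \<and> (\<Sum>u\<in>U. t u * x u) \<noteq> 0)"
  using assms(1)
proof (induction K arbitrary: t rule: finite_induct)
  case empty
  show ?case
  proof (cases "\<forall>u\<in>U. t u = 0")
    case False
    then have "(\<Sum>u\<in>U. t u * t u) \<noteq> 0"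
      using assms(2) by (subst sum_nonneg_eq_0_iff) auto
    then show ?thesis by blast
  qed auto
next
  case (insert k K)
  define \<phi> where "\<phi> x s = (\<Sum>u\<in>U. s u * x u)" for x s :: "'u \<Rightarrow> real"
  have lin: "\<phi> x (\<lambda>u. s u - r * s' u) = \<phi> x s - r * \<phi> x s'" for x s s' r
    by (simp add: \<phi>_def left_diff_distrib sum_subtractf sum_distrib_left mult.assoc)
  have lin2: "\<phi> (\<lambda>u. x u - r * x' u) s = \<phi> x s - r * \<phi> x' s" for x x' s r
    by (simp add: \<phi>_def right_diff_distrib sum_subtractf sum_distrib_left algebra_simps)
  have ext: "\<exists>y. \<forall>u\<in>U. s u = (\<Sum>l\<in>insert k K. y l * c l u)"
    if "\<forall>u\<in>U. s u - r * c k u = (\<Sum>l\<in>K. y l * c l u)" for s r y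
  proof (intro exI[of _ "y(k := r)"] ballI)
    fix u assume "u \<in> U"
    have "(\<Sum>l\<in>K. (y(k := r)) l * c l u) = (\<Sum>l\<in>K. y l * c l u)"
      using insert.hyps by (intro sum.cong) auto
    then show "s u = (\<Sum>l\<in>insert k K. (y(k := r)) l * c l u)"
      using insert.hyps bspec[OF that \<open>u \<in> U\<close>] by simp
  qed
  show ?case
  proof (cases "\<exists>y. \<forall>u\<in>U. t u = (\<Sum>k\<in>K. y k * c k u)")
    case True
    then show ?thesis using ext[of t 0] by auto
  next
    case False
    then obtain x where x: "\<forall>l\<in>K. \<phi> x (c l) = 0" "\<phi> x t \<noteq> 0"
      using insert.IH[of t] unfolding \<phi>_def by blast
    show ?thesis
    proof (cases "\<phi> x (c k) = 0")
      case True
      then show ?thesis using x unfolding \<phi>_def by blast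
    next
      case dnz: False
      \<comment> \<open>Chosen so that \<open>x\<close> annihilates \<open>t'\<close>; adding a
        multiple of \<open>x\<close> to a functional then does not change its value at
        \<open>t'\<close>.\<close>
      define r where "r = \<phi> x t / \<phi> x (c k)"
      define t' where "t' u = t u - r * c k u" for u
      show ?thesis
      proof (cases "\<exists>y. \<forall>u\<in>U. t' u = (\<Sum>k\<in>K. y k * c k u)")
        case True
        then show ?thesis using ext[of t r] unfolding t'_def by blast
      next
        case False
        then obtain x' where x': "\<forall>l\<in>K. \<phi> x' (c l) = 0" "\<phi> x' t' \<noteq> 0"
          using insert.IH[of t'] unfolding \<phi>_def by blast
        \<comment> \<open>The multiple of \<open>x\<close> is the one that makes the functional
          vanish at \<open>c k\<close>.\<close>
        define x'' where "x'' u = x' u - \<phi> x' (c k) / \<phi> x (c k) * x u" for u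
        have e: "\<phi> x'' s = \<phi> x' s - \<phi> x' (c k) / \<phi> x (c k) * \<phi> x s" for s
          unfolding x''_def by (rule lin2)
        have "\<phi> x' t' = \<phi> x' t - r * \<phi> x' (c k)" unfolding t'_def by (rule lin)
        then have "\<phi> x'' t = \<phi> x' t'" unfolding e r_def by simp
        moreover have "\<forall>l\<in>insert k K. \<phi> x'' (c l) = 0" using x x' dnz by (auto simp: e)
        ultimately show ?thesis using x'(2) unfolding \<phi>_def by metis
      qed
    qed
  qed
qed

section \<open>Stresses and small supports\<close>

text \<open>Here \<open>p k x\<close> is the \<open>k\<close>-th coordinate of the position of
  \<open>x\<close>, indexed like the \<theta> matrices. The weight is a total function that vanishes
  off \<open>E\<close>, so its triviality can be stated without mentioning edges.\<close>

definition stress :: "'v set \<Rightarrow> ('v \<times> 'v) set \<Rightarrow> (nat \<Rightarrow> 'v \<Rightarrow> real) \<Rightarrow> ('v \<Rightarrow> 'v \<Rightarrow> real) \<Rightarrow> bool" where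
  "stress V E p w \<longleftrightarrow>
     (\<forall>x y. w x y = w y x) \<and> (\<forall>x y. (x, y) \<notin> E \<longrightarrow> w x y = 0) \<and>
     (\<forall>k\<in>{1, 2}. \<forall>x\<in>V. (\<Sum>y\<in>V. w x y * p k y) = 0)"

definition no_stress :: "'v set \<Rightarrow> ('v \<times> 'v) set \<Rightarrow> (nat \<Rightarrow> 'v \<Rightarrow> real) \<Rightarrow> bool" where
  "no_stress V E p \<longleftrightarrow> (\<forall>w. stress V E p w \<longrightarrow> (\<forall>x y. w x y = 0))"

text \<open>Each edge occurs in both orientations, so images under \<open>E\<close> are
  neighbourhoods and \<open>card E\<close> is twice the number of edges. The colouring is an
  argument of its own because it survives deletion and the folding of equally coloured
  vertices.\<close>

definition bigraph :: "('v \<Rightarrow> bool) \<Rightarrow> 'v set \<Rightarrow> ('v \<times> 'v) set \<Rightarrow> bool" where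
  "bigraph side V E \<longleftrightarrow> finite V \<and> E \<subseteq> V \<times> V \<and> sym E \<and> (\<forall>(x, y)\<in>E. side x \<noteq> side y)"

definition independent2 :: "(nat \<Rightarrow> 'v \<Rightarrow> real) \<Rightarrow> 'v \<Rightarrow> 'v \<Rightarrow> bool" where
  "independent2 p x y \<longleftrightarrow> p 1 x * p 2 y - p 2 x * p 1 y \<noteq> 0"

lemma independent2_sum_zero:
  assumes "independent2 p x y" "\<And>k. k \<in> {1, 2} \<Longrightarrow> r * p k x + s * p k y = 0"
  shows "r = 0" "s = 0"
proof -
  have 1: "r * p 1 x + s * p 1 y = 0" and 2: "r * p 2 x + s * p 2 y = 0" using assms(2) by auto
  let ?d = "p 1 x * p 2 y - p 2 x * p 1 y"
  have "r * ?d = (r * p 1 x + s * p 1 y) * p 2 y - (r * p 2 x + s * p 2 y) * p 1 y"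
    by (simp add: algebra_simps)
  then show "r = 0" using 1 2 assms(1) by (simp add: independent2_def)
  have "s * ?d = (r * p 2 x + s * p 2 y) * p 1 x - (r * p 1 x + s * p 1 y) * p 2 x"
    by (simp add: algebra_simps)
  then show "s = 0" using 1 2 assms(1) by (simp add: independent2_def)
qed

lemma stress_sym: "stress V E p w \<Longrightarrow> w x y = w y x"
  unfolding stress_def by blast

lemma stress_support: "stress V E p w \<Longrightarrow> w x y \<noteq> 0 \<Longrightarrow> (x, y) \<in> E"
  unfolding stress_def by blast

lemma stress_balance: "stress V E p w \<Longrightarrow> k \<in> {1, 2} \<Longrightarrow> x \<in> V \<Longrightarrow> (\<Sum>y\<in>V. w x y * p k y) = 0"
  unfolding stress_def by blast

lemma stressI:
  assumes "\<And>x y. w x y = w y x" "\<And>x y. w x y \<noteq> 0 \<Longrightarrow> (x, y) \<in> E"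
    and "\<And>k x. k \<in> {1, 2} \<Longrightarrow> x \<in> V \<Longrightarrow> (\<Sum>y\<in>V. w x y * p k y) = 0"
  shows "stress V E p w"
  using assms unfolding stress_def by blast

lemma no_stressD: "no_stress V E p \<Longrightarrow> stress V E p w \<Longrightarrow> w x y = 0"
  unfolding no_stress_def by blast

lemma bigraphD:
  assumes "bigraph side V E"
  shows "finite V" "E \<subseteq> V \<times> V" "sym E" "(x, y) \<in> E \<Longrightarrow> side x \<noteq> side y"
  using assms unfolding bigraph_def by auto

text \<open>Two independent vectors satisfy no nontrivial linear relation. The vertex
  \<open>x\<close>, which lies outside \<open>S\<close>, serves as the second one when
  \<open>S\<close> is a single point.\<close>

lemma balanced_small_support_zero:
  assumes V: "finite V" "x \<in> V"
    and ind: "\<And>y z. y \<in> V \<Longrightarrow> z \<in> V \<Longrightarrow> y \<noteq> z \<Longrightarrow> independent2 p y z"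
    and S: "card S \<le> 2" "S \<subseteq> V - {x}" "\<And>y. f y \<noteq> 0 \<Longrightarrow> y \<in> S"
    and bal: "\<And>k. k \<in> {1, 2} \<Longrightarrow> (\<Sum>y\<in>V. f y * p k y) = 0"
  shows "f y = 0"
proof (rule ccontr)
  assume "f y \<noteq> 0"
  then have y: "y \<in> S" using S(3) by blast
  have finS: "finite S" using S(2) V(1) by (meson finite_Diff finite_subset)
  have "card (S - {y}) \<le> 1" using S(1) y finS by simp
  then obtain b where b: "b \<in> V" "b \<noteq> y" "S \<subseteq> {y, b}"
  proof (cases "S = {y}")
    case True
    then show ?thesis using that[of x] V S(2) by auto
  next
    case False
    then obtain b where "b \<in> S" "b \<noteq> y" using y by blast
    moreover have "S - {y} = {b}"
      using \<open>card (S - {y}) \<le> 1\<close> calculation finS card_le_Suc0_iff_eq[of "S - {y}"] by auto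
    ultimately show ?thesis using that[of b] S(2) by blast
  qed
  have yV: "y \<in> V" using y S(2) by blast
  have "f y * p k y + f b * p k b = 0" if k: "k \<in> {1, 2}" for k
  proof -
    have "(\<Sum>a\<in>{y, b}. f a * p k a) = (\<Sum>a\<in>V. f a * p k a)"
      using V(1) yV b S(3) by (intro sum.mono_neutral_left) auto
    then show ?thesis using bal[OF k] b(2) by simp
  qed
  then have "f y = 0" using independent2_sum_zero[OF ind[OF yV b(1)]] b(2) by blast
  with \<open>f y \<noteq> 0\<close> show False ..
qed

text \<open>The weights at \<open>x\<close> form a relation between at most two independent vectors,
  so they vanish and the stress restricts to the remaining graph.\<close>

lemma no_stress_delete_vertex:
  assumes G: "bigraph side V E" and x: "x \<in> V" "card (E `` {x}) \<le> 2"
    and ind: "\<And>y z. y \<in> V \<Longrightarrow> z \<in> V \<Longrightarrow> y \<noteq> z \<Longrightarrow> independent2 p y z"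
    and IH: "no_stress (V - {x}) (E \<inter> (V - {x}) \<times> (V - {x})) p"
  shows "no_stress V E p"
  unfolding no_stress_def
proof (intro allI impI)
  fix w a b assume st: "stress V E p w"
  note V = bigraphD[OF G]
  note supp = stress_support[OF st] and wsym = stress_sym[OF st]
  have w0: "w x y = 0" for y
  proof (rule balanced_small_support_zero[OF V(1) x(1) ind x(2)])
    show "E `` {x} \<subseteq> V - {x}" using V(2,4) by blast
  qed (use supp stress_balance[OF st _ x(1)] in auto)
  have "stress (V - {x}) (E \<inter> (V - {x}) \<times> (V - {x})) p w"
  proof (rule stressI)
    fix y z assume yz: "w y z \<noteq> 0"
    have "y \<noteq> x" "z \<noteq> x" using yz w0 wsym[of y z] by auto
    then show "(y, z) \<in> E \<inter> (V - {x}) \<times> (V - {x})" using supp[OF yz] V(2) by blast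
  next
    fix k :: nat and y assume ky: "k \<in> {1, 2}" "y \<in> V - {x}"
    have "w y x = 0" using w0 wsym by metis
    then show "(\<Sum>z\<in>V - {x}. w y z * p k z) = 0"
      using stress_balance[OF st ky(1), of y] ky(2) sum.remove[OF V(1) x(1), of "\<lambda>z. w y z * p k z"]
      by simp
  qed (rule wsym)
  then show "w a b = 0" by (rule no_stressD[OF IH])
qed

text \<open>With \<open>v\<close> placed on \<open>u\<close>, adding the weights at \<open>v\<close>
  to those at \<open>u\<close> gives a stress of the folded graph, which vanishes. The weights at
  \<open>u\<close> and \<open>v\<close> are therefore opposite and live on common neighbours, too
  few to carry a relation.\<close>

lemma no_stress_unfold:
  assumes G: "bigraph side V E" and uv: "u \<in> V" "v \<in> V" "u \<noteq> v" "side u = side v"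
    and common: "card (E `` {u} \<inter> E `` {v}) \<le> 2"
    and ind: "\<And>y z. y \<in> V \<Longrightarrow> z \<in> V \<Longrightarrow> y \<noteq> z \<Longrightarrow> independent2 p y z"
    and IH: "no_stress (V - {v}) (fold_edges u v E) p"
  shows "no_stress V E (\<lambda>k. (p k)(v := p k u))"
  unfolding no_stress_def
proof (intro allI impI)
  define q where "q k = (p k)(v := p k u)" for k
  fix w a b assume "stress V E (\<lambda>k. (p k)(v := p k u)) w"
  then have st: "stress V E q w" by (simp add: q_def[abs_def])
  note V = bigraphD[OF G]
  note supp = stress_support[OF st] and wsym = stress_sym[OF st] and eq = stress_balance[OF st]
  have w0: "w u v = 0" "w u u = 0" "w v v = 0" "w v u = 0" using supp V(4) uv(4) by metis+
  define w' where "w' x y = (if x = v \<or> y = v then 0 else if x = u then w u y + w v y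
    else if y = u then w x u + w x v else w x y)" for x y
  have w'sym: "w' x y = w' y x" for x y
    unfolding w'_def using wsym by simp
  have split: "(\<Sum>y\<in>V. g y) = g u + g v + (\<Sum>y\<in>V - {u, v}. g y)" for g :: "'a \<Rightarrow> real"
  proof -
    have "(\<Sum>y\<in>V. g y) = g u + (\<Sum>y\<in>V - {u}. g y)" using V(1) uv by (simp add: sum.remove)
    moreover have "(\<Sum>y\<in>V - {u}. g y) = g v + (\<Sum>y\<in>V - {u} - {v}. g y)"
      using V(1) uv by (intro sum.remove) auto
    moreover have "V - {u} - {v} = V - {u, v}" by auto
    ultimately show ?thesis by simp
  qed
  have split': "(\<Sum>y\<in>V - {v}. g y) = g u + (\<Sum>y\<in>V - {u, v}. g y)" for g :: "'a \<Rightarrow> real"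
  proof -
    have "(\<Sum>y\<in>V - {v}. g y) = g u + (\<Sum>y\<in>V - {v} - {u}. g y)"
      using V(1) uv by (intro sum.remove) auto
    moreover have "V - {v} - {u} = V - {u, v}" by auto
    ultimately show ?thesis by simp
  qed
  have quv: "q k v = p k u" "q k u = p k u" "\<And>y. y \<noteq> v \<Longrightarrow> q k y = p k y" for k
    using uv by (auto simp: q_def)
  have "stress (V - {v}) (fold_edges u v E) p w'"
  proof (rule stressI)
    fix x y assume nz: "w' x y \<noteq> 0"
    then have "\<exists>a b. w a b \<noteq> 0 \<and> x = fold_vertex u v a \<and> y = fold_vertex u v b"
    proof -
      have "fold_vertex u v v = u" "\<And>a. a \<noteq> v \<Longrightarrow> fold_vertex u v a = a"
        by (auto simp: fold_vertex_def)
      moreover have "x \<noteq> v" "y \<noteq> v" using nz by (auto simp: w'_def)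
      moreover have "w x y \<noteq> 0 \<or> x = u \<and> w v y \<noteq> 0 \<or> y = u \<and> w x v \<noteq> 0"
        using nz by (auto simp: w'_def split: if_splits)
      ultimately show ?thesis by metis
    qed
    then show "(x, y) \<in> fold_edges u v E" using supp unfolding fold_edges_def by blast
  next
    fix k :: nat and x assume k: "k \<in> {1, 2}" and x: "x \<in> V - {v}"
    show "(\<Sum>y\<in>V - {v}. w' x y * p k y) = 0"
    proof (cases "x = u")
      case True
      have "(\<Sum>y\<in>V - {v}. w' u y * p k y) = (\<Sum>y\<in>V - {u, v}. w u y * p k y + w v y * p k y)"
        unfolding split' using w0 uv by (auto simp: w'_def distrib_right intro!: sum.cong)
      also have "\<dots> = (\<Sum>y\<in>V. w u y * q k y) + (\<Sum>y\<in>V. w v y * q k y)"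
        unfolding split using w0 by (simp add: quv sum.distrib)
      finally show ?thesis using eq[OF k] uv True by simp
    next
      case False
      have "(\<Sum>y\<in>V - {v}. w' x y * p k y) = (w x u + w x v) * p k u + (\<Sum>y\<in>V - {u, v}. w x y * p k y)"
        unfolding split' using False x uv by (auto simp: w'_def intro!: sum.cong)
      also have "\<dots> = (\<Sum>y\<in>V. w x y * q k y)"
        unfolding split by (simp add: quv distrib_right)
      finally show ?thesis using eq[OF k] x by simp
    qed
  qed (rule w'sym)
  then have w'0: "w' x y = 0" for x y by (rule no_stressD[OF IH])
  have neg: "w v y = - w u y" for y
  proof (cases "y = v")
    case False
    then show ?thesis using w'0[of u y] uv(3) by (simp add: w'_def)
  qed (use w0 in simp)
  have off: "w x y = 0" if "x \<notin> {u, v}" "y \<notin> {u, v}" for x y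
    using w'0[of x y] that by (simp add: w'_def)
  have "w v y = 0" for y
  proof (rule balanced_small_support_zero[OF V(1) uv(2) ind common])
    show "E `` {u} \<inter> E `` {v} \<subseteq> V - {v}" using V(2,4) by blast
    show "y \<in> E `` {u} \<inter> E `` {v}" if "w v y \<noteq> 0" for y
    proof -
      have "w u y \<noteq> 0" using that neg[of y] by simp
      then show ?thesis using that supp by blast
    qed
    \<comment> \<open>The positions \<open>p\<close> and \<open>q\<close> differ only at
      \<open>v\<close>, which is not its own neighbour; so the relation at \<open>v\<close> is one
      between vectors of the independent position \<open>p\<close>.\<close>
    show "(\<Sum>y\<in>V. w v y * p k y) = 0" if k: "k \<in> {1, 2}" for k
    proof -
      have "(\<Sum>y\<in>V. w v y * p k y) = (\<Sum>y\<in>V. w v y * q k y)"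
        using w0 by (intro sum.cong) (auto simp: q_def)
      then show ?thesis using eq[OF k uv(2)] by simp
    qed
  qed
  then have "w x y = 0" if "x \<in> {u, v}" for x y
    using that neg[of y] by auto
  then show "w a b = 0" using off wsym by metis
qed

section \<open>Trivial motions, the linear system of stresses and the edge bound\<close>

text \<open>Both expressions sum \<open>f x * w x y * g y\<close> over the pairs from opposite
  sides. With coordinates of the positions for \<open>f\<close> and \<open>g\<close> these are the
  linear dependencies among the balance equations that come from trivial motions.\<close>

lemma sum_sides_swap:
  fixes w :: "'v \<Rightarrow> 'v \<Rightarrow> real"
  assumes fin: "finite V" and sym: "\<And>x y. w x y = w y x"
    and bip: "\<And>x y. w x y \<noteq> 0 \<Longrightarrow> side x \<noteq> side y"
  shows "(\<Sum>x\<in>{x\<in>V. side x}. f x * (\<Sum>y\<in>V. w x y * g y)) =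
    (\<Sum>y\<in>{y\<in>V. \<not> side y}. g y * (\<Sum>x\<in>V. w y x * f x))"
proof -
  let ?A = "{x\<in>V. side x}" and ?B = "{x\<in>V. \<not> side x}"
  have 1: "(\<Sum>y\<in>V. w x y * g y) = (\<Sum>y\<in>?B. w x y * g y)" if "x \<in> ?A" for x
    using fin that bip[of x] by (intro sum.mono_neutral_right) auto
  have 2: "(\<Sum>x\<in>V. w y x * f x) = (\<Sum>x\<in>?A. w y x * f x)" if "y \<in> ?B" for y
    using fin that bip[of y] by (intro sum.mono_neutral_right) auto
  have "(\<Sum>x\<in>?A. f x * (\<Sum>y\<in>V. w x y * g y)) = (\<Sum>x\<in>?A. \<Sum>y\<in>?B. f x * (w x y * g y))"
    using 1 by (simp add: sum_distrib_left)
  also have "\<dots> = (\<Sum>y\<in>?B. \<Sum>x\<in>?A. f x * (w x y * g y))" by (rule sum.swap)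
  also have "\<dots> = (\<Sum>y\<in>?B. \<Sum>x\<in>?A. g y * (w y x * f x))"
    using sym by (intro sum.cong refl) (simp add: algebra_simps)
  also have "\<dots> = (\<Sum>y\<in>?B. g y * (\<Sum>x\<in>V. w y x * f x))"
    using 2 by (simp add: sum_distrib_left)
  finally show ?thesis .
qed

text \<open>One orientation of each edge: the unknowns of the linear system of stresses.\<close>

definition forward_edges :: "('v \<Rightarrow> bool) \<Rightarrow> ('v \<times> 'v) set \<Rightarrow> ('v \<times> 'v) set" where
  "forward_edges side E = {e \<in> E. side (fst e)}"

text \<open>An entry of the rigidity matrix, with row \<open>kv\<close> for a coordinate and a
  vertex. The value type is left general so that the same formula serves real positions and
  polynomial variables.\<close>

definition edge_coeff :: "(nat \<Rightarrow> 'v \<Rightarrow> 'a::comm_monoid_add) \<Rightarrow> nat \<times> 'v \<Rightarrow> 'v \<times> 'v \<Rightarrow> 'a" where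
  "edge_coeff p kv e = (if snd kv = fst e then p (fst kv) (snd e) else 0) +
     (if snd kv = snd e then p (fst kv) (fst e) else 0)"

definition sym_weight :: "('v \<times> 'v) set \<Rightarrow> ('v \<times> 'v \<Rightarrow> real) \<Rightarrow> 'v \<Rightarrow> 'v \<Rightarrow> real" where
  "sym_weight P x a b = (if (a, b) \<in> P then x (a, b) else 0) + (if (b, a) \<in> P then x (b, a) else 0)"

lemma sym_weight_balance:
  assumes fin: "finite V" and P: "P \<subseteq> V \<times> V" and v: "v \<in> V"
  shows "(\<Sum>y\<in>V. sym_weight P x v y * p k y) = (\<Sum>e\<in>P. edge_coeff p (k, v) e * x e)"
proof -
  let ?i = "\<lambda>a b. if (a, b) \<in> P then x (a, b) else 0"
  have "(\<Sum>e\<in>P. edge_coeff p (k, v) e * x e) =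
      (\<Sum>e\<in>V \<times> V. edge_coeff p (k, v) e * (if e \<in> P then x e else 0))"
    using fin P by (intro sum.mono_neutral_cong_left) auto
  also have "\<dots> = (\<Sum>a\<in>V. \<Sum>b\<in>V. edge_coeff p (k, v) (a, b) * ?i a b)"
    by (auto simp: sum.cartesian_product intro!: sum.cong)
  also have "\<dots> = (\<Sum>a\<in>V. \<Sum>b\<in>V. if v = a then p k b * ?i a b else 0) +
      (\<Sum>a\<in>V. \<Sum>b\<in>V. if v = b then p k a * ?i a b else 0)"
    unfolding sum.distrib[symmetric] by (intro sum.cong refl) (auto simp: edge_coeff_def
        distrib_right)
  also have "(\<Sum>a\<in>V. \<Sum>b\<in>V. if v = a then p k b * ?i a b else 0) = (\<Sum>b\<in>V. p k b * ?i v b)"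
  proof -
    have "(\<Sum>a\<in>V. \<Sum>b\<in>V. if v = a then p k b * ?i a b else 0) =
        (\<Sum>a\<in>V. if v = a then (\<Sum>b\<in>V. p k b * ?i a b) else 0)"
      by (intro sum.cong refl) auto
    then show ?thesis using fin v by simp
  qed
  also have "(\<Sum>a\<in>V. \<Sum>b\<in>V. if v = b then p k a * ?i a b else 0) = (\<Sum>a\<in>V. p k a * ?i a v)"
    using fin v by (intro sum.cong refl) simp
  also have "(\<Sum>b\<in>V. p k b * ?i v b) + (\<Sum>a\<in>V. p k a * ?i a v) = (\<Sum>y\<in>V. sym_weight P x v y * p k y)"
    unfolding sum.distrib[symmetric] sym_weight_def
      by (intro sum.cong refl) (simp add: algebra_simps)
  finally show ?thesis by simp
qed

lemma forward_edgesD: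
  assumes G: "bigraph side V E" and "(a, b) \<in> forward_edges side E"
  shows "(a, b) \<in> E" "(b, a) \<in> E" "side a" "\<not> side b"
  using assms bigraphD[OF G] by (auto simp: forward_edges_def dest: symD)

lemma card_edges:
  assumes G: "bigraph side V E"
  shows "card E = 2 * card (forward_edges side E)"
proof -
  let ?P = "forward_edges side E"
  note V = bigraphD[OF G]
  have fin: "finite E" using V(1,2) by (meson finite_SigmaI finite_subset)
  have "E = ?P \<union> ?P\<inverse>"
    using V(3,4) by (auto simp: forward_edges_def dest: symD)
  moreover have "?P \<inter> ?P\<inverse> = {}" using forward_edgesD[OF G] by blast
  moreover have "finite ?P" using fin by (simp add: forward_edges_def)
  ultimately have "card E = card ?P + card (?P\<inverse>)" by (metis card_Un_disjoint finite_converse)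
  then show ?thesis by simp
qed

lemma stress_sym_weight:
  assumes G: "bigraph side V E"
    and x: "\<And>k v. k \<in> {1, 2} \<Longrightarrow> v \<in> V \<Longrightarrow> (\<Sum>e\<in>forward_edges side E. edge_coeff p (k, v) e * x e) = 0"
  shows "stress V E p (sym_weight (forward_edges side E) x)"
proof (rule stressI)
  show "sym_weight (forward_edges side E) x a b = sym_weight (forward_edges side E) x b a" for a b
    by (simp add: sym_weight_def)
  show "(a, b) \<in> E" if "sym_weight (forward_edges side E) x a b \<noteq> 0" for a b
    using that forward_edgesD[OF G] by (auto simp: sym_weight_def split: if_splits)
  have P: "forward_edges side E \<subseteq> V \<times> V" using bigraphD(2)[OF G] by (auto simp: forward_edges_def)
  show "(\<Sum>y\<in>V. sym_weight (forward_edges side E) x v y * p k y) = 0" if "k \<in> {1, 2}" "v \<in> V" for k v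
    using sym_weight_balance[OF bigraphD(1)[OF G] P that(2)] x[OF that] by simp
qed

text \<open>Stated as triviality of a matrix kernel, the absence of stresses becomes accessible to
  equation counting and to genericity.\<close>

lemma no_stress_iff:
  assumes G: "bigraph side V E"
  shows "no_stress V E p \<longleftrightarrow>
    (\<forall>x. (\<forall>kv\<in>{1, 2} \<times> V. (\<Sum>e\<in>forward_edges side E. edge_coeff p kv e * x e) = 0) \<longrightarrow>
      (\<forall>e\<in>forward_edges side E. x e = 0))"
  (is "_ \<longleftrightarrow> ?R")
proof
  assume ns: "no_stress V E p"
  show ?R
  proof (intro allI impI ballI)
    fix x e assume "\<forall>kv\<in>{1, 2} \<times> V. (\<Sum>e\<in>forward_edges side E. edge_coeff p kv e * x e) = 0"
      and e: "e \<in> forward_edges side E"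
    then have "stress V E p (sym_weight (forward_edges side E) x)"
      by (intro stress_sym_weight[OF G]) auto
    then have "sym_weight (forward_edges side E) x (fst e) (snd e) = 0" by (rule no_stressD[OF ns])
    moreover have "(snd e, fst e) \<notin> forward_edges side E"
      using e forward_edgesD[OF G, of "fst e" "snd e"] forward_edgesD[OF G, of "snd e" "fst e"]
        by auto
    ultimately show "x e = 0" using e by (simp add: sym_weight_def)
  qed
next
  assume R: ?R
  show "no_stress V E p" unfolding no_stress_def
  proof (intro allI impI)
    fix w a b assume st: "stress V E p w"
    let ?x = "\<lambda>e. w (fst e) (snd e)"
    note V = bigraphD[OF G]
    have P: "forward_edges side E \<subseteq> V \<times> V" using V(2) by (auto simp: forward_edges_def)
    have w: "w a b = sym_weight (forward_edges side E) ?x a b" for a b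
    proof (cases "(a, b) \<in> E")
      case True
      then have "(b, a) \<in> E" "side a \<noteq> side b" using V(3,4) by (auto dest: symD)
      then show ?thesis using True stress_sym[OF st]
        by (auto simp: sym_weight_def forward_edges_def)
    next
      case False
      then have "(b, a) \<notin> E" "w a b = 0" using V(3) stress_support[OF st] by (auto dest: symD)
      then show ?thesis using False by (auto simp: sym_weight_def forward_edges_def)
    qed
    have "(\<Sum>e\<in>forward_edges side E. edge_coeff p (k, v) e * ?x e) = 0" if "k \<in> {1, 2}" "v \<in> V"
      for k v
      using stress_balance[OF st that] sym_weight_balance[OF V(1) P that(2), of ?x p k]
        by (simp only: w[symmetric])
    then have x0: "\<forall>e\<in>forward_edges side E. ?x e = 0" using R[rule_format, of ?x] by auto
    have "sym_weight (forward_edges side E) ?x a b = 0"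
      using bspec[OF x0, of "(a, b)"] bspec[OF x0, of "(b, a)"] unfolding sym_weight_def by simp
    then show "w a b = 0" by (simp only: w[symmetric])
  qed
qed

text \<open>Both balance equations at \<open>x0\<close> follow from those at the other vertices, so
  there are at most \<open>2 * (card V - 1)\<close> independent equations, and hence edges. The
  bound doubles because \<open>E\<close> holds both orientations.\<close>

lemma no_stress_card_edges:
  assumes G: "bigraph side V E" and x0: "x0 \<in> V" "k0 \<in> {1, 2}" "p k0 x0 \<noteq> 0"
    and ns: "no_stress V E p"
  shows "card E \<le> 4 * (card V - 1)"
proof (rule ccontr)
  let ?P = "forward_edges side E"
  note V = bigraphD[OF G]
  assume "\<not> card E \<le> 4 * (card V - 1)"
  then have "2 * (card V - 1) < card ?P" using card_edges[OF G] by simp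
  moreover have "card ({1, 2::nat} \<times> (V - {x0})) = 2 * (card V - 1)"
    using V(1) x0(1) by (simp add: card_cartesian_product)
  ultimately have less: "card ({1, 2::nat} \<times> (V - {x0})) < card ?P" by simp
  have fin: "finite ?P" "finite ({1, 2::nat} \<times> (V - {x0}))"
    using V(1,2) finite_subset[of E "V \<times> V"] by (auto simp: forward_edges_def)
  obtain x where x: "\<And>kv. kv \<in> {1, 2} \<times> (V - {x0}) \<Longrightarrow> (\<Sum>e\<in>?P. edge_coeff p kv e * x e) = 0"
    and nz: "\<exists>e\<in>?P. x e \<noteq> 0"
    by (rule homogeneous_system_nonzero_solution[OF fin(2,1) less, of "edge_coeff p"]) blast
  define w where "w = sym_weight ?P x"
  have P: "?P \<subseteq> V \<times> V" using V(2) by (auto simp: forward_edges_def)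
  have bal: "(\<Sum>y\<in>V. w v y * p k y) = (\<Sum>e\<in>?P. edge_coeff p (k, v) e * x e)" if "v \<in> V" for k v
    unfolding w_def by (rule sym_weight_balance[OF V(1) P that])
  have wsym: "w a b = w b a" for a b by (simp add: w_def sym_weight_def)
  have wbip: "side a \<noteq> side b" if "w a b \<noteq> 0" for a b
    using that forward_edgesD[OF G] by (auto simp: w_def sym_weight_def split: if_splits)
  have "(\<Sum>y\<in>V. w x0 y * p k y) = 0" if k: "k \<in> {1, 2}" for k
  proof -
    have other: "(\<Sum>y\<in>V. w v y * p l y) = 0" if "l \<in> {1, 2}" "v \<in> V" "v \<noteq> x0" for l v
      using bal[of v l] x[of "(l, v)"] that by simp
    define same where "same y \<longleftrightarrow> side y = side x0" for y
    \<comment> \<open>In this pairing only the term of \<open>x0\<close> survives, and its factor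
      \<open>p k0 x0\<close> is nonzero.\<close>
    have "(\<Sum>v\<in>{v\<in>V. same v}. p k0 v * (\<Sum>y\<in>V. w v y * p k y)) =
        (\<Sum>v\<in>{v\<in>V. \<not> same v}. p k v * (\<Sum>y\<in>V. w v y * p k0 y))"
      using wbip by (intro sum_sides_swap[OF V(1) wsym]) (auto simp: same_def)
    also have "\<dots> = 0" using other[OF x0(2)] by (intro sum.neutral) (auto simp: same_def)
    also have "(\<Sum>v\<in>{v\<in>V. same v}. p k0 v * (\<Sum>y\<in>V. w v y * p k y)) =
        (\<Sum>v\<in>{x0}. p k0 v * (\<Sum>y\<in>V. w v y * p k y))"
      using V(1) x0(1) other[OF k] by (intro sum.mono_neutral_right) (auto simp: same_def)
    finally show ?thesis using x0(3) by simp
  qed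
  then have "(\<Sum>e\<in>?P. edge_coeff p (k, v) e * x e) = 0" if "k \<in> {1, 2}" "v \<in> V" for k v
    using bal[of v k] x[of "(k, v)"] that by (cases "v = x0") auto
  then have "\<forall>e\<in>?P. x e = 0" using ns unfolding no_stress_iff[OF G] by auto
  with nz show False by blast
qed

text \<open>
  The forces on \<open>u, c, v\<close> that pair to zero with the four-dimensional space of trivial motions form
  a two-dimensional space, and the edges \<open>uc\<close> and \<open>vc\<close> already span it.
\<close>

lemma glue_restrict:
  assumes G: "bigraph side V E" and V1: "V1 \<subseteq> V" "{u, c, v} \<subseteq> V1" "u \<noteq> v"
    and e: "(u, c) \<in> E" "(v, c) \<in> E"
    and sep: "\<And>x y. x \<in> V1 - {u, c, v} \<Longrightarrow> (x, y) \<in> E \<Longrightarrow> y \<in> V1"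
    and ind: "independent2 p u v"
    and ns: "no_stress V1 (E \<inter> V1 \<times> V1) p" and st: "stress V E p w"
    and xy: "x \<in> V1" "y \<in> V1" "w x y \<noteq> 0"
  shows "{x, y} = {u, c} \<or> {x, y} = {v, c}"
proof -
  note V = bigraphD[OF G] and supp = stress_support[OF st] and wsym = stress_sym[OF st]
  have fin1: "finite V1" using V(1) V1(1) finite_subset by blast
  \<comment> \<open>The stress cut off to \<open>V1\<close>; the forces \<open>f\<close> that it
    leaves unbalanced live on \<open>u\<close>, \<open>c\<close>, \<open>v\<close>.\<close>
  define w1 where "w1 x y = (if x \<in> V1 \<and> y \<in> V1 then w x y else 0)" for x y
  define f where "f k x = (\<Sum>y\<in>V1. w1 x y * p k y)" for k x
  have w1: "w1 x y = w1 y x" "w1 x y \<noteq> 0 \<Longrightarrow> side x \<noteq> side y" for x y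
    using wsym supp V(4) by (auto simp: w1_def split: if_splits)
  have f0: "f k x = 0" if "x \<in> V1 - {u, c, v}" "k \<in> {1, 2}" for k x
  proof -
    have "f k x = (\<Sum>y\<in>V1. w x y * p k y)" unfolding f_def w1_def using that by simp
    also have "\<dots> = (\<Sum>y\<in>V. w x y * p k y)"
      using V(1) V1(1) sep[OF that(1)] supp by (intro sum.mono_neutral_left) auto
    finally show ?thesis using stress_balance[OF st that(2)] that(1) V1(1) by auto
  qed
  have sides: "side u = side v" "side u \<noteq> side c" using V(4)[OF e(1)] V(4)[OF e(2)] by auto
  then have ne: "u \<noteq> c" "v \<noteq> c" by auto
  \<comment> \<open>The pairings with the trivial motions, one for each pair of coordinates.\<close>
  have moment: "p k u * f l u + p k v * f l v = p l c * f k c" if "k \<in> {1, 2}" "l \<in> {1, 2}" for k l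
  proof -
    define same where "same y \<longleftrightarrow> side y = side u" for y
    have "(\<Sum>x\<in>{x\<in>V1. same x}. p k x * f l x) = (\<Sum>y\<in>{y\<in>V1. \<not> same y}. p l y * f k y)"
      unfolding f_def using w1 by (intro sum_sides_swap[OF fin1]) (auto simp: same_def)
    also have "(\<Sum>x\<in>{x\<in>V1. same x}. p k x * f l x) = (\<Sum>x\<in>{u, v}. p k x * f l x)"
      using fin1 V1(2) sides f0 that by (intro sum.mono_neutral_right) (auto simp: same_def)
    also have "(\<Sum>y\<in>{y\<in>V1. \<not> same y}. p l y * f k y) = (\<Sum>y\<in>{c}. p l y * f k y)"
      using fin1 V1(2) sides f0 that by (intro sum.mono_neutral_right) (auto simp: same_def)
    finally show ?thesis using V1(3) by simp
  qed
  define D where "D = p 1 u * p 2 v - p 2 u * p 1 v"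
  have D: "D \<noteq> 0" using ind by (simp add: independent2_def D_def)
  \<comment> \<open>Cramer's rule for the force at \<open>c\<close> in terms of the positions of
    \<open>u\<close> and \<open>v\<close>. The coefficients \<open>r\<close> and \<open>s\<close>
    are the weights that \<open>uc\<close> and \<open>vc\<close> have to carry.\<close>
  define r where "r = (f 1 c * p 2 v - f 2 c * p 1 v) / D"
  define s where "s = (p 1 u * f 2 c - p 2 u * f 1 c) / D"
  have fc: "f k c = r * p k u + s * p k v" if "k \<in> {1, 2}" for k
  proof -
    have "(r * p k u + s * p k v) * D = f k c * D"
    proof -
      have "r * D = f 1 c * p 2 v - f 2 c * p 1 v" "s * D = p 1 u * f 2 c - p 2 u * f 1 c"
        using D by (auto simp: r_def s_def)
      moreover have "(r * p k u + s * p k v) * D = (r * D) * p k u + (s * D) * p k v"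
        by (simp add: algebra_simps)
      ultimately have "(r * p k u + s * p k v) * D =
          (f 1 c * p 2 v - f 2 c * p 1 v) * p k u + (p 1 u * f 2 c - p 2 u * f 1 c) * p k v" by simp
      also have "\<dots> = f k c * D" using that by (auto simp: D_def algebra_simps)
      finally show ?thesis .
    qed
    then show ?thesis using D by simp
  qed
  have fuv: "f l u = r * p l c" "f l v = s * p l c" if l: "l \<in> {1, 2}" for l
  proof -
    have "(f l u - r * p l c) * p k u + (f l v - s * p l c) * p k v = 0" if "k \<in> {1, 2}" for k
      using moment[OF that l] fc[OF that] by (simp add: algebra_simps)
    then have "f l u - r * p l c = 0" "f l v - s * p l c = 0"
      using independent2_sum_zero[OF ind] by blast+
    then show "f l u = r * p l c" "f l v = s * p l c" by auto
  qed
  define h where "h t a x y = (if x = t \<and> y = c \<or> x = c \<and> y = t then a else 0)"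
    for t x y and a :: real
  have h_sum: "(\<Sum>y\<in>V1. h t a x y * p k y) = (if x = t then a * p k c else if x =
      c then a * p k t else 0)"
    if "t \<in> {u, v}" for t a x k
  proof -
    have "t \<noteq> c" "t \<in> V1" "c \<in> V1" using that ne V1 by auto
    have "(\<Sum>y\<in>V1. h t a x y * p k y) = (\<Sum>y\<in>V1. if x = t \<and> y = c then a * p k c else 0) +
        (\<Sum>y\<in>V1. if x = c \<and> y = t then a * p k t else 0)"
      unfolding sum.distrib[symmetric] using \<open>t \<noteq> c\<close> by (intro sum.cong) (auto simp: h_def)
    also have "(\<Sum>y\<in>V1. if x = t \<and> y = c then a * p k c else 0) = (if x = t then a * p k c else 0)"
      using fin1 \<open>c \<in> V1\<close> by (cases "x = t") auto
    also have "(\<Sum>y\<in>V1. if x = c \<and> y = t then a * p k t else 0) = (if x = c then a * p k t else 0)"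
      using fin1 \<open>t \<in> V1\<close> by (cases "x = c") auto
    finally show ?thesis using \<open>t \<noteq> c\<close> by auto
  qed
  \<comment> \<open>Removing these two weights balances all forces, so what remains is a stress on
    \<open>V1\<close> and must vanish.\<close>
  define w' where "w' x y = w1 x y - h u r x y - h v s x y" for x y
  have "stress V1 (E \<inter> V1 \<times> V1) p w'"
  proof (rule stressI)
    show "w' x y = w' y x" for x y using w1(1)[of x y]
      by (simp add: w'_def h_def conj_commute disj_commute)
    show "(x, y) \<in> E \<inter> V1 \<times> V1" if "w' x y \<noteq> 0" for x y
    proof -
      have "w1 x y \<noteq> 0 \<or> h u r x y \<noteq> 0 \<or> h v s x y \<noteq> 0" using that by (auto simp: w'_def)
      then have "w1 x y \<noteq> 0 \<or> (x, y) \<in> {(u, c), (c, u), (v, c), (c, v)}"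
        by (auto simp: h_def split: if_splits)
      then show ?thesis using supp e V(3) V1(2) by (auto simp: w1_def dest: symD split: if_splits)
    qed
    show "(\<Sum>y\<in>V1. w' x y * p k y) = 0" if k: "k \<in> {1, 2}" and x: "x \<in> V1" for k x
    proof -
      have "(\<Sum>y\<in>V1. w' x y * p k y) =
          f k x - (\<Sum>y\<in>V1. h u r x y * p k y) - (\<Sum>y\<in>V1. h v s x y * p k y)"
        by (simp add: w'_def f_def left_diff_distrib sum_subtractf)
      also have "\<dots> = 0"
      proof -
        consider "x = u" | "x = v" | "x = c" | "x \<in> V1 - {u, c, v}" using x by blast
        then show ?thesis
        proof cases
          case 1
          then show ?thesis using V1(3) ne fuv[OF k] by (simp add: h_sum)
        next
          case 2
          then show ?thesis using V1(3) ne fuv[OF k] by (simp add: h_sum)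
        next
          case 3
          then show ?thesis using ne fc[OF k] by (simp add: h_sum)
        next
          case 4
          then show ?thesis using f0[OF 4 k] by (simp add: h_sum)
        qed
      qed
      finally show ?thesis .
    qed
  qed
  then have "w' x y = 0" by (rule no_stressD[OF ns])
  then have "h u r x y \<noteq> 0 \<or> h v s x y \<noteq> 0" using xy by (auto simp: w'_def w1_def)
  then show ?thesis by (auto simp: h_def split: if_splits)
qed

text \<open>Within either part the stress is confined to the edges \<open>uc\<close> and
  \<open>vc\<close>. At \<open>u\<close> and at \<open>v\<close> only the neighbour \<open>c\<close>
  is then left, and a single nonzero vector cannot be balanced.\<close>

lemma no_stress_glue:
  assumes G: "bigraph side V E" and V12: "V = V1 \<union> V2" "V1 \<inter> V2 = {u, c, v}" "u \<noteq> v"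
    and EV: "E \<subseteq> V1 \<times> V1 \<union> V2 \<times> V2" and e: "(u, c) \<in> E" "(v, c) \<in> E"
    and ind: "\<And>y z. y \<in> V \<Longrightarrow> z \<in> V \<Longrightarrow> y \<noteq> z \<Longrightarrow> independent2 p y z"
    and ns: "no_stress V1 (E \<inter> V1 \<times> V1) p" "no_stress V2 (E \<inter> V2 \<times> V2) p"
  shows "no_stress V E p"
  unfolding no_stress_def
proof (intro allI impI)
  fix w a b assume st: "stress V E p w"
  note V = bigraphD[OF G]
  have uv: "u \<in> V" "v \<in> V" "c \<in> V" "u \<noteq> c" "v \<noteq> c" using V12 V(4) e by auto
  have ind': "independent2 p u v" using ind uv V12(3) by blast
  have on: "{x, y} = {u, c} \<or> {x, y} = {v, c}" if "w x y \<noteq> 0" for x y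
  proof -
    have "(x, y) \<in> E" using stress_support[OF st that] .
    then consider "x \<in> V1" "y \<in> V1" | "x \<in> V2" "y \<in> V2" using EV by blast
    then show ?thesis
    proof cases
      case 1
      show ?thesis
        by (rule glue_restrict[OF G _ _ V12(3) e _ ind' ns(1) st 1 that]) (use V12 EV in auto)
    next
      case 2
      show ?thesis
        by (rule glue_restrict[OF G _ _ V12(3) e _ ind' ns(2) st 2 that]) (use V12 EV in auto)
    qed
  qed
  have w0: "w t y = 0" if t: "t \<in> {u, v}" for t y
  proof (rule balanced_small_support_zero[OF V(1) _ ind, of t "{c}"])
    show "y \<in> {c}" if "w t y \<noteq> 0" for y
      using on[OF that] t uv V12(3) by (auto simp: doubleton_eq_iff)
  qed (use t uv stress_balance[OF st] in auto)
  show "w a b = 0"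
  proof (rule ccontr)
    assume nz: "w a b \<noteq> 0"
    then have "a \<in> {u, v} \<or> b \<in> {u, v}" using on[OF nz] by (auto simp: doubleton_eq_iff)
    then show False using nz w0 stress_sym[OF st, of a b] by auto
  qed
qed

section \<open>Bipartite graphs without \<open>K\<^sub>3\<^sub>,\<^sub>3\<close> minor\<close>

lemma bigraph_restrict:
  assumes "bigraph side V E" "V' \<subseteq> V"
  shows "bigraph side V' (E \<inter> V' \<times> V')"
  using assms finite_subset unfolding bigraph_def sym_def by blast

lemma bigraph_fold:
  assumes G: "bigraph side V E" and uv: "u \<in> V" "u \<noteq> v" "side u = side v"
  shows "bigraph side (V - {v}) (fold_edges u v E)"
proof -
  note V = bigraphD[OF G]
  have f: "side (fold_vertex u v x) = side x" "x \<in> V \<Longrightarrow> fold_vertex u v x \<in> V - {v}" for x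
    using uv by (auto simp: fold_vertex_def)
  have "fold_edges u v E \<subseteq> (V - {v}) \<times> (V - {v})"
    unfolding fold_edges_def using V(2) f(2) by blast
  moreover have "side x \<noteq> side y" if "(x, y) \<in> fold_edges u v E" for x y
    using that V(4) f(1) unfolding fold_edges_def by blast
  ultimately show ?thesis
    using V(1) sym_fold_edges[OF V(3)] unfolding bigraph_def by blast
qed

lemma card_fold_edges: "finite E \<Longrightarrow> card (fold_edges u v E) \<le> card E"
proof -
  assume "finite E"
  moreover have "fold_edges u v E = (\<lambda>e. (fold_vertex u v (fst e), fold_vertex u v (snd e))) ` E"
    by (force simp: fold_edges_def)
  ultimately show ?thesis by (simp add: card_image_le)
qed

lemma finite_edges: "bigraph side V E \<Longrightarrow> finite E"
  unfolding bigraph_def by (meson finite_SigmaI finite_subset)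

lemma sum_degrees:
  assumes "bigraph side V E"
  shows "(\<Sum>x\<in>V. card (E `` {x})) = card E"
proof -
  note V = bigraphD[OF assms]
  have "E = (SIGMA x:V. E `` {x})" using V(2) by auto
  moreover have "finite (E `` {x})" for x using V(1,2) finite_subset[of "E `` {x}" V] by blast
  ultimately show ?thesis using card_SigmaI[OF V(1), of "\<lambda>x. E `` {x}"] by simp
qed

text \<open>If \<open>w\<close> reaches \<open>c'\<close> around the path \<open>u c v\<close> and
  also \<open>c\<close> around \<open>u c' v\<close>, then the component \<open>X\<close> of
  \<open>w\<close> off the five vertices touches \<open>z\<close>, \<open>c\<close> and
  \<open>c'\<close>, which gives a minor with classes \<open>u, v, X\<close> and
  \<open>z, c, c'\<close>.\<close>

lemma common_neighbours_separate:
  assumes G: "bigraph side V E" and noK: "\<not> K33_minor E"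
    and N: "E `` {z} = {u, v, w}" "u \<noteq> v" "w \<noteq> u" "w \<noteq> v"
    and cc: "c \<noteq> z" "c' \<noteq> z" "c \<noteq> c'" "{c, c'} \<subseteq> E `` {u} \<inter> E `` {v}"
  obtains d d' where "d \<in> {c, c'}" "d' \<in> {c, c'}" "d \<noteq> d'"
    "(w, d') \<notin> (E \<inter> (V - {u, d, v}) \<times> (V - {u, d, v}))\<^sup>*"
proof (rule ccontr)
  assume "\<not> thesis"
  with that have reach: "(w, d') \<in> (E \<inter> (V - {u, d, v}) \<times> (V - {u, d, v}))\<^sup>*"
    if "d \<in> {c, c'}" "d' \<in> {c, c'}" "d \<noteq> d'" for d d' using that by blast
  note V = bigraphD[OF G]
  have zE: "(z, x) \<in> E \<longleftrightarrow> x \<in> {u, v, w}" for x using N(1) by blast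
  then have sides: "side u \<noteq> side z" "side v \<noteq> side z" "side w \<noteq> side z" using V(4) by blast+
  have csides: "side c \<noteq> side u" "side c' \<noteq> side u" using V(4) cc(4) by blast+
  have wV: "w \<in> V" using zE V(2) by blast
  define S where "S = V - {u, v, z, c, c'}"
  define X where "X = {y. (w, y) \<in> (E \<inter> S \<times> S)\<^sup>*}"
  have wne: "w \<notin> {u, v, z, c, c'}" using N sides csides by auto
  have wS: "w \<in> S" using wne wV by (simp add: S_def)
  have XS: "X \<subseteq> S"
  proof
    fix y assume "y \<in> X"
    then have "(w, y) \<in> (E \<inter> S \<times> S)\<^sup>*" by (simp add: X_def)
    then show "y \<in> S" by (induction rule: rtrancl_induct) (use wS in auto)
  qed
  have X_step: "y \<in> X" if "x \<in> X" "(x, y) \<in> E" "y \<in> S" for x y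
    using that XS rtrancl_into_rtrancl[of w x "E \<inter> S \<times> S" y] unfolding X_def by blast
  have "w \<in> X" by (simp add: X_def)
  have adj: "\<exists>x\<in>X. (x, d') \<in> E" if d: "d \<in> {c, c'}" "d' \<in> {c, c'}" "d \<noteq> d'" for d d'
  proof -
    have dd: "{d, d'} = {c, c'}" using d by auto
    \<comment> \<open>A walk from \<open>w\<close> avoiding \<open>u\<close>, \<open>d\<close>,
      \<open>v\<close> stays in \<open>X\<close> until it meets \<open>d'\<close>, apart from
      detours to \<open>z\<close>, which can only return to \<open>w\<close>.\<close>
    have inv: "t \<in> X \<or> t = z \<or> (\<exists>x\<in>X. (x, d') \<in> E)"
      if "(w, t) \<in> (E \<inter> (V - {u, d, v}) \<times> (V - {u, d, v}))\<^sup>*" for t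
      using that
    proof (induction rule: rtrancl_induct)
      case base
      then show ?case using \<open>w \<in> X\<close> by blast
    next
      case (step y t)
      have t: "t \<in> V" "t \<notin> {u, d, v}" "(y, t) \<in> E" using step.hyps(2) by auto
      show ?case
      proof (cases "y = z")
        case True
        then have "t = w" using t zE by auto
        then show ?thesis using \<open>w \<in> X\<close> by blast
      next
        case False
        then consider "y \<in> X" | "\<exists>x\<in>X. (x, d') \<in> E" using step.IH by blast
        then show ?thesis
        proof cases
          case 1
          show ?thesis
          proof (cases "t \<in> S")
            case True
            then show ?thesis using X_step[OF 1 t(3)] by blast
          next
            case False
            then have "t = z \<or> t = d'" using t dd unfolding S_def by blast
            then show ?thesis using 1 t(3) by blast
          qed
        qed blast
      qed
    qed
    have "d' \<notin> X" "d' \<noteq> z" using XS d cc by (auto simp: S_def)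
    then show ?thesis using inv[OF reach[OF d]] by blast
  qed
  have "K33_minor E"
  proof (rule K33_minorI[OF V(3), of X u v z c c'])
    show "linked E X" unfolding X_def by (rule linked_reachable[OF V(3) wS])
    show "u \<notin> X" "v \<notin> X" "z \<notin> X" "c \<notin> X" "c' \<notin> X" using XS by (auto simp: S_def)
    show "distinct [u, v, z, c, c']" using N(2) cc sides csides V(4) by auto
    have "(u, z) \<in> E" "(v, z) \<in> E" "(w, z) \<in> E" using zE V(3) by (auto dest: symD)
    then show "{u, v} \<times> {z, c, c'} \<subseteq> E" using cc(4) by auto
    show "\<forall>y\<in>{z, c, c'}. \<exists>x\<in>X. (x, y) \<in> E"
      using adj[of c c'] adj[of c' c] cc(3) \<open>(w, z) \<in> E\<close> \<open>w \<in> X\<close> by blast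
  qed
  with noK show False ..
qed

section \<open>The induction over vertices and edges\<close>

text \<open>Genericity enters through \<open>transfer\<close> and independence only. Both range over
  \<open>V0\<close>, since the induction shrinks the graph but keeps \<open>p\<close>; edges count
  in the measure so that a single edge can be deleted.\<close>

theorem no_K33_minor_imp_no_stress:
  assumes transfer: "\<And>V E q. bigraph side V E \<Longrightarrow> V \<subseteq> V0 \<Longrightarrow> no_stress V E q \<Longrightarrow> no_stress V E p"
    and ind0: "\<And>y z. y \<in> V0 \<Longrightarrow> z \<in> V0 \<Longrightarrow> y \<noteq> z \<Longrightarrow> independent2 p y z"
    and "bigraph side V E" "V \<subseteq> V0" "\<not> K33_minor E"
  shows "no_stress V E p"
  using assms(3-)
proof (induction "card V + card E" arbitrary: V E rule: less_induct)
  case less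
  note G = less.prems(1) and noK = less.prems(3)
  note V = bigraphD[OF G] and finE = finite_edges[OF G]
  have ind: "independent2 p y z" if "y \<in> V" "z \<in> V" "y \<noteq> z" for y z
    using ind0 that less.prems(2) by blast
  have sub: "no_stress V' (E \<inter> V' \<times> V') p" if "V' \<subset> V" for V'
  proof (rule less.hyps)
    have "card V' < card V" using psubset_card_mono[OF V(1) that] .
    moreover have "card (E \<inter> V' \<times> V') \<le> card E" using finE by (intro card_mono) auto
    ultimately show "card V' + card (E \<inter> V' \<times> V') < card V + card E" by simp
    show "bigraph side V' (E \<inter> V' \<times> V')" using bigraph_restrict[OF G] that by blast
    show "\<not> K33_minor (E \<inter> V' \<times> V')" using K33_minor_mono noK by blast
  qed (use that less.prems(2) in blast)
  show ?case
  proof (cases "\<exists>x\<in>V. card (E `` {x}) \<le> 2")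
    case True
    then obtain x where x: "x \<in> V" "card (E `` {x}) \<le> 2" by blast
    show ?thesis by (rule no_stress_delete_vertex[OF G x ind sub]) (use x in auto)
  next
    case deg3: False
    show ?thesis
    proof (cases "E = {}")
      case True
      then show ?thesis unfolding no_stress_def stress_def by blast
    next
      case False
      then obtain a b where ab: "(a, b) \<in> E" by auto
      \<comment> \<open>Without one edge, removed in both orientations, the graph is stress free and
        \<open>card E0 \<le> 4 * (card V - 1)\<close>. Restoring the two pairs still leaves
        \<open>card E < 4 * card V\<close>, so the average degree is below four.\<close>
      define E0 where "E0 = E - {(a, b), (b, a)}"
      have G0: "bigraph side V E0"
        using G unfolding bigraph_def E0_def sym_def by blast
      have "(b, a) \<in> E" "a \<noteq> b" using ab V(3,4) by (auto dest: symD)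
      then have cardE: "card E = card E0 + 2"
        using ab finE card_Diff_subset[of "{(a, b), (b, a)}" E] card_mono[of E "{(a, b), (b, a)}"]
        by (auto simp: E0_def)
      have "no_stress V E0 p"
      proof (rule less.hyps)
        show "\<not> K33_minor E0" using K33_minor_mono[of E0 E] noK by (auto simp: E0_def)
      qed (use cardE G0 less.prems(2) in auto)
      moreover have "a \<in> V" "b \<in> V" using ab V(2) by auto
      moreover have "p 1 a \<noteq> 0 \<or> p 2 a \<noteq> 0"
        using ind[of a b] \<open>a \<in> V\<close> \<open>b \<in> V\<close> \<open>a \<noteq> b\<close> by (auto simp: independent2_def)
      then obtain k :: nat where "k \<in> {1, 2}" "p k a \<noteq> 0" by blast
      ultimately have "card E0 \<le> 4 * (card V - 1)" using no_stress_card_edges[OF G0] by blast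
      then have small: "card E < 4 * card V"
        using cardE \<open>a \<in> V\<close> V(1) card_gt_0_iff[of V] by auto
      have "\<exists>z\<in>V. card (E `` {z}) \<le> 3"
      proof (rule ccontr)
        assume "\<not> (\<exists>z\<in>V. card (E `` {z}) \<le> 3)"
        then have "(\<Sum>x\<in>V. 4) \<le> (\<Sum>x\<in>V. card (E `` {x}))" by (intro sum_mono) force
        then show False using sum_degrees[OF G] small by simp
      qed
      then obtain z where z: "z \<in> V" "card (E `` {z}) = 3" using deg3 by force
      then obtain u v w where N: "E `` {z} = {u, v, w}" "u \<noteq> v" "w \<noteq> u" "w \<noteq> v"
        by (auto simp: card_3_iff)
      have zE: "(z, x) \<in> E \<longleftrightarrow> x \<in> {u, v, w}" for x using N(1) by blast
      have uvV: "u \<in> V" "v \<in> V" "w \<in> V" using zE V(2) by blast+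
      have sides: "side u = side v" "side u \<noteq> side z" "side v \<noteq> side z" "side w \<noteq> side z"
        using V(4)[of z u] V(4)[of z v] V(4)[of z w] zE by auto
      show ?thesis
      proof (cases "card (E `` {u} \<inter> E `` {v}) \<le> 2")
        case True
        have "no_stress (V - {v}) (fold_edges u v E) p"
        proof (rule less.hyps)
          have "card (V - {v}) < card V" using V(1) uvV by (intro psubset_card_mono) auto
          then show "card (V - {v}) + card (fold_edges u v E) < card V + card E"
            using card_fold_edges[OF finE, of u v] by simp
          show "bigraph side (V - {v}) (fold_edges u v E)"
            by (rule bigraph_fold[OF G uvV(1) N(2) sides(1)])
          show "\<not> K33_minor (fold_edges u v E)"
            using K33_minor_unfold[OF V(3) N] sides noK by blast
        qed (use less.prems(2) in blast)
        \<comment> \<open>Folding settles only the special position with \<open>v\<close> on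
          \<open>u\<close>; \<open>transfer\<close> carries the conclusion to
          \<open>p\<close>.\<close>
        then show ?thesis
          using no_stress_unfold[OF G uvV(1,2) N(2) sides(1) True ind] transfer[OF G less.prems(2)]
            by blast
      next
        case False
        \<comment> \<open>An infinite set would have cardinality zero.\<close>
        then have fin: "finite (E `` {u} \<inter> E `` {v})" by (metis card.infinite zero_le)
        have "card (E `` {u} \<inter> E `` {v} - {z}) \<ge> 2"
          using False card_Diff_singleton_if[of "E `` {u} \<inter> E `` {v}" z] by auto
        then obtain c c' where cc: "c \<noteq> z" "c' \<noteq> z" "c \<noteq> c'" "{c, c'} \<subseteq> E `` {u} \<inter> E `` {v}"
          using card_le_Suc0_iff_eq[of "E `` {u} \<inter> E `` {v} - {z}"] fin
            by (force simp: numeral_2_eq_2)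
        obtain d d' where d: "d \<in> {c, c'}" "d' \<in> {c, c'}" "d \<noteq> d'"
          "(w, d') \<notin> (E \<inter> (V - {u, d, v}) \<times> (V - {u, d, v}))\<^sup>*"
          by (rule common_neighbours_separate[OF G noK N cc])
        have ud: "(u, d) \<in> E" "(v, d) \<in> E" "(u, d') \<in> E" using d cc(4) by auto
        \<comment> \<open>One side of the separation is the component of \<open>w\<close> with the
          path \<open>u d v\<close> attached, the other the complement of that component. The first
          lacks \<open>d'\<close> and the second lacks \<open>w\<close>, so both are proper.\<close>
        define C where "C = {y. (w, y) \<in> (E \<inter> (V - {u, d, v}) \<times> (V - {u, d, v}))\<^sup>*}"
        have dne: "side d \<noteq> side u" "side d' \<noteq> side u" using V(4) ud by blast+
        have wS: "w \<in> V - {u, d, v}" using uvV N sides dne by auto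
        have CS: "C \<subseteq> V - {u, d, v}"
        proof
          fix y assume "y \<in> C"
          then have "(w, y) \<in> (E \<inter> (V - {u, d, v}) \<times> (V - {u, d, v}))\<^sup>*" by (simp add: C_def)
          then show "y \<in> V - {u, d, v}" by (induction rule: rtrancl_induct) (use wS in auto)
        qed
        have C_step: "y \<in> C" if "x \<in> C" "(x, y) \<in> E" "y \<notin> {u, d, v}" for x y
          using that CS V(2) rtrancl_into_rtrancl[of w x "E \<inter> (V - {u, d, v}) \<times> (V - {u, d, v})" y]
          unfolding C_def by blast
        have "w \<in> C" "d' \<notin> C" "d' \<in> V" using d(4) ud V(2) by (auto simp: C_def)
        have dV: "d \<in> V" using ud V(2) by blast
        have d'ne: "d' \<notin> {u, d, v}" using d(3) dne sides by auto
        have 1: "C \<union> {u, d, v} \<subset> V" using CS uvV dV \<open>d' \<in> V\<close> \<open>d' \<notin> C\<close> d'ne by blast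
        have 2: "V - C \<subset> V" using \<open>w \<in> C\<close> uvV by blast
        show ?thesis
        proof (rule no_stress_glue[OF G _ _ N(2) _ ud(1,2) ind sub[OF 1] sub[OF 2]])
          show "V = (C \<union> {u, d, v}) \<union> (V - C)" using 1 by blast
          show "(C \<union> {u, d, v}) \<inter> (V - C) = {u, d, v}" using CS uvV dV by blast
          show "E \<subseteq> (C \<union> {u, d, v}) \<times> (C \<union> {u, d, v}) \<union> (V - C) \<times> (V - C)"
          proof (rule subrelI)
            fix x y assume xy: "(x, y) \<in> E"
            then have "(y, x) \<in> E" "x \<in> V" "y \<in> V" using V(2,3) by (auto dest: symD)
            then show "(x, y) \<in> (C \<union> {u, d, v}) \<times> (C \<union> {u, d, v}) \<union> (V - C) \<times> (V - C)"
              using C_step[of x y] C_step[of y x] xy by blast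
          qed
        qed
      qed
    qed
  qed
qed

section \<open>Generic positions\<close>

definition meval_mon :: "('v \<Rightarrow> real) \<Rightarrow> ('v \<Rightarrow>\<^sub>0 nat) \<Rightarrow> real" where
  "meval_mon a t = (\<Prod>v\<in>Poly_Mapping.keys t. a v ^ Poly_Mapping.lookup t v)"

lemma meval_mon_superset:
  assumes "finite S" "Poly_Mapping.keys t \<subseteq> S"
  shows "meval_mon a t = (\<Prod>v\<in>S. a v ^ Poly_Mapping.lookup t v)"
  unfolding meval_mon_def using assms by (intro prod.mono_neutral_left) (auto simp: in_keys_iff)

lemma meval_mon_add: "meval_mon a (s + t) = meval_mon a s * meval_mon a t"
proof -
  let ?S = "Poly_Mapping.keys s \<union> Poly_Mapping.keys t"
  have "Poly_Mapping.keys (s + t) \<subseteq> ?S" by (rule keys_add)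
  then have "meval_mon a (s + t) = (\<Prod>v\<in>?S. a v ^ Poly_Mapping.lookup (s + t) v)"
    by (intro meval_mon_superset) auto
  also have "\<dots> = meval_mon a s * meval_mon a t"
    by (simp add: meval_mon_superset[of ?S s] meval_mon_superset[of ?S t] lookup_add power_add
        prod.distrib)
  finally show ?thesis .
qed

lemma meval_rat_superset:
  assumes "finite S" "Poly_Mapping.keys p \<subseteq> S"
  shows "meval_rat p a = (\<Sum>t\<in>S. of_rat (Poly_Mapping.lookup p t) * meval_mon a t)"
  unfolding meval_rat_def meval_mon_def[symmetric]
  using assms by (intro sum.mono_neutral_left) (auto simp: in_keys_iff)

lemma meval_rat_single: "meval_rat (Poly_Mapping.single t c) a = of_rat c * meval_mon a t"
  by (subst meval_rat_superset[of "{t}"]) auto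

lemma meval_rat_zero: "meval_rat 0 a = 0"
  by (simp add: meval_rat_def)

lemma meval_rat_add: "meval_rat (p + q) a = meval_rat p a + meval_rat q a"
proof -
  let ?S = "Poly_Mapping.keys p \<union> Poly_Mapping.keys q"
  have "Poly_Mapping.keys (p + q) \<subseteq> ?S" by (rule keys_add)
  then have "meval_rat (p + q) a = (\<Sum>t\<in>?S. of_rat (Poly_Mapping.lookup (p + q) t) * meval_mon a t)"
    by (intro meval_rat_superset) auto
  also have "\<dots> = meval_rat p a + meval_rat q a"
    by (simp add: meval_rat_superset[of ?S p] meval_rat_superset[of ?S q] lookup_add of_rat_add
        distrib_right sum.distrib)
  finally show ?thesis .
qed

lemma poly_mapping_add_single_induct:
  assumes "P 0" "\<And>f a b. P f \<Longrightarrow> P (f + Poly_Mapping.single a b)"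
  shows "P (f :: 'a \<Rightarrow>\<^sub>0 'b::comm_monoid_add)"
proof (induction f rule: update_induct)
  case (update f a b)
  have "Poly_Mapping.update a b f = f + Poly_Mapping.single a b"
    using update.hyps(1)
    by (intro poly_mapping_eqI) (auto simp: lookup_update lookup_add lookup_single in_keys_iff)
  then show ?case using assms(2)[OF update.IH] by simp
qed (rule assms(1))

text \<open>By additivity in both factors it suffices to compare products of two monomials.\<close>

lemma meval_rat_mult: "meval_rat (p * q) a = meval_rat p a * meval_rat q a"
proof (induction p rule: poly_mapping_add_single_induct)
  case (2 p s c)
  have "meval_rat (Poly_Mapping.single s c * q) a =
      meval_rat (Poly_Mapping.single s c) a * meval_rat q a"
  proof (induction q rule: poly_mapping_add_single_induct)
    case (2 q t d)
    then show ?case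
      by (simp add: distrib_left meval_rat_add mult_single meval_rat_single meval_mon_add
          of_rat_mult)
  qed (simp add: meval_rat_zero)
  with 2 show ?case by (simp add: distrib_right meval_rat_add)
qed (simp add: meval_rat_zero)

lemma meval_rat_mvar: "meval_rat (mvar v) a = a v"
  by (simp add: mvar_def meval_rat_single meval_mon_def)

lemma meval_rat_one: "meval_rat 1 a = 1"
  using meval_rat_single[of 0 1 a] by (simp add: meval_mon_def)

text \<open>Needed in this form so that evaluation commutes with determinants.\<close>

lemma meval_rat_hom: "comm_ring_hom (\<lambda>p. meval_rat p a)"
  by unfold_locales (simp_all add: meval_rat_zero meval_rat_one meval_rat_add meval_rat_mult)

lemma meval_rat_sum: "meval_rat (sum f S) a = (\<Sum>s\<in>S. meval_rat (f s) a)"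
  by (induction S rule: infinite_finite_induct) (simp_all add: meval_rat_zero meval_rat_add)

section \<open>Variables occurring in a polynomial\<close>

lemma mvars_zero: "mvars 0 = {}" and mvars_mvar:
    "mvars (mvar v :: ('v, 'a::zero_neq_one) mpoly) = {v}"
  and mvars_const: "mvars (mconst c) = {}"
  by (auto simp: mvars_def mvar_def mconst_def)

lemma mvars_one: "mvars (1 :: ('v, 'a::zero_neq_one) mpoly) = {}"
  using mvars_const[of "1::'a"] by (simp add: mconst_def)

lemma mvars_add: "mvars (p + q) \<subseteq> mvars p \<union> mvars q"
  unfolding mvars_def using keys_add[of p q] by blast

lemma mvars_uminus: "mvars (- p :: ('v, 'a::ab_group_add) mpoly) = mvars p"
  by (simp add: mvars_def)

lemma mvars_mult: "mvars (p * q) \<subseteq> mvars p \<union> mvars q"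
proof
  fix v assume "v \<in> mvars (p * q)"
  then obtain t where t: "t \<in> Poly_Mapping.keys (p * q)" "v \<in> Poly_Mapping.keys t"
    by (auto simp: mvars_def)
  then obtain r s where "t = r + s" "r \<in> Poly_Mapping.keys p" "s \<in> Poly_Mapping.keys q"
    using keys_mult[of p q] by blast
  then show "v \<in> mvars p \<union> mvars q" using t(2) keys_add[of r s] unfolding mvars_def by blast
qed

lemma mvars_sum: "(\<And>s. s \<in> S \<Longrightarrow> mvars (f s) \<subseteq> W) \<Longrightarrow> mvars (sum f S) \<subseteq> W"
proof (induction S rule: infinite_finite_induct)
  case (insert x S)
  then show ?case using mvars_add[of "f x" "sum f S"] by (simp, blast)
qed (simp_all add: mvars_zero)

lemma mvars_prod:
  "(\<And>s. s \<in> S \<Longrightarrow> mvars (f s) \<subseteq> W) \<Longrightarrow> mvars (prod f S :: ('v, 'a::comm_ring_1) mpoly) \<subseteq> W"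
proof (induction S rule: infinite_finite_induct)
  case (insert x S)
  then show ?case using mvars_mult[of "f x" "prod f S"] by (simp, blast)
qed (simp_all add: mvars_one)

text \<open>Leibniz expansion: the signs are constants and bring in no variable.\<close>

lemma mvars_det:
  fixes A :: "('v, 'a::comm_ring_1) mpoly mat"
  assumes A: "A \<in> carrier_mat n n" and W: "\<And>i j. i < n \<Longrightarrow> j < n \<Longrightarrow> mvars (A $$ (i, j)) \<subseteq> W"
  shows "mvars (det A) \<subseteq> W"
proof -
  have sgn: "mvars (signof \<pi> :: ('v, 'a) mpoly) = {}" for \<pi>
    by (simp add: sign_def mvars_uminus mvars_one)
  have "mvars (signof \<pi> * (\<Prod>i = 0..<n. A $$ (i, \<pi> i))) \<subseteq> W" if "\<pi> permutes {0..<n}" for \<pi>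
  proof -
    have "mvars (\<Prod>i = 0..<n. A $$ (i, \<pi> i)) \<subseteq> W"
      using that W permutes_in_image[OF that] by (intro mvars_prod) auto
    then show ?thesis using mvars_mult[of "signof \<pi>" "\<Prod>i = 0..<n. A $$ (i, \<pi> i)"] sgn[of \<pi>]
      by (metis (no_types, lifting) Un_empty_left subset_trans)
  qed
  then show ?thesis unfolding det_def'[OF A] by (intro mvars_sum) auto
qed

text \<open>
  The Gram determinant of the equations is one integer polynomial in the coordinates, and it
  vanishes exactly at the positions that admit a nonzero solution.
\<close>

lemma gram_kernel_iff:
  fixes c :: "'k \<Rightarrow> 'u \<Rightarrow> real"
  assumes fin: "finite K" "finite U"
  shows "(\<forall>k\<in>K. (\<Sum>u\<in>U. c k u * x u) = 0) \<longleftrightarrow> (\<forall>t\<in>U. (\<Sum>u\<in>U. (\<Sum>k\<in>K. c k t * c k u) * x u) = 0)"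
proof -
  have gram: "(\<Sum>u\<in>U. (\<Sum>k\<in>K. c k t * c k u) * x u) = (\<Sum>k\<in>K. c k t * (\<Sum>u\<in>U. c k u * x u))" for t
    by (simp add: sum_distrib_left sum_distrib_right mult.assoc) (rule sum.swap)
  show ?thesis
  proof
    assume R: "\<forall>t\<in>U. (\<Sum>u\<in>U. (\<Sum>k\<in>K. c k t * c k u) * x u) = 0"
    \<comment> \<open>The quadratic form of the Gram matrix is the sum of the squares of the
      equations, which over the reals vanishes only if every equation holds.\<close>
    have "(\<Sum>k\<in>K. (\<Sum>u\<in>U. c k u * x u)\<^sup>2) = (\<Sum>k\<in>K. \<Sum>t\<in>U. x t * (c k t * (\<Sum>u\<in>U. c k u * x u)))"
      by (intro sum.cong refl) (simp add: power2_eq_square sum_distrib_right mult_ac)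
    also have "\<dots> = (\<Sum>t\<in>U. x t * (\<Sum>k\<in>K. c k t * (\<Sum>u\<in>U. c k u * x u)))"
      by (subst sum.swap) (simp add: sum_distrib_left)
    also have "\<dots> = 0" using R unfolding gram by (intro sum.neutral) auto
    finally show "\<forall>k\<in>K. (\<Sum>u\<in>U. c k u * x u) = 0"
      using fin by (simp add: sum_nonneg_eq_0_iff)
  qed (simp add: gram)
qed

text \<open>The unknowns are listed because matrices are indexed by numbers. The general entry type
  covers both the polynomial matrix and its real values.\<close>

definition gram_matrix :: "('k \<Rightarrow> 'u \<Rightarrow> 'a::comm_semiring_0) \<Rightarrow> 'k set \<Rightarrow> 'u list \<Rightarrow> 'a mat" where
  "gram_matrix c K us = mat (length us) (length us) (\<lambda>(i, j). \<Sum>k\<in>K. c k (us ! i) * c k (us ! j))"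

lemma gram_det_iff:
  fixes c :: "'k \<Rightarrow> 'u \<Rightarrow> real"
  assumes fin: "finite K" and us: "distinct us"
  shows "det (gram_matrix c K us) = 0 \<longleftrightarrow>
    (\<exists>x. (\<forall>k\<in>K. (\<Sum>u\<in>set us. c k u * x u) = 0) \<and> (\<exists>u\<in>set us. x u \<noteq> 0))"
proof -
  let ?n = "length us" and ?M = "gram_matrix c K us"
  have M: "?M \<in> carrier_mat ?n ?n" by (simp add: gram_matrix_def)
  have sum_us: "(\<Sum>u\<in>set us. g u) = (\<Sum>j = 0..<?n. g (us ! j))" for g :: "'u \<Rightarrow> real"
    using us by (simp add: sum.distinct_set_conv_list sum_list_sum_nth)
  have mult: "(?M *\<^sub>v vec ?n (\<lambda>j. x (us ! j))) $ i =
      (\<Sum>u\<in>set us. (\<Sum>k\<in>K. c k (us ! i) * c k u) * x u)"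
    if "i < ?n" for i x
    using that unfolding sum_us by (simp add: gram_matrix_def scalar_prod_def)
  have ker: "?M *\<^sub>v vec ?n (\<lambda>j. x (us ! j)) = 0\<^sub>v ?n \<longleftrightarrow> (\<forall>k\<in>K. (\<Sum>u\<in>set us. c k u * x u) = 0)" for x
  proof -
    have "?M *\<^sub>v vec ?n (\<lambda>j. x (us ! j)) = 0\<^sub>v ?n \<longleftrightarrow>
        (\<forall>i<?n. (?M *\<^sub>v vec ?n (\<lambda>j. x (us ! j))) $ i = 0)"
      using M by (auto simp: vec_eq_iff simp del: index_mult_mat_vec)
    also have "\<dots> \<longleftrightarrow> (\<forall>i<?n. (\<Sum>u\<in>set us. (\<Sum>k\<in>K. c k (us ! i) * c k u) * x u) = 0)"
      by (simp add: mult del: index_mult_mat_vec)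
    also have "\<dots> \<longleftrightarrow> (\<forall>t\<in>set us. (\<Sum>u\<in>set us. (\<Sum>k\<in>K. c k t * c k u) * x u) = 0)"
      by (simp add: all_set_conv_all_nth)
    finally show ?thesis using gram_kernel_iff[OF fin, of "set us" c x] by simp
  qed
  \<comment> \<open>Coordinate vectors become functions of the unknowns; distinctness of the list
    makes the index of an unknown unique.\<close>
  have repr: "\<exists>x. v = vec ?n (\<lambda>j. x (us ! j))" if v: "v \<in> carrier_vec ?n" for v :: "real vec"
  proof (intro exI)
    let ?x = "\<lambda>u. v $ (THE j. j < ?n \<and> us ! j = u)"
    have "(THE i. i < ?n \<and> us ! i = us ! j) = j" if "j < ?n" for j
      using that us by (auto simp: nth_eq_iff_index_eq)
    then show "v = vec ?n (\<lambda>j. ?x (us ! j))" using v by (intro eq_vecI) auto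
  qed
  have zero: "vec ?n (\<lambda>j. x (us ! j)) \<noteq> 0\<^sub>v ?n \<longleftrightarrow> (\<exists>u\<in>set us. x u \<noteq> 0)" for x :: "'u \<Rightarrow> real"
    using nth_mem[of _ us] by (fastforce simp: vec_eq_iff in_set_conv_nth)
  have "det ?M = 0 \<longleftrightarrow> (\<exists>v. v \<in> carrier_vec ?n \<and> v \<noteq> 0\<^sub>v ?n \<and> ?M *\<^sub>v v = 0\<^sub>v ?n)"
    by (rule det_0_iff_vec_prod_zero_field[OF M])
  also have "\<dots> \<longleftrightarrow> (\<exists>x. vec ?n (\<lambda>j. x (us ! j)) \<noteq> 0\<^sub>v ?n \<and> ?M *\<^sub>v vec ?n (\<lambda>j. x (us ! j)) = 0\<^sub>v ?n)"
  proof
    assume "\<exists>v. v \<in> carrier_vec ?n \<and> v \<noteq> 0\<^sub>v ?n \<and> ?M *\<^sub>v v = 0\<^sub>v ?n"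
    then obtain v where v: "v \<in> carrier_vec ?n" "v \<noteq> 0\<^sub>v ?n \<and> ?M *\<^sub>v v = 0\<^sub>v ?n" by blast
    obtain x where "v = vec ?n (\<lambda>j. x (us ! j))" using repr[OF v(1)] ..
    with v(2) show "\<exists>x. vec ?n (\<lambda>j. x (us ! j)) \<noteq> 0\<^sub>v ?n \<and> ?M *\<^sub>v vec ?n (\<lambda>j. x (us ! j)) = 0\<^sub>v ?n"
      by (intro exI[of _ x]) simp
  qed (use vec_carrier in blast)
  finally show ?thesis unfolding ker zero by (simp only: conj_commute)
qed

text \<open>The Gram determinant is a rational polynomial in variables from \<open>W\<close>. A
  nontrivial kernel at \<open>a\<close> makes it vanish there, hence identically by independence,
  hence at \<open>b\<close>, where the kernel is trivial.\<close>

lemma alg_independent_imp_trivial_kernel: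
  fixes C :: "'k \<Rightarrow> 'u \<Rightarrow> ('x, rat) mpoly"
  assumes alg: "alg_independent_rat W a" and fin: "finite K" "finite U"
    and vars: "\<And>k u. k \<in> K \<Longrightarrow> u \<in> U \<Longrightarrow> mvars (C k u) \<subseteq> W"
    and b: "\<And>x u. (\<And>k. k \<in> K \<Longrightarrow> (\<Sum>u\<in>U. meval_rat (C k u) b * x u) = 0) \<Longrightarrow> u \<in> U \<Longrightarrow> x u = 0"
    and x: "\<And>k. k \<in> K \<Longrightarrow> (\<Sum>u\<in>U. meval_rat (C k u) a * x u) = 0" and u: "u \<in> U"
  shows "x u = (0::real)"
proof (rule ccontr)
  assume "x u \<noteq> 0"
  obtain us where us: "set us = U" "distinct us" using finite_distinct_list[OF fin(2)] by blast
  let ?G = "gram_matrix C K us"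
  have G: "?G \<in> carrier_mat (length us) (length us)" by (simp add: gram_matrix_def)
  have ev: "meval_rat (det ?G) v = det (gram_matrix (\<lambda>k u. meval_rat (C k u) v) K us)" for v
  proof -
    interpret comm_ring_hom "\<lambda>p. meval_rat p v" by (rule meval_rat_hom)
    have "map_mat (\<lambda>p. meval_rat p v) ?G = gram_matrix (\<lambda>k u. meval_rat (C k u) v) K us"
      by (intro eq_matI) (auto simp: gram_matrix_def meval_rat_sum meval_rat_mult)
    then show ?thesis using hom_det[of ?G] by simp
  qed
  have "meval_rat (det ?G) a = 0"
    unfolding ev gram_det_iff[OF fin(1) us(2)] using x u us(1) \<open>x u \<noteq> 0\<close> by auto
  moreover have "mvars (det ?G) \<subseteq> W"
  proof (rule mvars_det[OF G])
    fix i j assume ij: "i < length us" "j < length us"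
    have "mvars (C k (us ! i) * C k (us ! j)) \<subseteq> W" if "k \<in> K" for k
      using mvars_mult[of "C k (us ! i)" "C k (us ! j)"] vars[OF that] ij us(1) nth_mem by blast
    then show "mvars (?G $$ (i, j)) \<subseteq> W" using ij by (auto simp: gram_matrix_def intro!: mvars_sum)
  qed
  ultimately have "det ?G = 0" using alg unfolding alg_independent_rat_def by blast
  then have "det (gram_matrix (\<lambda>k u. meval_rat (C k u) b) K us) = 0" using ev[of b]
    by (simp add: meval_rat_zero)
  then show False unfolding gram_det_iff[OF fin(1) us(2)] using b us(1) by blast
qed

section \<open>Balanced shifting\<close>

lemma carrier_poly_ring_iff: "p \<in> carrier (poly_ring n m) \<longleftrightarrow> mvars p \<subseteq> bip_verts n m"
  by (simp add: poly_ring_def)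

lemma poly_ring_simps [simp]:
  "x \<otimes>\<^bsub>poly_ring n m\<^esub> y = x * y" "x \<oplus>\<^bsub>poly_ring n m\<^esub> y = x + y"
  "\<one>\<^bsub>poly_ring n m\<^esub> = 1" "\<zero>\<^bsub>poly_ring n m\<^esub> = 0"
  by (simp_all add: poly_ring_def)

lemma poly_ring_closed:
  "p \<in> carrier (poly_ring n m) \<Longrightarrow> q \<in> carrier (poly_ring n m) \<Longrightarrow> p + q \<in> carrier (poly_ring n m)"
  "p \<in> carrier (poly_ring n m) \<Longrightarrow> q \<in> carrier (poly_ring n m) \<Longrightarrow> p * q \<in> carrier (poly_ring n m)"
  "0 \<in> carrier (poly_ring n m)" "1 \<in> carrier (poly_ring n m)" "mconst c \<in> carrier (poly_ring n m)"
  "v \<in> bip_verts n m \<Longrightarrow> mvar v \<in> carrier (poly_ring n m)"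
  "(\<And>x. x \<in> S \<Longrightarrow> f x \<in> carrier (poly_ring n m)) \<Longrightarrow> sum f S \<in> carrier (poly_ring n m)"
  using mvars_add[of p q] mvars_mult[of p q]
  by (auto simp: carrier_poly_ring_iff mvars_zero mvars_one mvars_const mvars_mvar mvars_sum)

lemma cring_poly_ring: "cring (poly_ring n m)"
proof (rule cringI)
  show "abelian_group (poly_ring n m)"
  proof (rule abelian_groupI)
    fix x assume "x \<in> carrier (poly_ring n m)"
    then have "- x \<in> carrier (poly_ring n m)" by (simp add: carrier_poly_ring_iff mvars_uminus)
    then show "\<exists>y\<in>carrier (poly_ring n m). y \<oplus>\<^bsub>poly_ring n m\<^esub> x = \<zero>\<^bsub>poly_ring n m\<^esub>"
      by (intro bexI[of _ "- x"]) auto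
  qed (auto simp: poly_ring_closed algebra_simps)
  show "comm_monoid (poly_ring n m)"
    by (rule comm_monoidI) (auto simp: poly_ring_closed algebra_simps)
qed (auto simp: algebra_simps)

lemma graph_ideal_gens_subset: "graph_ideal_gens n m E \<subseteq> carrier (poly_ring n m)"
  unfolding graph_ideal_gens_def
  by (auto simp: bip_verts_def intro!: poly_ring_closed)

lemma ideal_graph_ideal: "ideal (graph_ideal n m E) (poly_ring n m)"
proof -
  interpret cring "poly_ring n m" by (rule cring_poly_ring)
  show ?thesis unfolding graph_ideal_def by (rule genideal_ideal[OF graph_ideal_gens_subset])
qed

lemma residue_class_hom: "residue_class n m E \<in> Ring.ring_hom (poly_ring n m) (graph_ring n m E)"
  using ideal.rcos_ring_hom[OF ideal_graph_ideal, of n m E]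
  unfolding graph_ring_def residue_class_def[abs_def] by simp

lemma ring_graph_ring: "ring (graph_ring n m E)"
  unfolding graph_ring_def by (rule ideal.quotient_is_ring[OF ideal_graph_ideal])

lemma residue_class_finsum:
  assumes "finite S" "\<And>k. k \<in> S \<Longrightarrow> f k \<in> carrier (poly_ring n m)"
  shows "(\<Oplus>\<^bsub>graph_ring n m E\<^esub>k\<in>S. residue_class n m E (f k)) = residue_class n m E (\<Sum>k\<in>S. f k)"
  using assms
proof (induction S rule: finite_induct)
  case empty
  interpret Q: ring "graph_ring n m E" by (rule ring_graph_ring)
  have "residue_class n m E \<zero>\<^bsub>poly_ring n m\<^esub> = \<zero>\<^bsub>graph_ring n m E\<^esub>"
    using ring_hom_zero[OF residue_class_hom] cring_poly_ring ring_graph_ring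
      by (blast dest: cring.axioms(1))
  then show ?case by simp
next
  case (insert k S)
  interpret Q: ring "graph_ring n m E" by (rule ring_graph_ring)
  have closed: "residue_class n m E (f l) \<in> carrier (graph_ring n m E)" if "l \<in> insert k S" for l
    using ring_hom_closed[OF residue_class_hom] insert.prems that by blast
  have "residue_class n m E (f k + sum f S) =
      residue_class n m E (f k) \<oplus>\<^bsub>graph_ring n m E\<^esub> residue_class n m E (sum f S)"
    using ring_hom_add[OF residue_class_hom, of "f k" n m "sum f S" E] insert.prems
      poly_ring_closed(7)[of S f n m] by simp
  then show ?case using insert closed by (simp add: Pi_def)
qed

lemma residue_class_cong_ideal:
  assumes "p \<in> carrier (poly_ring n m)" "d \<in> graph_ideal n m E"
  shows "residue_class n m E (p + d) = residue_class n m E p"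
proof -
  interpret I: ideal "graph_ideal n m E" "poly_ring n m" by (rule ideal_graph_ideal)
  interpret Q: ring "graph_ring n m E" by (rule ring_graph_ring)
  have d: "d \<in> carrier (poly_ring n m)" using assms(2) I.a_subset by blast
  have "residue_class n m E d = graph_ideal n m E"
    unfolding residue_class_def by (rule I.a_rcos_const[OF assms(2)])
  also have "\<dots> = \<zero>\<^bsub>graph_ring n m E\<^esub>" by (simp add: graph_ring_def FactRing_def)
  finally show ?thesis
    using ring_hom_add[OF residue_class_hom assms(1) d, of E] ring_hom_closed[OF residue_class_hom
        assms(1), of E]
    by simp
qed

section \<open>Forms of degree (1,1)\<close>

text \<open>The general form of degree \<open>(1, 1)\<close>, with coefficient matrix
  \<open>F\<close>; a product of two linear forms has a matrix of rank at most one.\<close>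

definition cross_poly :: "nat \<Rightarrow> nat \<Rightarrow> (nat \<Rightarrow> nat \<Rightarrow> real) \<Rightarrow> (nat + nat, real) mpoly" where
  "cross_poly n m F = (\<Sum>s\<in>{1..n}. \<Sum>t\<in>{1..m}. mconst (F s t) * (mvar (Inl s) * mvar (Inr t)))"

lemma mconst_add: "mconst (x + y) = mconst x + mconst (y::'a::monoid_add)"
  by (simp add: mconst_def single_add)

lemma mconst_mult: "mconst (x * y) = mconst x * mconst (y::'a::semiring_0)"
  by (simp add: mconst_def mult_single)

lemma mconst_zero: "mconst 0 = 0"
  by (simp add: mconst_def)

lemma cross_poly_add: "cross_poly n m (\<lambda>s t. F s t + G s t) = cross_poly n m F + cross_poly n m G"
  by (simp add: cross_poly_def mconst_add distrib_right sum.distrib)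

lemma cross_poly_scale: "mconst c * cross_poly n m F = cross_poly n m (\<lambda>s t. c * F s t)"
  by (simp add: cross_poly_def mconst_mult sum_distrib_left mult.assoc)

lemma cross_poly_sum: "(\<Sum>k\<in>S. cross_poly n m (F k)) = cross_poly n m (\<lambda>s t. \<Sum>k\<in>S. F k s t)"
proof (induction S rule: infinite_finite_induct)
  case (insert k S)
  then show ?case by (simp add: cross_poly_add)
qed (simp_all add: cross_poly_def mconst_zero)

lemma theta_mult: "theta_A n a i * theta_B m b j = cross_poly n m (\<lambda>s t. a i s * b j t)"
  unfolding theta_A_def theta_B_def cross_poly_def sum_product
  by (intro sum.cong refl) (simp add: mconst_mult mult_ac)

lemma cross_poly_closed: "cross_poly n m F \<in> carrier (poly_ring n m)"
  unfolding cross_poly_def by (intro poly_ring_closed) (auto simp: bip_verts_def)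

text \<open>Terms at non-edges are multiples of generators, and terms at edges have coefficient
  zero.\<close>

lemma cross_poly_in_ideal:
  assumes "\<And>s t. (s, t) \<in> E \<Longrightarrow> F s t = 0"
  shows "cross_poly n m F \<in> graph_ideal n m E"
proof -
  interpret R: cring "poly_ring n m" by (rule cring_poly_ring)
  interpret I: ideal "graph_ideal n m E" "poly_ring n m" by (rule ideal_graph_ideal)
  have zero: "0 \<in> graph_ideal n m E" using I.zero_closed by simp
  have add: "x + y \<in> graph_ideal n m E" if "x \<in> graph_ideal n m E" "y \<in> graph_ideal n m E" for x y
    using I.a_closed[OF that] by simp
  have sum: "sum f S \<in> graph_ideal n m E" if "\<And>x. x \<in> S \<Longrightarrow> f x \<in> graph_ideal n m E"
    for f :: "nat \<Rightarrow> (nat + nat, real) mpoly" and S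
    using that by (induction S rule: infinite_finite_induct) (auto intro: zero add)
  have "mconst (F s t) * (mvar (Inl s) * mvar (Inr t)) \<in> graph_ideal n m E"
    if st: "s \<in> {1..n}" "t \<in> {1..m}" for s t
  proof (cases "(s, t) \<in> E")
    case True
    then show ?thesis using assms zero by (simp add: mconst_zero)
  next
    case False
    then have "mvar (Inl s) * mvar (Inr t) \<in> graph_ideal_gens n m E"
      unfolding graph_ideal_gens_def using st by blast
    then have "mvar (Inl s) * mvar (Inr t) \<in> graph_ideal n m E"
      unfolding graph_ideal_def using R.genideal_self[OF graph_ideal_gens_subset] by blast
    then show ?thesis using I.I_l_closed[of _ "mconst (F s t)"] poly_ring_closed(5) by simp
  qed
  then show ?thesis unfolding cross_poly_def by (intro sum) auto
qed

text \<open>Modulo the graph ideal only the coefficients on \<open>E\<close> matter, so a linear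
  relation between them lifts to the quotient ring.\<close>

lemma theta_prod_in_span:
  assumes "finite K"
    and y: "\<And>s t. (s, t) \<in> E \<Longrightarrow> a i s * b j t = (\<Sum>k\<in>K. y k * (a (fst k) s * b (snd k) t))"
  shows "theta_prod n m E a b (i, j) \<in> graph_ring_span n m E (theta_prod n m E a b) K"
proof -
  let ?G = "\<lambda>s t. \<Sum>k\<in>K. y k * (a (fst k) s * b (snd k) t)"
  have closed: "mconst c * cross_poly n m F \<in> carrier (poly_ring n m)" for c F
    by (intro poly_ring_closed cross_poly_closed)
  have term_eq: "residue_class n m E (mconst (y k)) \<otimes>\<^bsub>graph_ring n m E\<^esub> theta_prod n m E a b k =
      residue_class n m E (mconst (y k) * cross_poly n m (\<lambda>s t. a (fst k) s * b (snd k) t))" for k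
    unfolding theta_prod_def theta_mult
    using ring_hom_mult[OF residue_class_hom poly_ring_closed(5) cross_poly_closed] by simp
  have "(\<Oplus>\<^bsub>graph_ring n m E\<^esub>k\<in>K. residue_class n m E (mconst (y k)) \<otimes>\<^bsub>graph_ring n m E\<^esub> theta_prod n m E a b k) =
      residue_class n m E (\<Sum>k\<in>K. mconst (y k) * cross_poly n m (\<lambda>s t. a (fst k) s * b (snd k) t))"
    unfolding term_eq using assms(1) closed by (intro residue_class_finsum) auto
  also have "(\<Sum>k\<in>K. mconst (y k) * cross_poly n m (\<lambda>s t. a (fst k) s * b (snd k) t)) =
      cross_poly n m ?G"
    unfolding cross_poly_scale cross_poly_sum ..
  also have "residue_class n m E (cross_poly n m ?G) =
      residue_class n m E (cross_poly n m ?G + cross_poly n m (\<lambda>s t. a i s * b j t - ?G s t))"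
    by (rule residue_class_cong_ideal[symmetric, OF cross_poly_closed]) (rule cross_poly_in_ideal,
        simp add: y)
  also have "\<dots> = theta_prod n m E a b (i, j)"
    unfolding theta_prod_def theta_mult cross_poly_add[symmetric] by simp
  finally show ?thesis unfolding graph_ring_span_def by blast
qed

section \<open>Lexicographic order and copies of K33\<close>

text \<open>A pair that meets the initial segment has its smaller element there, while
  \<open>i\<close> and \<open>j'\<close> both lie beyond it. This holds for every pair beyond the
  segment, not only for the first one.\<close>

lemma lex_less_admissible:
  assumes adm: "admissible n m k l r" and ij: "k < i" "i \<le> n" "l < j" "j \<le> m"
    and pq: "1 \<le> p" "p \<le> n" "1 \<le> q" "q \<le> m" and low: "p \<le> k \<or> q \<le> l"
  shows "lex_less r (pair_set (p, q)) (pair_set (i, j))"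
proof -
  have tot: "total_on (bip_verts n m) r"
    using adm by (auto simp: admissible_def bip_order_def strict_linear_order_on_def)
  have init: "(u, w) \<in> r"
    if "u \<in> bip_verts n m" "u \<in> bip_verts k l" "w \<in> bip_verts n m" "w \<notin> bip_verts k l" for u w
  proof -
    have "u \<noteq> w" using that by auto
    then have "(u, w) \<in> r \<or> (w, u) \<in> r" using tot that unfolding total_on_def by simp
    moreover have "(w, u) \<notin> r" using adm that unfolding admissible_def by blast
    ultimately show ?thesis by simp
  qed
  have V: "Inl p \<in> bip_verts n m" "Inr q \<in> bip_verts n m"
      "Inl i \<in> bip_verts n m" "Inr j \<in> bip_verts n m"
    and K: "Inl i \<notin> bip_verts k l" "Inr j \<notin> bip_verts k l"
      "Inl p \<in> bip_verts k l \<longleftrightarrow> p \<le> k" "Inr q \<in> bip_verts k l \<longleftrightarrow> q \<le> l"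
    using pq ij by (auto simp: bip_verts_def)
  have A: "(Inl p, Inl i) \<in> r" "(Inl p, Inr j) \<in> r" if "p \<le> k"
    using init V K that by blast+
  have B: "(Inr q, Inl i) \<in> r" "(Inr q, Inr j) \<in> r" if "q \<le> l"
    using init V K that by blast+
  have x: ?thesis if "p \<le> k" "(Inl p, Inr q) \<in> r"
    using A that ij unfolding lex_less_def pair_set_def by (intro bexI[of _ "Inl p"]) auto
  have y: ?thesis if "q \<le> l" "(Inr q, Inl p) \<in> r"
    using B that ij unfolding lex_less_def pair_set_def by (intro bexI[of _ "Inr q"]) auto
  consider "p \<le> k" "q \<le> l" | "p \<le> k" "\<not> q \<le> l" | "\<not> p \<le> k" "q \<le> l" using low by blast
  then show ?thesis
  proof cases
    case 1
    have "(Inl p, Inr q) \<in> r \<or> (Inr q, Inl p) \<in> r" using tot V unfolding total_on_def by blast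
    then show ?thesis using x y 1 by blast
  next
    case 2
    then show ?thesis using x init V K by blast
  next
    case 3
    then show ?thesis using y init V K by blast
  qed
qed

text \<open>The copy may exchange the classes, but each class lands in one side. Three distinct
  positive indices include one that is at least \<open>3\<close>; such a vertex from each class
  gives the edge.\<close>

lemma K33_copy_high_edge:
  assumes copy: "subgraph_copy (complete_bipartite 3 3) (bip_graph n m S)"
  obtains i j where "(i, j) \<in> S" "3 \<le> i" "3 \<le> j"
proof -
  let ?W = "bip_verts 3 3"
  obtain f where inj: "inj_on f ?W" and V: "f ` ?W \<subseteq> bip_verts n m"
    and E: "\<forall>e\<in>pair_set ` ({1..3} \<times> {1..3}). f ` e \<in> pair_set ` S"
    using copy unfolding subgraph_copy_def complete_bipartite_def bip_graph_def fst_conv snd_conv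
    by (elim exE conjE)
  have edge: "\<exists>i j. (i, j) \<in> S \<and> {f (Inl x), f (Inr y)} = {Inl i, Inr j}"
    if "x \<in> {1..3}" "y \<in> {1..3}" for x y
  proof -
    have "f ` pair_set (x, y) \<in> pair_set ` S" using E that by blast
    then show ?thesis by (force simp: pair_set_def)
  qed
  have three: "\<exists>x\<in>{1..3}. 3 \<le> g x" if "inj_on g {1..3}" "\<forall>x\<in>{1..3}. 1 \<le> g x" for g :: "nat \<Rightarrow> nat"
  proof (rule ccontr)
    assume "\<not> (\<exists>x\<in>{1..3}. 3 \<le> g x)"
    then have "g ` {1..3} \<subseteq> {1, 2}" using that(2) by force
    then have "card (g ` {1..3}) \<le> card {1, 2::nat}" by (intro card_mono) auto
    then show False using card_image[OF that(1)] by simp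
  qed
  \<comment> \<open>It is enough to look at the image of \<open>Inl 1\<close>, since all of the
    other class is adjacent to it.\<close>
  define swap where "swap \<longleftrightarrow> \<not> isl (f (Inl 1))"
  have R: "isl (f (Inr y)) \<longleftrightarrow> swap" if "y \<in> {1..3}" for y
    using edge[of 1 y] that by (auto simp: swap_def doubleton_eq_iff)
  have L: "isl (f (Inl x)) \<longleftrightarrow> \<not> swap" if "x \<in> {1..3}" for x
    using edge[of x 1] R[of 1] that by (auto simp: doubleton_eq_iff)
  have W: "Inl x \<in> ?W" "Inr x \<in> ?W" if "x \<in> {1..3}" for x using that by (auto simp: bip_verts_def)
  define gL where "gL x = (if swap then projr (f (Inl x)) else projl (f (Inl x)))" for x
  define gR where "gR x = (if swap then projl (f (Inr x)) else projr (f (Inr x)))" for x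
  have fL: "f (Inl x) = (if swap then Inr (gL x) else Inl (gL x))" if "x \<in> {1..3}" for x
    using L[OF that] by (auto simp: gL_def sum.collapse)
  have fR: "f (Inr x) = (if swap then Inl (gR x) else Inr (gR x))" if "x \<in> {1..3}" for x
    using R[OF that] by (auto simp: gR_def sum.collapse)
  have "inj_on gL {1..3}"
  proof (rule inj_onI)
    fix x y assume "x \<in> {1..3}" "y \<in> {1..3}" "gL x = gL y"
    then have "f (Inl x) = f (Inl y)" using fL by simp
    then show "x = y" using inj_onD[OF inj] W \<open>x \<in> {1..3}\<close> \<open>y \<in> {1..3}\<close> by blast
  qed
  moreover have "inj_on gR {1..3}"
  proof (rule inj_onI)
    fix x y assume "x \<in> {1..3}" "y \<in> {1..3}" "gR x = gR y"
    then have "f (Inr x) = f (Inr y)" using fR by simp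
    then show "x = y" using inj_onD[OF inj] W \<open>x \<in> {1..3}\<close> \<open>y \<in> {1..3}\<close> by blast
  qed
  moreover have "1 \<le> gL x \<and> 1 \<le> gR x" if x: "x \<in> {1..3}" for x
  proof -
    have "f (Inl x) \<in> bip_verts n m" "f (Inr x) \<in> bip_verts n m" using V W[OF x] by blast+
    then show ?thesis using fL[OF x] fR[OF x] by (cases swap) (auto simp: bip_verts_def)
  qed
  ultimately obtain x y where xy: "x \<in> {1..3}" "3 \<le> gL x" "y \<in> {1..3}" "3 \<le> gR y" using three
    by meson
  then have "(if swap then (gR y, gL x) else (gL x, gR y)) \<in> S"
    using edge[of x y] fL[of x] fR[of y] by (auto simp: doubleton_eq_iff)
  then show thesis using that xy by (cases swap) auto
qed


section \<open>Generic coordinates\<close>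

text \<open>Row \<open>k\<close> of the two \<theta> matrices supplies the \<open>k\<close>-th
  coordinate of every vertex. The entry type is open because the same pattern produces variable
  names in \<open>coord_var\<close>.\<close>

definition coord :: "(nat \<Rightarrow> nat \<Rightarrow> 'a) \<Rightarrow> (nat \<Rightarrow> nat \<Rightarrow> 'a) \<Rightarrow> nat \<Rightarrow> nat + nat \<Rightarrow> 'a" where
  "coord a b k = case_sum (a k) (b k)"

definition coord_var :: "nat \<Rightarrow> nat + nat \<Rightarrow> (nat \<times> nat) + (nat \<times> nat)" where
  "coord_var = coord (\<lambda>k s. Inl (k, s)) (\<lambda>k t. Inr (k, t))"

definition coord_eval :: "(nat \<Rightarrow> nat + nat \<Rightarrow> real) \<Rightarrow> (nat \<times> nat) + (nat \<times> nat) \<Rightarrow> real" where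
  "coord_eval q = case_sum (\<lambda>(k, s). q k (Inl s)) (\<lambda>(k, t). q k (Inr t))"

definition generic_vars :: "nat \<Rightarrow> nat \<Rightarrow> ((nat \<times> nat) + (nat \<times> nat)) set" where
  "generic_vars n m = Inl ` ({1..n} \<times> {1..n}) \<union> Inr ` ({1..m} \<times> {1..m})"

lemma coord_eval_var: "coord_eval q (coord_var k v) = q k v"
  by (cases v) (simp_all add: coord_eval_def coord_var_def coord_def)

lemma generic_iff: "generic n m a b \<longleftrightarrow>
    alg_independent_rat (generic_vars n m) (coord_eval (coord a b))"
proof -
  have "case_sum (\<lambda>(i, j). a i j) (\<lambda>(s, t). b s t) = coord_eval (coord a b)"
    by (auto simp: coord_eval_def coord_def fun_eq_iff split: sum.split)
  then show ?thesis by (simp add: generic_def generic_vars_def)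
qed

lemma coord_var_generic:
  "k \<in> {1, 2} \<Longrightarrow> v \<in> bip_verts n m \<Longrightarrow> 2 \<le> n \<Longrightarrow> 2 \<le> m \<Longrightarrow> coord_var k v \<in> generic_vars n m"
  by (auto simp: coord_var_def coord_def generic_vars_def bip_verts_def)

text \<open>The determinant of two positions is a nonzero polynomial in entries of the first two
  rows of the \<theta> matrices.\<close>

lemma generic_independent2:
  assumes gen: "generic n m a b" and nm: "2 \<le> n" "2 \<le> m"
    and yz: "y \<in> bip_verts n m" "z \<in> bip_verts n m" "y \<noteq> z"
  shows "independent2 (coord a b) y z"
proof -
  let ?x = "\<lambda>k v. mvar (coord_var k v) :: (_, rat) mpoly"
  define P where "P = ?x 1 y * ?x 2 z + - (?x 2 y * ?x 1 z)"
  have ev: "meval_rat P (coord_eval q) = q 1 y * q 2 z - q 2 y * q 1 z" for q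
  proof -
    interpret comm_ring_hom "\<lambda>p. meval_rat p (coord_eval q)" by (rule meval_rat_hom)
    show ?thesis
      unfolding P_def hom_add hom_uminus hom_mult meval_rat_mvar coord_eval_var by simp
  qed
  have "mvars P \<subseteq> generic_vars n m"
  proof -
    have "mvars (?x k v) \<subseteq> generic_vars n m" if "k \<in> {1, 2}" "v \<in> {y, z}" for k v
      using coord_var_generic[OF that(1) _ nm, of v] that(2) yz by (auto simp: mvars_mvar)
    then have 1: "mvars (?x k v * ?x l w) \<subseteq> generic_vars n m"
      if "k \<in> {1, 2}" "l \<in> {1, 2}" "v \<in> {y, z}" "w \<in> {y, z}" for k l v w
      using that by (intro order.trans[OF mvars_mult]) auto
    have "mvars P \<subseteq> mvars (?x 1 y * ?x 2 z) \<union> mvars (?x 2 y * ?x 1 z)"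
      unfolding P_def by (rule order.trans[OF mvars_add]) (simp add: mvars_uminus)
    also have "\<dots> \<subseteq> generic_vars n m" by (intro Un_least 1) auto
    finally show ?thesis .
  qed
  moreover have "P \<noteq> 0"
  proof
    assume "P = 0"
    \<comment> \<open>Placing \<open>y\<close> and \<open>z\<close> at the two unit vectors gives
      determinant one.\<close>
    then have "meval_rat P (coord_eval (\<lambda>k v. if k = 1 \<and> v = y \<or> k = 2 \<and> v = z then 1 else 0)) = 0"
      by (simp add: meval_rat_zero)
    then show False unfolding ev using yz(3) by simp
  qed
  ultimately have "meval_rat P (coord_eval (coord a b)) \<noteq> 0"
    using gen unfolding generic_iff alg_independent_rat_def by blast
  then show ?thesis unfolding ev independent2_def .
qed

text \<open>This supplies \<open>transfer\<close>: the rigidity matrix has polynomial entries, so a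
  trivial kernel at one position forces a trivial kernel at the generic one.\<close>

lemma generic_no_stress:
  assumes gen: "generic n m a b" and nm: "2 \<le> n" "2 \<le> m"
    and G: "bigraph side V E" "V \<subseteq> bip_verts n m" and q: "no_stress V E q"
  shows "no_stress V E (coord a b)"
proof -
  note V = bigraphD[OF G(1)]
  let ?P = "forward_edges side E"
  define C where "C = edge_coeff (\<lambda>k v. mvar (coord_var k v) :: (_, rat) mpoly)"
  have ev: "meval_rat (C kv e) (coord_eval p) = edge_coeff p kv e" for kv e p
    by (simp add: C_def edge_coeff_def meval_rat_add meval_rat_zero meval_rat_mvar coord_eval_var)
  have fin: "finite ({1, 2::nat} \<times> V)" "finite ?P"
    using V(1) finite_edges[OF G(1)] by (auto simp: forward_edges_def)
  have vars: "mvars (C kv e) \<subseteq> generic_vars n m" if "kv \<in> {1, 2} \<times> V" "e \<in> ?P" for kv e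
  proof -
    have "fst e \<in> bip_verts n m" "snd e \<in> bip_verts n m" using that(2) V(2) G(2)
      by (cases e; auto simp: forward_edges_def)+
    moreover have "fst kv \<in> {1, 2}" using that(1) by auto
    ultimately have "mvars (mvar (coord_var (fst kv) (fst e)) :: (_, rat) mpoly) \<subseteq> generic_vars n m"
        "mvars (mvar (coord_var (fst kv) (snd e)) :: (_, rat) mpoly) \<subseteq> generic_vars n m"
      using coord_var_generic[OF _ _ nm] by (auto simp: mvars_mvar)
    then show ?thesis unfolding C_def edge_coeff_def
      by (intro order.trans[OF mvars_add]) (auto simp: mvars_zero)
  qed
  show ?thesis unfolding no_stress_iff[OF G(1)]
  proof (intro allI impI ballI)
    fix x e
    assume x: "\<forall>kv\<in>{1, 2} \<times> V. (\<Sum>e\<in>?P. edge_coeff (coord a b) kv e * x e) = 0" and e: "e \<in> ?P"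
    show "x e = 0"
    proof (rule alg_independent_imp_trivial_kernel[OF gen[unfolded generic_iff] fin vars,
      where b = "coord_eval q"])
      show "y u = 0" if "\<And>k. k \<in> {1, 2} \<times> V \<Longrightarrow> (\<Sum>u\<in>?P. meval_rat (C k u) (coord_eval q) * y u) = 0"
          "u \<in> ?P" for y u
        using q that unfolding no_stress_iff[OF G(1)] ev by blast
      show "(\<Sum>u\<in>?P. meval_rat (C k u) (coord_eval (coord a b)) * x u) = 0" if "k \<in> {1, 2} \<times> V" for k
        using x that unfolding ev by blast
    qed (use e in auto)
  qed
qed

text \<open>The matrix specialises to the identity; injectivity of \<open>inj_var\<close> keeps
  diagonal and off-diagonal entries apart.\<close>

lemma alg_independent_square_trivial_kernel:
  assumes alg: "alg_independent_rat W \<alpha>" and W: "\<And>i j. i \<in> {1..N} \<Longrightarrow> j \<in> {1..N} \<Longrightarrow> inj_var i j \<in> W"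
    and inj: "\<And>i j i' j'. inj_var i j = inj_var i' j' \<Longrightarrow> i = i' \<and> j = j'"
    and x: "\<And>i. i \<in> {1..N} \<Longrightarrow> (\<Sum>j\<in>{1..N}. \<alpha> (inj_var i j) * x j) = 0" and j: "j \<in> {1..N::nat}"
  shows "x j = (0::real)"
proof (rule alg_independent_imp_trivial_kernel[OF alg, where K = "{1..N}" and U = "{1..N}" and
      C = "\<lambda>i j. mvar (inj_var i j)" and b = "\<lambda>v. if \<exists>i. v = inj_var i i then 1 else 0"])
  fix y :: "nat \<Rightarrow> real" and u
  assume y: "\<And>k. k \<in> {1..N} \<Longrightarrow>
      (\<Sum>u\<in>{1..N}. meval_rat (mvar (inj_var k u)) (\<lambda>v. if \<exists>i. v = inj_var i i then 1 else 0) * y u) =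
          0"
    and u: "u \<in> {1..N}"
  have "(\<exists>i. inj_var u v = inj_var i i) \<longleftrightarrow> v = u" for v using inj by metis
  then have "(\<Sum>v\<in>{1..N}. (if v = u then 1 else 0) * y v) = 0"
    using y[OF u] unfolding meval_rat_mvar by simp
  then show "y u = 0" using u by (simp add: if_distrib[of "\<lambda>z. z * _"] cong: if_cong)
qed (use assms in \<open>auto simp: mvars_mvar meval_rat_mvar\<close>)


section \<open>From stresses to the shifted graph\<close>

definition bip_edges :: "(nat \<times> nat) set \<Rightarrow> ((nat + nat) \<times> (nat + nat)) set" where
  "bip_edges E = {(Inl i, Inr j) | i j. (i, j) \<in> E} \<union> {(Inr j, Inl i) | i j. (i, j) \<in> E}"

lemma bigraph_bip_edges:
  assumes "E \<subseteq> {1..n} \<times> {1..m}"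
  shows "bigraph isl (bip_verts n m) (bip_edges E)"
  using assms unfolding bigraph_def bip_edges_def bip_verts_def sym_def by auto

lemma forward_bip_edges: "forward_edges isl (bip_edges E) = (\<lambda>e. (Inl (fst e), Inr (snd e))) ` E"
  unfolding forward_edges_def bip_edges_def by force

text \<open>Grouping the edges by an endpoint turns the equation for one row of a \<theta> matrix
  into an equation in the vertex sums.\<close>

lemma sum_group_by_value:
  fixes f :: "nat \<Rightarrow> real"
  assumes "\<And>e. e \<in> E \<Longrightarrow> h e \<in> {1..n::nat}"
  shows "(\<Sum>e\<in>E. f (h e) * g e) = (\<Sum>s\<in>{1..n}. f s * (\<Sum>e\<in>E. (if s = h e then 1 else 0) * g e))"
proof -
  have "(\<Sum>e\<in>E. f (h e) * g e) = (\<Sum>e\<in>E. \<Sum>s\<in>{1..n}. if s = h e then f s * g e else 0)"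
    using assms by (intro sum.cong refl) simp
  also have "\<dots> = (\<Sum>s\<in>{1..n}. \<Sum>e\<in>E. if s = h e then f s * g e else 0)" by (rule sum.swap)
  also have "\<dots> = (\<Sum>s\<in>{1..n}. f s * (\<Sum>e\<in>E. (if s = h e then 1 else 0) * g e))"
    unfolding sum_distrib_left by (intro sum.cong refl) simp
  finally show ?thesis .
qed

lemma planar_no_stress:
  assumes E: "E \<subseteq> {1..n} \<times> {1..m}" and "planar (bip_graph n m E)"
    and gen: "generic n m a b" and nm: "2 \<le> n" "2 \<le> m"
  shows "no_stress (bip_verts n m) (bip_edges E) (coord a b)"
proof (rule no_K33_minor_imp_no_stress[where side = isl and ?V0.0 = "bip_verts n m"])
  note G = bigraph_bip_edges[OF E]
  show "\<not> K33_minor (bip_edges E)"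
  proof (rule planar_no_K33_minor[OF assms(2)])
    show "finite (fst (bip_graph n m E))" by (simp add: bip_graph_def bip_verts_def)
    show "sym (bip_edges E)" using bigraphD(3)[OF G] .
    fix x y assume "(x, y) \<in> bip_edges E"
    then obtain i j where ij: "(i, j) \<in> E" "{x, y} = {Inl i, Inr j}"
      by (auto simp: bip_edges_def)
    have "{x, y} \<in> snd (bip_graph n m E)"
      unfolding bip_graph_def snd_conv ij(2)
        by (rule image_eqI[OF _ ij(1)]) (simp add: pair_set_def)
    moreover have "{x, y} \<subseteq> bip_verts n m" unfolding ij(2) using ij(1) E
      by (auto simp: bip_verts_def)
    ultimately show "{x, y} \<in> snd (bip_graph n m E) \<and> x \<in> fst (bip_graph n m E) \<and>
        y \<in> fst (bip_graph n m E)"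
      by (simp add: bip_graph_def)
  qed
  show "bigraph isl (bip_verts n m) (bip_edges E)" by (rule G)
qed (use generic_no_stress[OF gen nm] generic_independent2[OF gen nm] in auto)

text \<open>A functional on the edges that kills these products is a stress, hence zero by
  planarity, so nothing separates \<open>t\<close> from their span.\<close>

lemma theta_products_span:
  assumes E: "E \<subseteq> {1..n} \<times> {1..m}" and pl: "planar (bip_graph n m E)"
    and gen: "generic n m a b" and nm: "2 \<le> n" "2 \<le> m"
  defines "K \<equiv> {pq \<in> {1..n} \<times> {1..m}. fst pq \<le> 2 \<or> snd pq \<le> 2}"
  shows "\<exists>y. \<forall>e\<in>E. t e = (\<Sum>k\<in>K. y k * (a (fst k) (fst e) * b (snd k) (snd e)))"
proof -
  note alg = gen[unfolded generic_iff]
  have fin: "finite K" "finite E" using E finite_subset by (auto simp: K_def)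
  have False if x: "\<forall>k\<in>K. (\<Sum>e\<in>E. a (fst k) (fst e) * b (snd k) (snd e) * x e) = 0"
    and nz: "(\<Sum>e\<in>E. t e * x e) \<noteq> 0" for x
  proof -
    let ?V = "bip_verts n m" and ?P = "forward_edges isl (bip_edges E)"
    \<comment> \<open>For fixed \<open>k\<close> the row \<open>p\<close> ranges over all of
      \<open>{1..n}\<close>, so the vanishing products form a square generic system in the vertex
      sums. Its trivial kernel gives the balance equation at \<open>Inl s\<close>.\<close>
    have A: "(\<Sum>e\<in>E. (if s = fst e then 1 else 0) * (b k (snd e) * x e)) = 0" if k: "k \<in> {1, 2}"
      and s: "s \<in> {1..n}" for k s
    proof (rule alg_independent_square_trivial_kernel[OF alg, where N = n
      and inj_var = "\<lambda>i j. Inl (i, j)"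
          and x = "\<lambda>s. \<Sum>e\<in>E. (if s = fst e then 1 else 0) * (b k (snd e) * x e)"])
      fix p assume p: "p \<in> {1..n}"
      have "(p, k) \<in> K" using p k nm by (auto simp: K_def)
      then have "(\<Sum>e\<in>E. a p (fst e) * b k (snd e) * x e) = 0" using x by force
      then have "0 = (\<Sum>e\<in>E. a p (fst e) * (b k (snd e) * x e))" by (simp add: mult.assoc)
      also have "\<dots> = (\<Sum>s\<in>{1..n}. a p s * (\<Sum>e\<in>E. (if s =
          fst e then 1 else 0) * (b k (snd e) * x e)))"
        using E by (intro sum_group_by_value) auto
      finally show "(\<Sum>j\<in>{1..n}. coord_eval (coord a b) (Inl (p, j)) * (\<Sum>e\<in>E. (if j =
          fst e then 1 else 0) * (b k (snd e) * x e))) = 0"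
        by (simp add: coord_eval_def coord_def)
    qed (use s in \<open>auto simp: generic_vars_def\<close>)
    have B: "(\<Sum>e\<in>E. (if s = snd e then 1 else 0) * (a k (fst e) * x e)) = 0" if k: "k \<in> {1, 2}"
      and s: "s \<in> {1..m}" for k s
    proof (rule alg_independent_square_trivial_kernel[OF alg, where N = m
      and inj_var = "\<lambda>i j. Inr (i, j)"
          and x = "\<lambda>s. \<Sum>e\<in>E. (if s = snd e then 1 else 0) * (a k (fst e) * x e)"])
      fix p assume p: "p \<in> {1..m}"
      have "(k, p) \<in> K" using p k nm by (auto simp: K_def)
      then have "(\<Sum>e\<in>E. a k (fst e) * b p (snd e) * x e) = 0" using x by force
      then have "0 = (\<Sum>e\<in>E. b p (snd e) * (a k (fst e) * x e))" by (simp add: mult_ac)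
      also have "\<dots> = (\<Sum>s\<in>{1..m}. b p s * (\<Sum>e\<in>E. (if s =
          snd e then 1 else 0) * (a k (fst e) * x e)))"
        using E by (intro sum_group_by_value) auto
      finally show "(\<Sum>j\<in>{1..m}. coord_eval (coord a b) (Inr (p, j)) * (\<Sum>e\<in>E. (if j =
          snd e then 1 else 0) * (a k (fst e) * x e))) = 0"
        by (simp add: coord_eval_def coord_def)
    qed (use s in \<open>auto simp: generic_vars_def\<close>)
    define x' where "x' e = x (projl (fst e), projr (snd e))" for e :: "(nat + nat) \<times> (nat + nat)"
    have inj: "inj_on (\<lambda>e. (Inl (fst e), Inr (snd e)) :: (nat + nat) \<times> (nat + nat)) E"
      by (auto simp: inj_on_def prod_eq_iff)
    have sum_P: "(\<Sum>e\<in>?P. edge_coeff (coord a b) kv e * x' e) =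
        (\<Sum>e\<in>E. edge_coeff (coord a b) kv (Inl (fst e), Inr (snd e)) * x e)" for kv
      unfolding forward_bip_edges sum.reindex[OF inj] by (simp add: x'_def o_def)
    have "(\<Sum>e\<in>?P. edge_coeff (coord a b) kv e * x' e) = 0" if kv: "kv \<in> {1, 2} \<times> ?V" for kv
    proof -
      obtain k v where kv': "kv = (k, v)" "k \<in> {1, 2}" "v \<in> ?V" using kv by auto
      from kv'(3) consider s where "v = Inl s" "s \<in> {1..n}" | s where "v = Inr s" "s \<in> {1..m}"
        unfolding bip_verts_def by blast
      then show ?thesis
      proof cases
        case 1
        have "(\<Sum>e\<in>E. edge_coeff (coord a b) kv (Inl (fst e), Inr (snd e)) * x e) =
            (\<Sum>e\<in>E. (if s = fst e then 1 else 0) * (b k (snd e) * x e))"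
          unfolding kv' 1 by (intro sum.cong refl) (simp add: edge_coeff_def coord_def)
        then show ?thesis unfolding sum_P using A[OF kv'(2) 1(2)] by simp
      next
        case 2
        have "(\<Sum>e\<in>E. edge_coeff (coord a b) kv (Inl (fst e), Inr (snd e)) * x e) =
            (\<Sum>e\<in>E. (if s = snd e then 1 else 0) * (a k (fst e) * x e))"
          unfolding kv' 2 by (intro sum.cong refl) (simp add: edge_coeff_def coord_def)
        then show ?thesis unfolding sum_P using B[OF kv'(2) 2(2)] by simp
      qed
    qed
    then have "\<forall>e\<in>?P. x' e = 0"
      using planar_no_stress[OF E pl gen nm] unfolding no_stress_iff[OF bigraph_bip_edges[OF E]]
        by blast
    then have "x e = 0" if "e \<in> E" for e
      using that unfolding forward_bip_edges by (auto simp: x'_def)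
    then show False using nz by simp
  qed
  then show ?thesis using span_or_separating_functional[OF fin, of t
      "\<lambda>k e. a (fst k) (fst e) * b (snd k) (snd e)"]
    by blast
qed

text \<open>The pairs with an index at most \<open>2\<close> all precede \<open>(i, j)\<close>, and
  their products already span everything on the edges.\<close>

lemma high_pair_notin_balanced_shifting:
  assumes E: "E \<subseteq> {1..n} \<times> {1..m}" and pl: "planar (bip_graph n m E)"
    and gen: "generic n m a b" and adm: "admissible n m 2 2 r" and ij: "3 \<le> i" "3 \<le> j"
  shows "(i, j) \<notin> balanced_shifting n m E a b r"
proof
  assume "(i, j) \<in> balanced_shifting n m E a b r"
  then have nm: "i \<le> n" "j \<le> m" and notin: "theta_prod n m E a b (i, j) \<notin>
        graph_ring_span n m E (theta_prod n m E a b)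
          {pq \<in> {1..n} \<times> {1..m}. lex_less r (pair_set pq) (pair_set (i, j))}"
    by (auto simp: balanced_shifting_def)
  let ?K = "{pq \<in> {1..n} \<times> {1..m}. fst pq \<le> 2 \<or> snd pq \<le> 2}"
  let ?L = "{pq \<in> {1..n} \<times> {1..m}. lex_less r (pair_set pq) (pair_set (i, j))}"
  obtain y where y: "\<forall>e\<in>E. a i (fst e) * b j (snd e) =
      (\<Sum>k\<in>?K. y k * (a (fst k) (fst e) * b (snd k) (snd e)))"
    using theta_products_span[OF E pl gen, of "\<lambda>e. a i (fst e) * b j (snd e)"] nm ij by force
  have KL: "?K \<subseteq> ?L" using lex_less_admissible[OF adm, of i j] nm ij by auto
  have fin: "finite ?L" by (rule finite_subset[of _ "{1..n} \<times> {1..m}"]) auto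
  have "theta_prod n m E a b (i, j) \<in> graph_ring_span n m E (theta_prod n m E a b) ?L"
  \<comment> \<open>The remaining pairs below \<open>(i, j)\<close> receive coefficient
    zero.\<close>
  proof (rule theta_prod_in_span[OF fin, where y = "\<lambda>k. if k \<in> ?K then y k else 0"])
    fix s t assume "(s, t) \<in> E"
    then have "a i s * b j t = (\<Sum>k\<in>?K. y k * (a (fst k) s * b (snd k) t))" using y by force
    also have "\<dots> = (\<Sum>k\<in>?L. (if k \<in> ?K then y k else 0) * (a (fst k) s * b (snd k) t))"
      using fin KL by (intro sum.mono_neutral_cong_left) auto
    finally show "a i s * b j t =
        (\<Sum>k\<in>?L. (if k \<in> ?K then y k else 0) * (a (fst k) s * b (snd k) t))" .
  qed
  with notin show False ..
qed

theorem theorem4p1: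
  fixes n m :: nat and E :: "(nat \<times> nat) set"
    and a b :: "nat \<Rightarrow> nat \<Rightarrow> real" and r :: "(nat + nat) rel"
  assumes "E \<subseteq> {1..n} \<times> {1..m}"
    and "planar (bip_graph n m E)"
    and "generic n m a b"
    and "admissible n m 2 2 r"
  shows "\<not> subgraph_copy (complete_bipartite 3 3) (bip_graph n m (balanced_shifting n m E a b r))
         \<and> stress_free n m E a b 2 2"
proof
  note high = high_pair_notin_balanced_shifting[OF assms]
  show "\<not> subgraph_copy (complete_bipartite 3 3) (bip_graph n m (balanced_shifting n m E a b r))"
    using high by (metis K33_copy_high_edge)
  show "stress_free n m E a b 2 2"
    unfolding stress_free_iff[OF assms(4)] using high[of 3 3] by simp
qed

end
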